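(* Let $G=(V,\mathcal E,T)$ be a temporal graph with $n=|V|$ and $m=|\mathcal E|$, and fix either the non-strict or the strict setting. (i) For passive walks, the betweenness centralities $B(v,t)$ of all temporal nodes $(v,t)\in V\times[T]$ can be computed in $O(n^2T+nmT)$ time. This holds for each of the following costs: shortest walks, shortest $k$-restless walks (any $k\in\mathbb N$), and shortest foremost walks. (ii) For active walks, the betweenness centralities $B(v,t)$ of all temporal nodes can be computed in $O(n^2T^2+nmT)$ time. This holds for the cost of shortest walks and for the cost of shortest $k$-restless walks.
   Context: **Temporal graphs and walks.** - A temporal graph is $G=(V,\mathcal E,T)$, where $V$ is a finite node set, $T\in\mathbb N$, $[T]=\{1,\dots,T\}$, and $\mathcal E\subseteq V\times V\times[T]$ is a set of temporal arcs with no self-loops. Pairs $(v,t)\in V\times[T]$ are temporal nodes. - A walk is a sequence $W=(e_1,\dots,e_r)$ with $r\ge1$ and $e_i=(u_i,v_i,t_i)\in\mathcal E$, such that $u_{i+1}=v_i$ for $1\le i<r$. - In the non-strict setting, $t_i\le t_{i+1}$; in the strict setting, $t_i<t_{i+1}$. - $W$ is an $s$–$z$ walk if $u_1=s$ and $v_r=z$. - $\mathrm{len}(W)=r$ and $\mathrm{arr}(W)=t_r$. - For $k\in\mathbb N\cup\{\infty\}$, $W$ is $k$-restless if $t_{i+1}-t_i\le k$ for all $i$ (no condition when $k=\infty$). **Visited temporal nodes.** - Passive walks: $\mathrm{Vis}(W)=\{(u_1,t_1)\}\cup\{(v_i,t_i):1\le i\le r\}$. - Active walks: $\mathrm{Vis}(W)=\{(u_1,t_1)\}\cup\{(v_i,t):1\le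 i<r,\ t_i\le t\le t_{i+1}\}\cup\{(v_r,t):t_r\le t\le T\}$. The last set corresponds to extending the walk on its final node up to time $T$. **Costs and optimal walk sets**, for $s\neq z$: - Shortest ($k=\infty$) or shortest $k$-restless: $\mathcal W^\star_{sz}$ is the set of $k$-restless $s$–$z$ walks of minimum length. - Shortest foremost: $\mathcal W^\star_{sz}$ is the set of $s$–$z$ walks minimizing $n\cdot\mathrm{arr}(W)+\mathrm{len}(W)$. **Counts and betweenness.** - $\sigma_{sz}=|\mathcal W^\star_{sz}|$. - $\sigma_{sz}(v,t)=|\{W\in\mathcal W^\star_{sz}:(v,t)\in\mathrm{Vis}(W)\}|$. - $\delta_{sz}(v,t)=\sigma_{sz}(v,t)/\sigma_{sz}$ if $\sigma_{sz}>0$, and $\delta_{sz}(v,t)=0$ otherwise. - $B(v,t)=\sum_{s,z\in V,\ s\ne v\ne z,\ s\neq z}\delta_{sz}(v,t)$. **Model of computation.** Running time is counted in a RAM model with unit-cost arithmetic operations. *)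

theory Defs
  imports Complex_Main "HOL-Library.Extended_Nat"
begin

text \<open>The node set V is identified with {0..<n}; a temporal arc (u,v,t) is a triple of naturals.
  The arc set is given as a duplicate-free list es (the input), with E = set es and m = length es.\<close>

type_synonym arc = "nat \<times> nat \<times> nat"

definition src :: "arc \<Rightarrow> nat" where "src e = fst e"
definition dst :: "arc \<Rightarrow> nat" where "dst e = fst (snd e)"
definition tm  :: "arc \<Rightarrow> nat" where "tm e = snd (snd e)"

definition wf_tgraph :: "nat \<Rightarrow> nat \<Rightarrow> arc list \<Rightarrow> bool" where
  "wf_tgraph n T es \<longleftrightarrow> distinct es \<and>
     (\<forall>e\<in>set es. src e < n \<and> dst e < n \<and> src e \<noteq> dst e \<and> 1 \<le> tm e \<and> tm e \<le> T)"

definition is_walk :: "bool \<Rightarrow> arc set \<Rightarrow> arc list \<Rightarrow> bool" where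
  "is_walk strict E W \<longleftrightarrow> W \<noteq> [] \<and> set W \<subseteq> E \<and>
     (\<forall>i. Suc i < length W \<longrightarrow> dst (W ! i) = src (W ! Suc i) \<and>
        (if strict then tm (W ! i) < tm (W ! Suc i) else tm (W ! i) \<le> tm (W ! Suc i)))"

definition is_sz_walk :: "bool \<Rightarrow> arc set \<Rightarrow> nat \<Rightarrow> nat \<Rightarrow> arc list \<Rightarrow> bool" where
  "is_sz_walk strict E s z W \<longleftrightarrow> is_walk strict E W \<and> src (hd W) = s \<and> dst (last W) = z"

definition arr :: "arc list \<Rightarrow> nat" where "arr W = tm (last W)"

definition restless :: "enat \<Rightarrow> arc list \<Rightarrow> bool" where
  "restless k W \<longleftrightarrow> (\<forall>i. Suc i < length W \<longrightarrow> enat (tm (W ! Suc i) - tm (W ! i)) \<le> k)"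

datatype mode = Passive | Active

definition Vis :: "mode \<Rightarrow> nat \<Rightarrow> arc list \<Rightarrow> (nat \<times> nat) set" where
  "Vis md T W = (case md of
     Passive \<Rightarrow> {(src (hd W), tm (hd W))} \<union> {(dst (W ! i), tm (W ! i)) | i. i < length W}
   | Active \<Rightarrow> {(src (hd W), tm (hd W))}
        \<union> {(dst (W ! i), t) | i t. Suc i < length W \<and> tm (W ! i) \<le> t \<and> t \<le> tm (W ! Suc i)}
        \<union> {(dst (last W), t) | t. tm (last W) \<le> t \<and> t \<le> T})"

text \<open>Restless k: shortest k-restless walks (k = \<infinity> gives shortest walks);
  Foremost: shortest foremost walks (minimise n * arr W + len W).\<close>
datatype cost = Restless enat | Foremost

definition argmin_set :: "'a set \<Rightarrow> ('a \<Rightarrow> nat) \<Rightarrow> 'a set" where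
  "argmin_set A f = {x \<in> A. \<forall>y\<in>A. f x \<le> f y}"

definition opt_walks :: "bool \<Rightarrow> cost \<Rightarrow> nat \<Rightarrow> arc set \<Rightarrow> nat \<Rightarrow> nat \<Rightarrow> arc list set" where
  "opt_walks strict c n E s z = (case c of
     Restless k \<Rightarrow> argmin_set {W. is_sz_walk strict E s z W \<and> restless k W} length
   | Foremost \<Rightarrow> argmin_set {W. is_sz_walk strict E s z W} (\<lambda>W. n * arr W + length W))"

definition sigma :: "bool \<Rightarrow> cost \<Rightarrow> nat \<Rightarrow> arc set \<Rightarrow> nat \<Rightarrow> nat \<Rightarrow> nat" where
  "sigma strict c n E s z = card (opt_walks strict c n E s z)"

definition sigma_at :: "bool \<Rightarrow> mode \<Rightarrow> cost \<Rightarrow> nat \<Rightarrow> nat \<Rightarrow> arc set \<Rightarrow> nat \<Rightarrow> nat \<Rightarrow> nat \<Rightarrow> nat \<Rightarrow> nat" where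
  "sigma_at strict md c n T E s z v t =
     card {W \<in> opt_walks strict c n E s z. (v, t) \<in> Vis md T W}"

definition delta :: "bool \<Rightarrow> mode \<Rightarrow> cost \<Rightarrow> nat \<Rightarrow> nat \<Rightarrow> arc set \<Rightarrow> nat \<Rightarrow> nat \<Rightarrow> nat \<Rightarrow> nat \<Rightarrow> real" where
  "delta strict md c n T E s z v t =
     (if sigma strict c n E s z > 0
      then real (sigma_at strict md c n T E s z v t) / real (sigma strict c n E s z) else 0)"

definition betweenness :: "bool \<Rightarrow> mode \<Rightarrow> cost \<Rightarrow> nat \<Rightarrow> nat \<Rightarrow> arc set \<Rightarrow> nat \<Rightarrow> nat \<Rightarrow> real" where
  "betweenness strict md c n T E v t =
     (\<Sum>(s, z) \<in> {(s, z). s < n \<and> z < n \<and> s \<noteq> v \<and> v \<noteq> z \<and> s \<noteq> z}.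
        delta strict md c n T E s z v t)"

datatype exp = Cst rat | Mem exp | Add exp exp | Sub exp exp | Mul exp exp | Dvd exp exp
  | Less exp exp | Equ exp exp | Flr exp

type_synonym memory = "int \<Rightarrow> rat"

fun eval :: "exp \<Rightarrow> memory \<Rightarrow> rat" where
  "eval (Cst q) s = q"
| "eval (Mem a) s = s \<lfloor>eval a s\<rfloor>"
| "eval (Add a b) s = eval a s + eval b s"
| "eval (Sub a b) s = eval a s - eval b s"
| "eval (Mul a b) s = eval a s * eval b s"
| "eval (Dvd a b) s = eval a s / eval b s"
| "eval (Less a b) s = (if eval a s < eval b s then 1 else 0)"
| "eval (Equ a b) s = (if eval a s = eval b s then 1 else 0)"
| "eval (Flr a) s = of_int \<lfloor>eval a s\<rfloor>"

fun ecost :: "exp \<Rightarrow> nat" where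
  "ecost (Cst q) = 1"
| "ecost (Mem a) = 1 + ecost a"
| "ecost (Add a b) = 1 + ecost a + ecost b"
| "ecost (Sub a b) = 1 + ecost a + ecost b"
| "ecost (Mul a b) = 1 + ecost a + ecost b"
| "ecost (Dvd a b) = 1 + ecost a + ecost b"
| "ecost (Less a b) = 1 + ecost a + ecost b"
| "ecost (Equ a b) = 1 + ecost a + ecost b"
| "ecost (Flr a) = 1 + ecost a"

datatype com = Skip | Store exp exp | Seq com com | If exp com com | While exp com

inductive exec :: "com \<Rightarrow> memory \<Rightarrow> nat \<Rightarrow> memory \<Rightarrow> bool" where
  "exec Skip s 1 s"
| "exec (Store a e) s (1 + ecost a + ecost e) (s(\<lfloor>eval a s\<rfloor> := eval e s))"
| "exec c1 s k1 s1 \<Longrightarrow> exec c2 s1 k2 s2 \<Longrightarrow> exec (Seq c1 c2) s (k1 + k2) s2"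
| "eval b s \<noteq> 0 \<Longrightarrow> exec c1 s k s' \<Longrightarrow> exec (If b c1 c2) s (1 + ecost b + k) s'"
| "eval b s = 0 \<Longrightarrow> exec c2 s k s' \<Longrightarrow> exec (If b c1 c2) s (1 + ecost b + k) s'"
| "eval b s = 0 \<Longrightarrow> exec (While b c) s (1 + ecost b) s"
| "eval b s \<noteq> 0 \<Longrightarrow> exec c s k1 s1 \<Longrightarrow> exec (While b c) s1 k2 s2 \<Longrightarrow>
     exec (While b c) s (1 + ecost b + k1 + k2) s2"

text \<open>Input: cell 0 = n, cell 1 = T, cell 2 = m, cell 3 = k (restless parameter, 0 if unused),
  cells 4+3i, 5+3i, 6+3i = u, v, t of the i-th arc (i < m); all other cells 0.
  Output: B(v,t) is expected in cell -1 - (v*T + (t-1)).\<close>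

definition input :: "nat \<Rightarrow> nat \<Rightarrow> arc list \<Rightarrow> nat \<Rightarrow> memory" where
  "input n T es k = (\<lambda>a.
     if a = 0 then of_nat n else if a = 1 then of_nat T
     else if a = 2 then of_nat (length es) else if a = 3 then of_nat k
     else if 4 \<le> a \<and> a < 4 + 3 * int (length es) then
       (let i = nat (a - 4) div 3; j = nat (a - 4) mod 3; e = es ! i in
        of_nat (if j = 0 then src e else if j = 1 then dst e else tm e))
     else 0)"

definition out_addr :: "nat \<Rightarrow> nat \<Rightarrow> nat \<Rightarrow> int" where
  "out_addr T v t = - 1 - int (v * T + (t - 1))"

definition computes_betweenness ::
  "com \<Rightarrow> nat \<Rightarrow> (nat \<Rightarrow> nat \<Rightarrow> nat \<Rightarrow> nat) \<Rightarrow> bool \<Rightarrow> mode \<Rightarrow> cost \<Rightarrow> nat \<Rightarrow> bool" where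
  "computes_betweenness P C bound strict md c k \<longleftrightarrow>
     (\<forall>n T es. wf_tgraph n T es \<longrightarrow>
        (\<exists>steps s'. exec P (input n T es k) steps s' \<and>
           steps \<le> C * (bound n T (length es) + 1) \<and>
           (\<forall>v < n. \<forall>t \<in> {1..T}.
              real_of_rat (s' (out_addr T v t)) = betweenness strict md c n T (set es) v t)))"

definition bound_passive :: "nat \<Rightarrow> nat \<Rightarrow> nat \<Rightarrow> nat" where
  "bound_passive n T m = n ^ 2 * T + n * m * T"

definition bound_active :: "nat \<Rightarrow> nat \<Rightarrow> nat \<Rightarrow> nat" where
  "bound_active n T m = n ^ 2 * T ^ 2 + n * m * T"

end

theory Submission
  imports Defs "HOL-Library.Nat_Bijection"
begin

text \<open>Fix a source \<open>s\<close>. Consider the graph on the temporal nodes and a root \<open>(s, 0)\<close> in which an arc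
  \<open>(u, v, t)\<close> leads to \<open>(v, t)\<close> from every \<open>(u, t')\<close> where a walk may take it next; it has \<open>O(mT)\<close> edges.
  Breadth-first search yields the distances \<open>D\<close> and the numbers \<open>S\<close> of shortest paths from the root.
  The optimal walks to \<open>z\<close> are the shortest paths to those \<open>(z, t)\<close> that minimise \<open>a t + D(z, t)\<close>, where
  \<open>a = 0\<close> for shortest and \<open>a = n\<close> for shortest foremost walks; \<open>k = \<infinity>\<close> amounts to \<open>k = T\<close>.
  As in Brandes' algorithm, a backward recursion along tight edges yields the weighted number \<open>g\<close> of
  optimal continuations, and \<open>s\<close> contributes \<open>S (g - w)\<close> to the passive betweenness, where \<open>w\<close> is the weight
  of ending here.

  Active walks are in addition at \<open>v\<close> during the waiting periods, which correspond to the tight edges leaving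
  \<open>v\<close> and are collected in a difference array. A walk is counted twice by this if it waits at \<open>v\<close> until
  time \<open>t\<close> and returns to \<open>v\<close> still at time \<open>t\<close>. It then runs through a shortest cycle through \<open>v\<close> in the
  snapshot at time \<open>t\<close>; these cycles are counted beforehand, by searches with \<open>k = 0\<close>.\<close>

section \<open>A small array language for the RAM\<close>

text \<open>The graph of temporal nodes has at most m(T+1) edges, so \<open>n\<close> searches fit
  into both bounds, but visiting every moment of every waiting period would not. Each waiting period
  therefore leaves only two entries in a difference array, whose prefix sums are taken once per node
  and source. The correction for double visits is the only place where a second factor T arises: for
  every source and every temporal node \<open>(v, t)\<close> all earlier arrival times at
  \<open>v\<close> are scanned. A scan step takes constant time because the cycle in the snapshot
  does not depend on when \<open>v\<close> was entered, apart from the test that the wait is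
  permitted; \<open>n\<close> searches, one for each \<open>v\<close>, thus serve all sources. On
  the machine side, the cost of a command is bounded by its text. It is enough to count commands of
  a small array language, whose clock ticks once per command and per loop round, and to compile this
  language with constant overhead. Subtracting only the weight of ending here is right because an
  optimal walk to \<open>v\<close> ends at its first visit of \<open>v\<close>.\<close>

type_synonym store = "nat \<times> nat \<times> nat \<times> nat \<Rightarrow> rat"

text \<open>\<open>In\<close> reads an input cell, \<open>Rd\<close> a cell of a numbered
  three-dimensional array. The input is a separate read-only function: arrays will lie at negative
  addresses, so running a program leaves the input cells alone.\<close>

datatype aexp = Num rat | In aexp | Rd nat aexp aexp aexp | Plus aexp aexp | Minus aexp aexp
  | Times aexp aexp | Divide aexp aexp | Lt aexp aexp | Eq aexp aexp

definition idx :: "rat \<Rightarrow> nat" where "idx x = nat \<lfloor>x\<rfloor>"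

lemma idx_of_nat [simp]: "idx (of_nat i) = i"
  by (simp add: idx_def)

lemma idx_numeral [simp]: "idx 0 = 0" "idx 1 = 1" "idx (numeral k) = numeral k"
  by (simp_all add: idx_def)

primrec aval :: "(nat \<Rightarrow> rat) \<Rightarrow> aexp \<Rightarrow> store \<Rightarrow> rat" where
  "aval I (Num q) s = q"
| "aval I (In a) s = I (idx (aval I a s))"
| "aval I (Rd c a b d) s = s (c, idx (aval I a s), idx (aval I b s), idx (aval I d s))"
| "aval I (Plus a b) s = aval I a s + aval I b s"
| "aval I (Minus a b) s = aval I a s - aval I b s"
| "aval I (Times a b) s = aval I a s * aval I b s"
| "aval I (Divide a b) s = aval I a s / aval I b s"
| "aval I (Lt a b) s = of_bool (aval I a s < aval I b s)"
| "aval I (Eq a b) s = of_bool (aval I a s = aval I b s)"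

datatype acom = Nop | Wr nat aexp aexp aexp aexp | Sq acom acom (infixr ";;" 60)
  | Cond aexp acom acom | For nat aexp acom

definition round :: "nat \<Rightarrow> nat \<Rightarrow> store \<times> nat \<Rightarrow> store \<times> nat" where
  "round x i y = ((fst y)((x, 0, 0, 0) := of_nat i), Suc (snd y))"

text \<open>The second component of a configuration is a clock. The bound of a \<open>For\<close> loop is evaluated
  once, and its counter (cell 0 of the named array) is reset from a hidden register in every round,
  so that loops terminate whatever the body does.\<close>

primrec run :: "(nat \<Rightarrow> rat) \<Rightarrow> acom \<Rightarrow> store \<times> nat \<Rightarrow> store \<times> nat" where
  "run I Nop = (\<lambda>(s, \<tau>). (s, Suc \<tau>))"
| "run I (Wr c a b d e) =
     (\<lambda>(s, \<tau>). (s((c, idx (aval I a s), idx (aval I b s), idx (aval I d s)) := aval I e s), Suc \<tau>))"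
| "run I (c1 ;; c2) = (\<lambda>x. run I c2 (run I c1 x))"
| "run I (Cond b c1 c2) = (\<lambda>(s, \<tau>). if aval I b s \<noteq> 0 then run I c1 (s, Suc \<tau>) else run I c2 (s, Suc \<tau>))"
| "run I (For x e c) = (\<lambda>(s, \<tau>).
     fold (\<lambda>i y. run I c (round x i y)) [0..<idx (aval I e s)] (s, Suc \<tau>))"

definition wp :: "(nat \<Rightarrow> rat) \<Rightarrow> acom \<Rightarrow> (store \<Rightarrow> nat \<Rightarrow> bool) \<Rightarrow> store \<Rightarrow> nat \<Rightarrow> bool" where
  "wp I c Q s \<tau> = (case run I c (s, \<tau>) of (s', \<tau>') \<Rightarrow> Q s' \<tau>')"

lemma wp_simps [simp]:
  "wp I Nop Q s \<tau> = Q s (Suc \<tau>)"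
  "wp I (Wr c a b d e) Q s \<tau> =
     Q (s((c, idx (aval I a s), idx (aval I b s), idx (aval I d s)) := aval I e s)) (Suc \<tau>)"
  "wp I (c1 ;; c2) Q s \<tau> = wp I c1 (wp I c2 Q) s \<tau>"
  "wp I (Cond b c1 c2) Q s \<tau> = (if aval I b s \<noteq> 0 then wp I c1 Q s (Suc \<tau>) else wp I c2 Q s (Suc \<tau>))"
  by (auto simp: wp_def split: prod.splits)

text \<open>The invariant \<open>J\<close> also speaks about the clock, so that correctness and
  running time of a loop come out of one induction. The body of a round starts after its tick, with
  the counter already set.\<close>

lemma wp_For:
  assumes "idx (aval I e s) = N" "J 0 s (Suc \<tau>)"
    and step: "\<And>i s \<tau>. i < N \<Longrightarrow> J i s \<tau> \<Longrightarrow> wp I c (J (Suc i)) (s((x, 0, 0, 0) := of_nat i)) (Suc \<tau>)"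
    and "\<And>s \<tau>. J N s \<tau> \<Longrightarrow> Q s \<tau>"
  shows "wp I (For x e c) Q s \<tau>"
proof -
  let ?f = "\<lambda>i y. run I c (round x i y)"
  have "M \<le> N \<Longrightarrow> case fold ?f [0..<M] (s, Suc \<tau>) of (s', \<tau>') \<Rightarrow> J M s' \<tau>'" for M
  proof (induction M)
    case (Suc M)
    obtain s1 \<tau>1 where *: "fold ?f [0..<M] (s, Suc \<tau>) = (s1, \<tau>1)"
      by fastforce
    then have "J M s1 \<tau>1"
      using Suc by simp
    from step[OF _ this] Suc.prems * show ?case
      by (simp add: wp_def round_def)
  qed (use assms in auto)
  from this[of N] show ?thesis
    using assms by (auto simp: wp_def split: prod.splits)
qed

text \<open>Monotonicity of the clock is what allows the constant of a simulation to be enlarged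
  later.\<close>

lemma run_clock: "\<tau> \<le> snd (run I c (s, \<tau>))"
proof (induction c arbitrary: s \<tau>)
  case (Sq c1 c2)
  then show ?case
    by (metis comp_apply le_trans prod.collapse run.simps(3))
next
  case (Cond b c1 c2)
  then show ?case
    by (simp add: Suc_leD)
next
  case (For x e c)
  let ?f = "\<lambda>i y. run I c (round x i y)"
  have "\<tau>' \<le> snd (fold ?f xs (s', \<tau>'))" for xs s' \<tau>'
  proof (induction xs arbitrary: s' \<tau>')
    case (Cons y xs)
    have "\<tau>' \<le> snd (?f y (s', \<tau>'))"
      unfolding round_def fst_conv snd_conv by (rule Suc_leD[OF For])
    then show ?case
      using Cons[of "snd (?f y (s', \<tau>'))" "fst (?f y (s', \<tau>'))"] by simp
  qed auto
  then show ?case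
    by (simp add: Suc_leD)
qed auto


subsection \<open>Compilation\<close>

text \<open>\<open>idx\<close> sends negative numbers to 0, whereas the floor of the RAM is an
  integer. Multiplying by the test for positivity first makes the two agree.\<close>

definition clip :: "exp \<Rightarrow> exp" where
  "clip e = Flr (Mul (Less (Cst 0) e) e)"

lemma eval_clip [simp]: "eval (clip e) s = of_nat (idx (eval e s))"
  by (cases "0 < eval e s") (auto simp: clip_def idx_def not_less)

text \<open>Cantor's pairing function as an expression of constant cost. It gives every array
  unbounded room in all indices, without any size being known in advance.\<close>

definition pair :: "exp \<Rightarrow> exp \<Rightarrow> exp" where
  "pair a b = Add (Dvd (Mul (Add a b) (Add (Add a b) (Cst 1))) (Cst 2)) a"

lemma eval_pair:
  assumes "eval a s = of_nat x" "eval b s = of_nat y"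
  shows "eval (pair a b) s = of_nat (prod_encode (x, y))"
proof -
  have "2 * triangle k = k * Suc k" for k
    by (simp add: triangle_def)
  from arg_cong[OF this, where f = "of_nat :: nat \<Rightarrow> rat"]
  have "2 * (of_nat (triangle k) :: rat) = of_nat k * (of_nat k + 1)" for k
    by (simp add: algebra_simps)
  from this[of "x + y"] show ?thesis
    using assms by (simp add: pair_def prod_encode_def algebra_simps)
qed

text \<open>The shift by \<open>N\<close>, the product of \<open>n\<close> and \<open>T\<close>,
  leaves the cells from -1 down to -N to the output. Number 0 of this layout holds the hidden
  registers of loops; array \<open>c\<close> of a program is stored under
  \<open>Suc c\<close>.\<close>

definition addr :: "nat \<Rightarrow> nat \<Rightarrow> nat \<Rightarrow> nat \<Rightarrow> nat \<Rightarrow> int" where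
  "addr N c i j l = - 1 - int N - int (prod_encode (c, prod_encode (i, prod_encode (j, l))))"

lemma addr_eq [simp]: "addr N c i j l = addr N c' i' j' l' \<longleftrightarrow> c = c' \<and> i = i' \<and> j = j' \<and> l = l'"
  by (auto simp: addr_def dest!: inj_onD[OF inj_prod_encode])

lemma addr_less: "addr N c i j l < - int N"
  by (simp add: addr_def)

definition eaddr :: "nat \<Rightarrow> exp \<Rightarrow> exp \<Rightarrow> exp \<Rightarrow> exp" where
  "eaddr c a b d = Sub (Sub (Cst (- 1)) (Mul (Mem (Cst 0)) (Mem (Cst 1))))
     (pair (Cst (of_nat c)) (pair (clip a) (pair (clip b) (clip d))))"

lemma eval_eaddr:
  assumes "s 0 * s 1 = of_nat N"
  shows "eval (eaddr c a b d) s = of_int (addr N c (idx (eval a s)) (idx (eval b s)) (idx (eval d s)))"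
proof -
  have "eval (pair (Cst (of_nat c)) (pair (clip a) (pair (clip b) (clip d)))) s =
     of_nat (prod_encode (c, prod_encode (idx (eval a s), prod_encode (idx (eval b s), idx (eval d s)))))"
    by (intro eval_pair) simp_all
  then show ?thesis
    using assms by (simp add: eaddr_def addr_def)
qed

primrec ecomp :: "aexp \<Rightarrow> exp" where
  "ecomp (Num q) = Cst q"
| "ecomp (In a) = Mem (clip (ecomp a))"
| "ecomp (Rd c a b d) = Mem (eaddr (Suc c) (ecomp a) (ecomp b) (ecomp d))"
| "ecomp (Plus a b) = Add (ecomp a) (ecomp b)"
| "ecomp (Minus a b) = Sub (ecomp a) (ecomp b)"
| "ecomp (Times a b) = Mul (ecomp a) (ecomp b)"
| "ecomp (Divide a b) = Dvd (ecomp a) (ecomp b)"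
| "ecomp (Lt a b) = Less (ecomp a) (ecomp b)"
| "ecomp (Eq a b) = Equ (ecomp a) (ecomp b)"

abbreviation hid :: "nat \<Rightarrow> exp" where
  "hid r \<equiv> eaddr 0 (Cst (of_nat r)) (Cst 0) (Cst 0)"

lemma eval_hid:
  assumes "M 0 * M 1 = of_nat N"
  shows "eval (Mem (hid r)) M = M (addr N 0 r 0 0)"
  using assms by (simp add: eval_eaddr)

text \<open>Array 0 holds the output; it is mirrored into the output cells, which no expression reads.\<close>

definition cwrite :: "nat \<Rightarrow> exp \<Rightarrow> exp \<Rightarrow> exp \<Rightarrow> exp \<Rightarrow> com" where
  "cwrite c a b d e = Seq
     (If (Mul (Mul (Less (clip a) (Mul (Mem (Cst 0)) (Mem (Cst 1)))) (Equ (clip b) (Cst 0)))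
              (Mul (Equ (clip d) (Cst 0)) (Equ (Cst (of_nat c)) (Cst 0))))
        (Store (Sub (Cst (- 1)) (clip a)) e) Skip)
     (Store (eaddr (Suc c) a b d) e)"

definition cwrite_cost :: "nat \<Rightarrow> exp \<Rightarrow> exp \<Rightarrow> exp \<Rightarrow> exp \<Rightarrow> nat" where
  "cwrite_cost c a b d e = ecost (eaddr (Suc c) a b d) +
      ecost (Mul (Mul (Less (clip a) (Mul (Mem (Cst 0)) (Mem (Cst 1)))) (Equ (clip b) (Cst 0)))
              (Mul (Equ (clip d) (Cst 0)) (Equ (Cst (of_nat c)) (Cst 0)))) +
      ecost (Sub (Cst (- 1)) (clip a)) + 2 * ecost e + 3"

primrec comp :: "nat \<Rightarrow> acom \<Rightarrow> com" where
  "comp r Nop = Skip"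
| "comp r (Wr c a b d e) = cwrite c (ecomp a) (ecomp b) (ecomp d) (ecomp e)"
| "comp r (c1 ;; c2) = Seq (comp r c1) (comp r c2)"
| "comp r (Cond b c1 c2) = If (ecomp b) (comp r c1) (comp r c2)"
| "comp r (For x e c) = Seq (Store (hid (2 * r)) (Cst 0)) (Seq (Store (hid (2 * r + 1)) (clip (ecomp e)))
     (While (Less (Mem (hid (2 * r))) (Mem (hid (2 * r + 1))))
       (Seq (cwrite x (Cst 0) (Cst 0) (Cst 0) (Mem (hid (2 * r))))
         (Seq (comp (Suc r) c) (Store (hid (2 * r)) (Add (Mem (hid (2 * r))) (Cst 1)))))))"

definition represents :: "(nat \<Rightarrow> rat) \<Rightarrow> nat \<Rightarrow> memory \<Rightarrow> store \<Rightarrow> bool" where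
  "represents I N M s \<longleftrightarrow> I 0 * I 1 = of_nat N \<and> (\<forall>i. M (int i) = I i) \<and>
     (\<forall>c i j l. M (addr N (Suc c) i j l) = s (c, i, j, l)) \<and>
     (\<forall>i<N. M (- 1 - int i) = s (0, i, 0, 0))"

lemma represents_size: "represents I N M s \<Longrightarrow> M 0 * M 1 = of_nat N"
  unfolding represents_def by (metis of_nat_0 of_nat_1)

lemma eval_ecomp: "represents I N M s \<Longrightarrow> eval (ecomp e) M = aval I e s"
proof (induction e)
  case (Rd c a b d)
  then show ?case
    using represents_size[OF Rd.prems] by (simp add: eval_eaddr) (simp add: represents_def)
qed (auto simp: represents_def)

text \<open>Number 0 of the layout is no array of the program, so loop registers may be overwritten
  without changing the represented store.\<close>

lemma represents_hidden:
  "represents I N M s \<Longrightarrow> represents I N (M(addr N 0 i j l := q)) s"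
  unfolding represents_def using addr_less[of N 0 i j l] by (auto simp: addr_def)

text \<open>The mirror cell is written first; the array cell is then addressed and filled from the
  changed memory. The \<open>stable\<close> premises say that the first write cannot alter the value
  of the expressions.\<close>

lemma exec_cwrite:
  fixes c a b d e
  assumes "represents I N M s" "s' = s((c, idx (eval a M), idx (eval b M), idx (eval d M)) := q)"
    and q: "eval e M = q"
    and stable: "\<And>i x. i < N \<Longrightarrow> eval a (M(- 1 - int i := x)) = eval a M"
      "\<And>i x. i < N \<Longrightarrow> eval b (M(- 1 - int i := x)) = eval b M"
      "\<And>i x. i < N \<Longrightarrow> eval d (M(- 1 - int i := x)) = eval d M"
      "\<And>i x. i < N \<Longrightarrow> eval e (M(- 1 - int i := x)) = eval e M"
  shows "\<exists>k M'. exec (cwrite c a b d e) M k M' \<and> k \<le> cwrite_cost c a b d e \<and>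
      represents I N M' s' \<and> (\<forall>r. M' (addr N 0 r 0 0) = M (addr N 0 r 0 0))"
proof -
  let ?g = "Mul (Mul (Less (clip a) (Mul (Mem (Cst 0)) (Mem (Cst 1)))) (Equ (clip b) (Cst 0)))
              (Mul (Equ (clip d) (Cst 0)) (Equ (Cst (of_nat c)) (Cst 0)))"
  define i j l where ijl: "i = idx (eval a M)" "j = idx (eval b M)" "l = idx (eval d M)"
  have sz: "M 0 * M 1 = of_nat N"
    using assms represents_size by blast
  \<comment> \<open>The guard is a conjunction of 0/1 tests, written as a product.\<close>
  define G where "G = ?g"
  have g: "eval G M \<noteq> 0 \<longleftrightarrow> i < N \<and> j = 0 \<and> l = 0 \<and> c = 0"
    using sz by (simp add: ijl G_def)
  define M1 where "M1 = (if eval G M \<noteq> 0 then M(- 1 - int i := q) else M)"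
  have neg: "M1 (int x) = M (int x)" for x
    by (simp add: M1_def)
  have sz1: "M1 0 * M1 1 = of_nat N"
    using neg[of 0] neg[of 1] sz by simp
  have fl: "\<lfloor>- 1 - (rat_of_nat i)\<rfloor> = - 1 - int i"
    by linarith
  obtain k1 where k1: "exec (If G (Store (Sub (Cst (- 1)) (clip a)) e) Skip) M k1 M1"
    "k1 \<le> 2 + ecost G + ecost (Sub (Cst (- 1)) (clip a)) + ecost e"
  proof (cases "eval G M = 0")
    case True
    then have "exec (If G (Store (Sub (Cst (- 1)) (clip a)) e) Skip) M (1 + ecost G + 1) M"
      by (intro exec.intros)
    then show ?thesis
      using that True by (simp add: M1_def)
  next
    case False
    have "exec (Store (Sub (Cst (- 1)) (clip a)) e) M (1 + ecost (Sub (Cst (- 1)) (clip a)) + ecost e) M1"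
      using exec.intros(2)[of "Sub (Cst (- 1)) (clip a)" e M] False q
      by (simp add: M1_def ijl[symmetric] fl del: eval.simps(5) eval.simps(7))
    from that[OF exec.intros(4)[OF False this]] show ?thesis
      by simp
  qed
  have st: "eval a M1 = eval a M" "eval b M1 = eval b M" "eval d M1 = eval d M" "eval e M1 = q"
    using stable[of i q] q g by (auto simp: M1_def Let_def)
  let ?M' = "M1(addr N (Suc c) i j l := q)"
  have "exec (Store (eaddr (Suc c) a b d) e) M1 (1 + ecost (eaddr (Suc c) a b d) + ecost e) ?M'"
    using exec.intros(2)[of "eaddr (Suc c) a b d" e M1] by (simp add: eval_eaddr[OF sz1] st ijl)
  note ex = exec.intros(3)[OF k1(1) this]
  have ne: "addr N c' i' j' l' \<noteq> - 1 - int x" if "x < N" for c' i' j' l' x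
    using addr_less[of N c' i' j' l'] that by linarith
  have ne2: "addr N c' i' j' l' \<noteq> int x" for c' i' j' l' x
    using addr_less[of N c' i' j' l'] by linarith
  have "represents I N ?M' s'"
    unfolding represents_def
  proof (intro conjI allI impI)
    fix x assume x: "x < N"
    show "?M' (- 1 - int x) = s' (0, x, 0, 0)"
      using x ne[OF x, symmetric] g assms(1,2)
      by (auto simp: M1_def ijl[symmetric] represents_def)
  next
    fix c' i' j' l'
    show "?M' (addr N (Suc c') i' j' l') = s' (c', i', j', l')"
      using g assms(1,2) ne[of i] by (auto simp: M1_def ijl[symmetric] represents_def)
  next
    fix x show "?M' (int x) = I x"
      using assms(1) ne2[symmetric] neg by (simp add: represents_def)
  qed (use assms(1) in \<open>simp add: represents_def\<close>)
  moreover have "?M' (addr N 0 r 0 0) = M (addr N 0 r 0 0)" for r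
    using ne[of i] g by (auto simp: M1_def)
  ultimately show ?thesis
    using ex k1(2) unfolding cwrite_def cwrite_cost_def G_def by fastforce
qed

text \<open>Hidden registers below \<open>2 * r\<close> belong to the enclosing loops.\<close>

definition simulates :: "nat \<Rightarrow> acom \<Rightarrow> nat \<Rightarrow> bool" where
  "simulates r c K \<longleftrightarrow> (\<forall>I N M s \<tau> s' \<tau>'. represents I N M s \<longrightarrow> run I c (s, \<tau>) = (s', \<tau>') \<longrightarrow>
     (\<exists>k M'. exec (comp r c) M k M' \<and> represents I N M' s' \<and> k + K * \<tau> \<le> K * \<tau>' \<and>
       (\<forall>i < 2 * r. M' (addr N 0 i 0 0) = M (addr N 0 i 0 0))))"

text \<open>The clock never runs backwards, so an additional \<open>K' - K\<close> per tick only
  adds slack. This brings the parts of a compound command to a common constant.\<close>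

lemma simulates_mono:
  assumes "simulates r c K" "K \<le> K'"
  shows "simulates r c K'"
  unfolding simulates_def
proof (intro allI impI)
  fix I N M s \<tau> s' \<tau>' assume *: "represents I N M s" "run I c (s, \<tau>) = (s', \<tau>')"
  then obtain k M' where km: "exec (comp r c) M k M' \<and> represents I N M' s' \<and> k + K * \<tau> \<le> K * \<tau>' \<and>
       (\<forall>i < 2 * r. M' (addr N 0 i 0 0) = M (addr N 0 i 0 0))"
    using assms(1) unfolding simulates_def by blast
  have "(K' - K) * \<tau> \<le> (K' - K) * \<tau>'"
    using run_clock[of \<tau> I c s] * by simp
  then have "k + (K + (K' - K)) * \<tau> \<le> (K + (K' - K)) * \<tau>'"
    using km unfolding distrib_right by linarith
  then have "k + K' * \<tau> \<le> K' * \<tau>'"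
    using assms(2) by simp
  then show "\<exists>k M'. exec (comp r c) M k M' \<and> represents I N M' s' \<and> k + K' * \<tau> \<le> K' * \<tau>' \<and>
       (\<forall>i < 2 * r. M' (addr N 0 i 0 0) = M (addr N 0 i 0 0))"
    using km by blast
qed

text \<open>Compiled expressions read non-negative cells and cells below -N; the output cells lie
  between these two regions.\<close>

lemma represents_out:
  assumes "represents I N M s" "i < N"
  shows "eval (ecomp e) (M(- 1 - int i := x)) = eval (ecomp e) M"
proof -
  have ne: "addr N c i' j l \<noteq> - 1 - int i" for c i' j l
    using addr_less[of N c i' j l] assms(2) by linarith
  have sz: "M 0 * M 1 = of_nat N"
    using assms represents_size by blast
  show ?thesis
  proof (induction e)
    case (Rd c a b d)
    then show ?case
      using sz ne by (simp add: eval_eaddr)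
  qed auto
qed

lemma exec_store_hid:
  assumes "represents I N M s" "i \<noteq> j"
  shows "exec (Store (hid i) e) M (1 + ecost (hid i) + ecost e) (M(addr N 0 i 0 0 := eval e M))"
  using exec.intros(2)[of "hid i" e M] represents_size[OF assms(1)] by (simp add: eval_eaddr)

text \<open>Every tick pays for the RAM steps of one expanded command, whose number depends on the
  text of the command alone. Hence one constant serves all inputs.\<close>

lemma simulates_ex: "\<exists>K. simulates r c K"
proof (induction c arbitrary: r)
  case Nop
  have "simulates r Nop 1"
    unfolding simulates_def using exec.intros(1) by fastforce
  then show ?case ..
next
  case (Wr c a b d e)
  let ?K = "cwrite_cost c (ecomp a) (ecomp b) (ecomp d) (ecomp e)"
  have K: "\<exists>k M'. exec (cwrite c (ecomp a) (ecomp b) (ecomp d) (ecomp e)) M k M' \<and> k \<le> ?K \<and> 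
       represents I N M' s' \<and> (\<forall>r. M' (addr N 0 r 0 0) = M (addr N 0 r 0 0))"
    if "represents I N M s"
      "s' = s((c, idx (aval I a s), idx (aval I b s), idx (aval I d s)) := q)"
      "aval I e s = q" for I N M s s' q
    by (rule exec_cwrite[where a = "ecomp a" and b = "ecomp b" and d = "ecomp d" and e = "ecomp e" and c = c])
      (use that in \<open>simp_all add: eval_ecomp[OF that(1)] represents_out[OF that(1)]\<close>)
  have "simulates r (Wr c a b d e) ?K"
    unfolding simulates_def
  proof (intro allI impI)
    fix I N M s \<tau> s' \<tau>'
    assume *: "represents I N M s" "run I (Wr c a b d e) (s, \<tau>) = (s', \<tau>')"
    then have "s' = s((c, idx (aval I a s), idx (aval I b s), idx (aval I d s)) := aval I e s)" "\<tau>' = Suc \<tau>"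
      by auto
    then show "\<exists>k M'. exec (comp r (Wr c a b d e)) M k M' \<and> represents I N M' s' \<and> k + ?K * \<tau> \<le> ?K * \<tau>' \<and>
      (\<forall>i<2 * r. M' (addr N 0 i 0 0) = M (addr N 0 i 0 0))"
      using K[OF *(1) _ refl] by fastforce
  qed
  then show ?case ..
next
  case (Sq c1 c2)
  obtain K1 K2 where "simulates r c1 K1" "simulates r c2 K2"
    using Sq by metis
  then have K: "simulates r c1 (max K1 K2)" "simulates r c2 (max K1 K2)"
    using simulates_mono by (meson max.cobounded1 max.cobounded2)+
  let ?K = "max K1 K2"
  have "simulates r (c1 ;; c2) ?K"
    unfolding simulates_def
  proof (intro allI impI)
    fix I N M s \<tau> s' \<tau>'
    assume *: "represents I N M s" "run I (c1 ;; c2) (s, \<tau>) = (s', \<tau>')"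
    obtain s1 \<tau>1 where 1: "run I c1 (s, \<tau>) = (s1, \<tau>1)" "run I c2 (s1, \<tau>1) = (s', \<tau>')"
      using *(2) by (metis prod.collapse run.simps(3))
    obtain k1 M1 where M1: "exec (comp r c1) M k1 M1" "represents I N M1 s1" "k1 + ?K * \<tau> \<le> ?K * \<tau>1"
      "\<forall>i<2 * r. M1 (addr N 0 i 0 0) = M (addr N 0 i 0 0)"
      using K(1) 1(1) *(1) unfolding simulates_def by blast
    obtain k2 M2 where M2: "exec (comp r c2) M1 k2 M2" "represents I N M2 s'" "k2 + ?K * \<tau>1 \<le> ?K * \<tau>'"
      "\<forall>i<2 * r. M2 (addr N 0 i 0 0) = M1 (addr N 0 i 0 0)"
      using K(2) 1(2) M1(2) unfolding simulates_def by blast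
    have "exec (comp r (c1 ;; c2)) M (k1 + k2) M2"
      using exec.intros(3)[OF M1(1) M2(1)] by simp
    moreover have "k1 + k2 + ?K * \<tau> \<le> ?K * \<tau>'"
      using M1(3) M2(3) by linarith
    ultimately show "\<exists>k M'. exec (comp r (c1 ;; c2)) M k M' \<and> represents I N M' s' \<and> k + ?K * \<tau> \<le> ?K * \<tau>' \<and>
      (\<forall>i<2 * r. M' (addr N 0 i 0 0) = M (addr N 0 i 0 0))"
      using M1(4) M2(2,4) by metis
  qed
  then show ?case ..
next
  case (Cond b c1 c2)
  obtain K1 K2 where 0: "simulates r c1 K1" "simulates r c2 K2"
    using Cond by metis
  \<comment> \<open>At this rate the tick of \<open>Cond\<close> pays for evaluating the
    condition.\<close>
  define K where "K = K1 + K2 + 1 + ecost (ecomp b)"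
  have K: "simulates r c1 K" "simulates r c2 K"
    using 0[THEN simulates_mono] by (auto simp: K_def)
  have "simulates r (Cond b c1 c2) K"
    unfolding simulates_def
  proof (intro allI impI)
    fix I N M s \<tau> s' \<tau>'
    assume *: "represents I N M s" "run I (Cond b c1 c2) (s, \<tau>) = (s', \<tau>')"
    let ?c = "if aval I b s \<noteq> 0 then c1 else c2"
    have "run I ?c (s, Suc \<tau>) = (s', \<tau>')"
      using *(2) by (auto split: if_splits)
    moreover have "simulates r ?c K"
      using K by simp
    ultimately obtain k M' where M': "exec (comp r ?c) M k M'" "represents I N M' s'" "k + K * Suc \<tau> \<le> K * \<tau>'"
      "\<forall>i<2 * r. M' (addr N 0 i 0 0) = M (addr N 0 i 0 0)"
      using *(1) unfolding simulates_def by blast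
    have "exec (comp r (Cond b c1 c2)) M (1 + ecost (ecomp b) + k) M'"
      using M'(1) eval_ecomp[OF *(1), of b] exec.intros(4,5)[of "ecomp b" M] by (auto split: if_splits)
    moreover have "1 + ecost (ecomp b) + k + K * \<tau> \<le> K * \<tau>'"
      using M'(3) by (simp add: K_def)
    ultimately show "\<exists>k M'. exec (comp r (Cond b c1 c2)) M k M' \<and> represents I N M' s' \<and> k + K * \<tau> \<le> K * \<tau>' \<and>
      (\<forall>i<2 * r. M' (addr N 0 i 0 0) = M (addr N 0 i 0 0))"
      using M'(2,4) by blast
  qed
  then show ?case ..
next
  case (For x e c)
  obtain K0 where K0: "simulates (Suc r) c K0"
    using For by metis
  let ?h = "hid (2 * r)" and ?l = "hid (2 * r + 1)"
  define K1 where "K1 = cwrite_cost x (Cst 0) (Cst 0) (Cst 0) (Mem ?h)"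
  have K1: "\<exists>k M'. exec (cwrite x (Cst 0) (Cst 0) (Cst 0) (Mem ?h)) M k M' \<and> k \<le> K1 \<and> 
       represents I N M' s' \<and> (\<forall>r. M' (addr N 0 r 0 0) = M (addr N 0 r 0 0))"
    if "represents I N M s" "s' = s((x, 0, 0, 0) := q)" "eval (Mem ?h) M = q" for I N M s s' q
  proof -
    have "eval (Mem ?h) (M(- 1 - int i := y)) = eval (Mem ?h) M" if "i < N" for i y
    proof -
      have "addr N 0 (2 * r) 0 0 \<noteq> - 1 - int i"
        using addr_less[of N 0 "2 * r" 0 0] that by linarith
      then show ?thesis
        using represents_size[OF \<open>represents I N M s\<close>] eval_hid[of M N "2 * r"]
          eval_hid[of "M(- 1 - int i := y)" N "2 * r"] by (simp del: eval.simps(2) of_nat_mult)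
    qed
    note stable = this
    show ?thesis
      unfolding K1_def
      by (rule exec_cwrite[where a = "Cst 0" and b = "Cst 0" and d = "Cst 0" and e = "Mem ?h" and c = x])
        (use that stable in \<open>simp_all del: eval.simps(2)\<close>)
  qed
  let ?b = "Less (Mem ?h) (Mem ?l)"
  let ?inc = "Store ?h (Add (Mem ?h) (Cst 1))"
  let ?body = "Seq (cwrite x (Cst 0) (Cst 0) (Cst 0) (Mem ?h)) (Seq (comp (Suc r) c) ?inc)"
  \<comment> \<open>\<open>K2\<close> is the overhead of a round and is paid by the tick of that
    round. \<open>K3\<close> covers the initialisation and the final failing test, and is paid by
    the tick of the \<open>For\<close> itself.\<close>
  define K2 where "K2 = 1 + ecost ?b + K1 + (1 + ecost ?h + ecost (Add (Mem ?h) (Cst 1)))"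
  define K3 where "K3 = (1 + ecost ?h + 1) + (1 + ecost ?l + ecost (clip (ecomp e))) + (1 + ecost ?b)"
  define K where "K = K0 + K2 + K3"
  have K: "simulates (Suc r) c K"
    using simulates_mono[OF K0] by (simp add: K_def)
  have hl: "eval (Mem ?h) M = M (addr N 0 (2 * r) 0 0)" "eval (Mem ?l) M = M (addr N 0 (2 * r + 1) 0 0)"
    if "represents I N M s" for I N M s
    using eval_hid[OF represents_size[OF that]] by blast+
  have loop: "\<exists>k M'. exec (While ?b ?body) M k M' \<and> represents I N M' s' \<and>
       k + K * \<tau> \<le> K * \<tau>' + (1 + ecost ?b) \<and> (\<forall>i<2 * r. M' (addr N 0 i 0 0) = M (addr N 0 i 0 0))"
    if "represents I N M s" "M (addr N 0 (2 * r) 0 0) = of_nat j" "M (addr N 0 (2 * r + 1) 0 0) = of_nat n"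
      "fold (\<lambda>i y. run I c (round x i y)) [j..<n] (s, \<tau>) = (s', \<tau>')" "j \<le> n"
    for I N M s \<tau> s' \<tau>' j n
    using that
  proof (induction "n - j" arbitrary: j M s \<tau>)
    case 0
    have "eval ?b M = 0"
      using 0 unfolding eval.simps(7) hl[OF 0(2)] by simp
    note ex = exec.intros(6)[OF this]
    have "s' = s" "\<tau>' = \<tau>"
      using 0 by auto
    then show ?case
      using ex 0(2) by (intro exI[of _ "1 + ecost ?b"] exI[of _ M]) (simp del: ecost.simps)
  next
    case (Suc d)
    then have jn: "j < n" by simp
    obtain s2 \<tau>2 where s2: "run I c (s((x, 0, 0, 0) := of_nat j), Suc \<tau>) = (s2, \<tau>2)"
      by fastforce
    have rest: "fold (\<lambda>i y. run I c (round x i y)) [Suc j..<n] (s2, \<tau>2) = (s', \<tau>')"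
      using Suc.prems(4) jn s2 by (simp add: upt_conv_Cons round_def)
    obtain k1 M1 where M1: "exec (cwrite x (Cst 0) (Cst 0) (Cst 0) (Mem ?h)) M k1 M1" "k1 \<le> K1"
      "represents I N M1 (s((x, 0, 0, 0) := of_nat j))" "\<And>r. M1 (addr N 0 r 0 0) = M (addr N 0 r 0 0)"
      using K1[OF Suc.prems(1) refl] hl(1)[OF Suc.prems(1)] unfolding Suc.prems(2) by blast
    \<comment> \<open>The body was compiled one level deeper and leaves both registers of this loop
      intact.\<close>
    obtain k2 M2 where M2: "exec (comp (Suc r) c) M1 k2 M2" "represents I N M2 s2" "k2 + K * Suc \<tau> \<le> K * \<tau>2"
      "\<forall>i<2 * Suc r. M2 (addr N 0 i 0 0) = M1 (addr N 0 i 0 0)"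
      using K s2 M1(3) unfolding simulates_def by blast
    have h2: "M2 (addr N 0 (2 * r) 0 0) = of_nat j" "M2 (addr N 0 (2 * r + 1) 0 0) = of_nat n"
      using M2(4) M1(4) Suc.prems(2,3) by auto
    let ?M3 = "M2(addr N 0 (2 * r) 0 0 := of_nat (Suc j))"
    have e3: "exec ?inc M2 (1 + ecost ?h + ecost (Add (Mem ?h) (Cst 1))) ?M3"
    proof -
      have "eval (Add (Mem ?h) (Cst 1)) M2 = of_nat (Suc j)"
        using hl[OF M2(2)] h2 by (simp only: eval.simps(1,3))
      then show ?thesis
        using exec_store_hid[OF M2(2), of "2 * r" "2 * r + 1" "Add (Mem ?h) (Cst 1)"] by (simp only:)
    qed
    have body: "exec ?body M (k1 + (k2 + (1 + ecost ?h + ecost (Add (Mem ?h) (Cst 1))))) ?M3"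
      using exec.intros(3)[OF M1(1) exec.intros(3)[OF M2(1) e3]] .
    have "eval ?b M \<noteq> 0"
      using jn unfolding eval.simps(7) hl[OF Suc.prems(1)] Suc.prems(2,3) by simp
    note W = exec.intros(7)[OF this body]
    obtain k4 M4 where M4: "exec (While ?b ?body) ?M3 k4 M4" "represents I N M4 s'"
      "k4 + K * \<tau>2 \<le> K * \<tau>' + (1 + ecost ?b)" "\<forall>i<2 * r. M4 (addr N 0 i 0 0) = ?M3 (addr N 0 i 0 0)"
    proof -
      have "d = n - Suc j" "Suc j \<le> n" "?M3 (addr N 0 (2 * r) 0 0) = of_nat (Suc j)"
        "?M3 (addr N 0 (2 * r + 1) 0 0) = of_nat n"
        using Suc.hyps(2) jn h2 by auto
      from Suc.hyps(1)[OF this(1) represents_hidden[OF M2(2)] this(3,4) rest this(2)] show ?thesis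
        using that by blast
    qed
    have "1 + ecost ?b + (k1 + (k2 + (1 + ecost ?h + ecost (Add (Mem ?h) (Cst 1))))) + k4 + K * \<tau> \<le> K * \<tau>' + (1 + ecost ?b)"
    proof -
      have "K2 \<le> K"
        by (simp add: K_def)
      then have "K2 + k2 + K * \<tau> \<le> K * \<tau>2"
        using M2(3) by simp
      then show ?thesis
        using M4(3) M1(2) unfolding K2_def by linarith
    qed
    moreover have "\<forall>i<2 * r. M4 (addr N 0 i 0 0) = M (addr N 0 i 0 0)"
      using M4(4) M2(4) M1(4) by simp
    ultimately show ?case
      using W[OF M4(1)] M4(2) by blast
  qed
  have "simulates r (For x e c) K"
    unfolding simulates_def
  proof (intro allI impI)
    fix I N M s \<tau> s' \<tau>'
    assume *: "represents I N M s" "run I (For x e c) (s, \<tau>) = (s', \<tau>')"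
    let ?n = "idx (aval I e s)"
    let ?M1 = "M(addr N 0 (2 * r) 0 0 := 0)"
    let ?M2 = "?M1(addr N 0 (2 * r + 1) 0 0 := of_nat ?n)"
    have R1: "represents I N ?M1 s" and R2: "represents I N ?M2 s"
      using *(1) represents_hidden by blast+
    have E1: "exec (Store ?h (Cst 0)) M (1 + ecost ?h + 1) ?M1"
      using exec_store_hid[OF *(1), of "2 * r" "2 * r + 1" "Cst 0"] unfolding ecost.simps eval.simps by simp
    have E2: "exec (Store ?l (clip (ecomp e))) ?M1 (1 + ecost ?l + ecost (clip (ecomp e))) ?M2"
      using exec_store_hid[OF R1, of "2 * r + 1" "2 * r" "clip (ecomp e)"] eval_ecomp[OF R1, of e] by simp
    obtain k M' where M': "exec (While ?b ?body) ?M2 k M'" "represents I N M' s'"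
       "k + K * Suc \<tau> \<le> K * \<tau>' + (1 + ecost ?b)" "\<forall>i<2 * r. M' (addr N 0 i 0 0) = ?M2 (addr N 0 i 0 0)"
      using loop[OF R2, of 0 ?n "Suc \<tau>" s' \<tau>'] *(2) by auto
    have "exec (comp r (For x e c)) M ((1 + ecost ?h + 1) + ((1 + ecost ?l + ecost (clip (ecomp e))) + k)) M'"
      using exec.intros(3)[OF E1 exec.intros(3)[OF E2 M'(1)]] unfolding comp.simps .
    moreover have "(1 + ecost ?h + 1) + ((1 + ecost ?l + ecost (clip (ecomp e))) + k) + K * \<tau> \<le> K * \<tau>'"
    proof -
      have "K3 \<le> K"
        by (simp add: K_def)
      then show ?thesis
        using M'(3) unfolding K3_def mult_Suc_right by linarith
    qed
    moreover have "\<forall>i<2 * r. M' (addr N 0 i 0 0) = M (addr N 0 i 0 0)"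
      using M'(4) by simp
    ultimately show "\<exists>k M'. exec (comp r (For x e c)) M k M' \<and> represents I N M' s' \<and> k + K * \<tau> \<le> K * \<tau>' \<and>
      (\<forall>i<2 * r. M' (addr N 0 i 0 0) = M (addr N 0 i 0 0))"
      using M'(2) by blast
  qed
  then show ?case ..
qed

lemma exec_comp:
  obtains K where "\<And>I N M Q. \<lbrakk>represents I N M (\<lambda>_. 0); wp I c Q (\<lambda>_. 0) 0\<rbrakk> \<Longrightarrow>
    \<exists>k M' s \<tau>. exec (comp 0 c) M k M' \<and> k \<le> K * \<tau> \<and> Q s \<tau> \<and> represents I N M' s"
proof -
  obtain K where "simulates 0 c K"
    using simulates_ex by blast
  then show ?thesis
    using that[of K] unfolding simulates_def wp_def by (fastforce split: prod.splits)
qed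

section \<open>Shortest walks as paths in the graph of temporal nodes\<close>

declare split_paired_All [simp del] split_paired_Ex [simp del]

text \<open>Time 0 is reserved for the root \<open>(s, 0)\<close>, from which any first arc may be taken.\<close>

definition ok :: "bool \<Rightarrow> nat \<Rightarrow> nat \<Rightarrow> nat \<Rightarrow> bool" where
  "ok strict K t t' \<longleftrightarrow> t = 0 \<or> ((if strict then t < t' else t \<le> t') \<and> t' \<le> t + K)"

definition edge :: "bool \<Rightarrow> nat \<Rightarrow> arc set \<Rightarrow> nat \<times> nat \<Rightarrow> arc \<Rightarrow> bool" where
  "edge strict K E x e \<longleftrightarrow> e \<in> E \<and> src e = fst x \<and> ok strict K (snd x) (tm e)"

text \<open>An arc \<open>(u, v, t)\<close> is \<open>(u, (v, t))\<close>, so \<open>snd e\<close>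
  is the temporal node that it enters. Paths are lists of arcs and thereby the same objects as
  walks; the inner nodes are determined by the arcs.\<close>

primrec path :: "bool \<Rightarrow> nat \<Rightarrow> arc set \<Rightarrow> nat \<times> nat \<Rightarrow> arc list \<Rightarrow> nat \<times> nat \<Rightarrow> bool" where
  "path strict K E x [] y \<longleftrightarrow> x = y"
| "path strict K E x (e # W) y \<longleftrightarrow> edge strict K E x e \<and> path strict K E (snd e) W y"

lemma path_append:
  "path strict K E x (W1 @ W2) y \<longleftrightarrow> (\<exists>z. path strict K E x W1 z \<and> path strict K E z W2 y)"
  by (induction W1 arbitrary: x) auto

lemma path_last: "path strict K E x W y \<Longrightarrow> W \<noteq> [] \<Longrightarrow> y = snd (last W)"
  by (induction W arbitrary: x) (auto split: if_splits)

lemma path_unique: "path strict K E x W y \<Longrightarrow> path strict K E x W y' \<Longrightarrow> y = y'"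
  by (induction W arbitrary: x) auto

lemma path_suffix:
  assumes "path strict K E x (W1 @ W2) y" "path strict K E x W1 z"
  shows "path strict K E z W2 y"
proof -
  obtain z' where "path strict K E x W1 z'" "path strict K E z' W2 y"
    using assms(1) by (auto simp: path_append)
  then show ?thesis
    using path_unique[OF assms(2)] by simp
qed

lemma path_subset: "path strict K E x W y \<Longrightarrow> set W \<subseteq> E"
proof (induction W arbitrary: x)
  case (Cons e W)
  then show ?case
    using Cons.IH[of "snd e"] by (simp add: edge_def)
qed auto

lemma path_time:
  "path strict K E x W y \<Longrightarrow> snd x \<le> snd y \<and> (\<forall>e\<in>set W. snd x \<le> tm e \<and> tm e \<le> snd y)"
proof (induction W arbitrary: x)
  case (Cons e W)
  then have "snd x \<le> tm e"
    by (auto simp: edge_def ok_def split: if_splits)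
  moreover have "snd (snd e) = tm e"
    by (simp add: tm_def)
  moreover have "edge strict K E x e" "path strict K E (snd e) W y"
    using Cons.prems by auto
  ultimately show ?case
    using Cons.IH[of "snd e"] by force
qed auto

lemma all_Suc_less: "(\<forall>i. Suc i < Suc (Suc n) \<longrightarrow> P i) \<longleftrightarrow> P 0 \<and> (\<forall>i. Suc i < Suc n \<longrightarrow> P (Suc i))"
  by (metis Suc_less_eq gr0_implies_Suc less_Suc_eq_0_disj zero_less_Suc)

text \<open>From time 1 on, \<open>ok\<close> is exactly the step condition of a restless walk. Arcs
  carry positive times, so the free choice at time 0 can only occur at the start
  \<open>x\<close>.\<close>

lemma path_iff_walk:
  assumes "\<And>e. e \<in> E \<Longrightarrow> 1 \<le> tm e" "W \<noteq> []"
  shows "path strict K E x W y \<longleftrightarrow> is_walk strict E W \<and> restless (enat K) W \<and>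
     edge strict K E x (hd W) \<and> snd (last W) = y"
  using assms(2)
proof (induction W arbitrary: x rule: induct_list012)
  case (2 e)
  then show ?case
    by (auto simp: is_walk_def restless_def edge_def)
next
  case (3 e f W)
  let ?st = "\<lambda>e f. dst e = src f \<and> (if strict then tm e < tm f else tm e \<le> tm f)"
  have w: "is_walk strict E (e # f # W) \<longleftrightarrow> e \<in> E \<and> ?st e f \<and> is_walk strict E (f # W)"
    unfolding is_walk_def list.size add_0_right add_Suc_right
    by (simp only: all_Suc_less nth_Cons_0 nth_Cons_Suc) auto
  have r: "restless (enat K) (e # f # W) \<longleftrightarrow> tm f - tm e \<le> K \<and> restless (enat K) (f # W)"
    unfolding restless_def list.size add_0_right add_Suc_right
    by (simp only: all_Suc_less nth_Cons_0 nth_Cons_Suc) auto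
  have "edge strict K E (snd e) f \<longleftrightarrow> f \<in> E \<and> ?st e f \<and> tm f - tm e \<le> K" if "e \<in> E"
    using assms(1)[OF that] by (auto simp: edge_def ok_def dst_def tm_def)
  moreover have "is_walk strict E (f # W) \<Longrightarrow> f \<in> E"
    by (auto simp: is_walk_def)
  moreover have "edge strict K E x e \<Longrightarrow> e \<in> E"
    by (simp add: edge_def)
  moreover have "path strict K E (snd e) (f # W) y \<longleftrightarrow> is_walk strict E (f # W) \<and> restless (enat K) (f # W) \<and>
      edge strict K E (snd e) f \<and> snd (last (f # W)) = y"
    using 3(2)[of "snd e"] by simp
  ultimately show ?case
    unfolding w r path.simps(2)[of _ _ _ _ e] list.sel(1) last_ConsR[OF list.distinct(2)] by blast
qed auto

lemma sz_walk_iff_path: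
  assumes "\<And>e. e \<in> E \<Longrightarrow> 1 \<le> tm e"
  shows "is_sz_walk strict E s z W \<and> restless (enat K) W \<longleftrightarrow> W \<noteq> [] \<and> (\<exists>t. path strict K E (s, 0) W (z, t))"
proof (cases "W = []")
  case False
  have "is_walk strict E W \<Longrightarrow> hd W \<in> E"
    using False by (auto simp: is_walk_def)
  then show ?thesis
    using False path_iff_walk[where E = E and W = W and x = "(s, 0)", OF assms False]
    by (auto simp: is_sz_walk_def edge_def ok_def dst_def prod_eq_iff)
qed (simp add: is_sz_walk_def is_walk_def)

lemma restless_bounded:
  assumes "\<And>e. e \<in> E \<Longrightarrow> tm e \<le> T" "is_walk strict E W"
  shows "restless (enat T) W"
  unfolding restless_def
proof (intro allI impI)
  fix i assume "Suc i < length W"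
  then have "W ! Suc i \<in> E"
    using assms(2) nth_mem by (fastforce simp: is_walk_def)
  from assms(1)[OF this] show "enat (tm (W ! Suc i) - tm (W ! i)) \<le> enat T"
    by simp
qed


section \<open>Shortest paths from the root and their number\<close>

text \<open>Only local facts about a finished search are assumed: \<open>relaxed\<close> bounds
  \<open>D\<close> by the length of every path, \<open>parent\<close> provides a path that attains
  the bound, and \<open>counted\<close> is the recursion over last edges. The program produces such
  a pair for the given window and also for window 0.\<close>

locale bfs_tree =
  fixes strict :: bool and K :: nat and E :: "arc set" and s :: nat
    and D :: "nat \<times> nat \<Rightarrow> nat" and S :: "nat \<times> nat \<Rightarrow> nat"
  assumes fin: "finite E"
    and pos: "e \<in> E \<Longrightarrow> 1 \<le> tm e"
    and root: "D (s, 0) = 1" "S (s, 0) = 1"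
    and relaxed: "D x \<noteq> 0 \<Longrightarrow> edge strict K E x e \<Longrightarrow> D (snd e) \<noteq> 0 \<and> D (snd e) \<le> Suc (D x)"
    and parent: "D y \<noteq> 0 \<Longrightarrow> y \<noteq> (s, 0) \<Longrightarrow>
      \<exists>x e. D x \<noteq> 0 \<and> edge strict K E x e \<and> snd e = y \<and> D y = Suc (D x)"
    and counted: "D y \<noteq> 0 \<Longrightarrow> y \<noteq> (s, 0) \<Longrightarrow>
      S y = (\<Sum>(x, e) \<in> {(x, e). D x \<noteq> 0 \<and> edge strict K E x e \<and> snd e = y \<and> D y = Suc (D x)}. S x)"
    and unreached: "D x = 0 \<Longrightarrow> S x = 0"
begin

text \<open>\<open>D\<close> is the distance from the root \<open>(s, 0)\<close> plus one, and 0 on unreachable temporal nodes.\<close>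

abbreviation "P \<equiv> path strict K E"
abbreviation "r \<equiv> (s, 0::nat)"

definition tight :: "((nat \<times> nat) \<times> arc) set" where
  "tight = {(x, e). D x \<noteq> 0 \<and> edge strict K E x e \<and> D (snd e) = Suc (D x)}"

text \<open>Continuations: they extend shortest paths from the root to \<open>x\<close> into
  shortest paths to \<open>y\<close>.\<close>

definition cont :: "nat \<times> nat \<Rightarrow> nat \<times> nat \<Rightarrow> arc list set" where
  "cont x y = {W. P x W y \<and> D y = D x + length W}"

lemma finite_tight: "finite tight"
proof (rule finite_subset)
  show "tight \<subseteq> (\<Union>e\<in>E. ({src e} \<times> {..tm e}) \<times> {e})"
    by (auto simp: tight_def edge_def ok_def split: if_splits)
qed (use fin in auto)

lemma finite_cont: "finite (cont x y)"
  by (rule finite_subset[OF _ finite_lists_length_eq[OF fin, of "D y - D x"]])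
    (auto simp: cont_def dest: path_subset)

lemma path_dist: "P x W y \<Longrightarrow> D x \<noteq> 0 \<Longrightarrow> D y \<noteq> 0 \<and> D y \<le> D x + length W"
proof (induction W arbitrary: x)
  case (Cons e W)
  then show ?case
    using relaxed[of x e] Cons.IH[of "snd e"] by force
qed auto

lemma shortest_path: "D y \<noteq> 0 \<Longrightarrow> \<exists>W. P r W y \<and> D y = Suc (length W)"
proof (induction "D y" arbitrary: y rule: less_induct)
  case less
  show ?case
  proof (cases "y = r")
    case True
    then show ?thesis
      using root by (intro exI[of _ "[]"]) auto
  next
    case False
    then obtain x e where xe: "D x \<noteq> 0" "edge strict K E x e" "snd e = y" "D y = Suc (D x)"
      using parent less.prems by blast
    then obtain W where "P r W x" "D x = Suc (length W)"
      using less.hyps[of x] by auto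
    then show ?thesis
      using xe by (intro exI[of _ "W @ [e]"]) (auto simp: path_append)
  qed
qed

lemma dist_le: "P r W y \<Longrightarrow> D y \<noteq> 0 \<and> D y \<le> Suc (length W)"
  using path_dist[of r W y] root by simp

text \<open>Both parts obey the inequality of \<open>path_dist\<close>; if it is attained for the
  whole, it is attained for each part.\<close>

lemma cont_split:
  assumes "D x \<noteq> 0" "P x W1 y" "P y W2 z" "D z = D x + length W1 + length W2"
  shows "W1 \<in> cont x y" "W2 \<in> cont y z"
  using path_dist[OF assms(2,1)] path_dist[OF assms(3)] assms by (auto simp: cont_def)

lemma cont_append: "W1 \<in> cont x y \<Longrightarrow> W2 \<in> cont y z \<Longrightarrow> W1 @ W2 \<in> cont x z"
  by (auto simp: cont_def path_append)

text \<open>All members of \<open>cont x y\<close> have the same length, so a concatenation can be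
  cut in one place only.\<close>

lemma inj_append_cont: "inj_on (\<lambda>(W1, W2). W1 @ W2) (cont x y \<times> B)"
  by (auto simp: inj_on_def cont_def)

lemma cont_self: "cont x x = {[]}"
  by (auto simp: cont_def)

lemma cont_Cons: "D x \<noteq> 0 \<Longrightarrow> e # W \<in> cont x y \<longleftrightarrow> (x, e) \<in> tight \<and> W \<in> cont (snd e) y"
  using path_dist[of "snd e" W y] relaxed[of x e] by (auto simp: cont_def tight_def)

lemma cont_snoc:
  assumes "D x \<noteq> 0"
  shows "W @ [e] \<in> cont x y \<longleftrightarrow> snd e = y \<and> (\<exists>u. (u, e) \<in> tight \<and> W \<in> cont x u)"
proof
  assume *: "W @ [e] \<in> cont x y"
  then obtain u where u: "P x W u" "P u [e] y" "D y = D x + length W + length [e]"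
    by (auto simp: cont_def path_append)
  from cont_split[OF assms u] have "W \<in> cont x u" "[e] \<in> cont u y"
    by auto
  moreover have "D u \<noteq> 0"
    using path_dist[OF u(1) assms] by blast
  ultimately show "snd e = y \<and> (\<exists>u. (u, e) \<in> tight \<and> W \<in> cont x u)"
    using cont_Cons[of u e "[]" y] by (auto simp: cont_def)
next
  assume "snd e = y \<and> (\<exists>u. (u, e) \<in> tight \<and> W \<in> cont x u)"
  then obtain u where "snd e = y" "(u, e) \<in> tight" "W \<in> cont x u"
    by blast
  moreover from this have "[e] \<in> cont u y"
    by (simp add: cont_def tight_def)
  ultimately show "W @ [e] \<in> cont x y"
    using cont_append by blast
qed

lemma cont_unreached: "D x \<noteq> 0 \<Longrightarrow> D y = 0 \<Longrightarrow> cont x y = {}"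
  by (auto simp: cont_def)

text \<open>Removing the last edge leads bijectively to pairs of a tight edge into \<open>x\<close>
  and a shortest path to its tail; \<open>counted\<close> sums over exactly these edges.\<close>

lemma card_cont_root: "D x \<noteq> 0 \<Longrightarrow> card (cont r x) = S x"
proof (induction "D x" arbitrary: x rule: less_induct)
  case less
  show ?case
  proof (cases "x = r")
    case True
    then show ?thesis
      using root by (simp add: cont_self)
  next
    case False
    let ?I = "{(u, e). D u \<noteq> 0 \<and> edge strict K E u e \<and> snd e = x \<and> D x = Suc (D u)}"
    have I: "?I = {(u, e) \<in> tight. snd e = x}"
      by (auto simp: tight_def)
    have finI: "finite ?I"
      unfolding I by (rule finite_subset[OF _ finite_tight]) auto
    have "cont r x = (\<Union>p\<in>?I. (\<lambda>W. W @ [snd p]) ` cont r (fst p))"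
    proof (intro set_eqI iffI)
      fix W assume W: "W \<in> cont r x"
      have "W \<noteq> []"
        using W False by (auto simp: cont_def)
      then obtain V e where "W = V @ [e]"
        by (metis rev_exhaust)
      with W cont_snoc[of r V e x] root obtain u where "W = V @ [e]" "(u, e) \<in> ?I" "V \<in> cont r u"
        unfolding I by auto
      then show "W \<in> (\<Union>p\<in>?I. (\<lambda>W. W @ [snd p]) ` cont r (fst p))"
        by (intro UN_I[of "(u, e)"]) auto
    next
      fix W assume "W \<in> (\<Union>p\<in>?I. (\<lambda>W. W @ [snd p]) ` cont r (fst p))"
      then obtain p V where "p \<in> ?I" "W = V @ [snd p]" "V \<in> cont r (fst p)"
        by blast
      then show "W \<in> cont r x"
        unfolding I using root cont_snoc[of r V "snd p" x] by auto
    qed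
    moreover have "card (\<Union>p\<in>?I. (\<lambda>W. W @ [snd p]) ` cont r (fst p)) =
        (\<Sum>p\<in>?I. card ((\<lambda>W. W @ [snd p]) ` cont r (fst p)))"
    proof (rule card_UN_disjoint[OF finI])
      \<comment> \<open>The list \<open>V\<close> alone determines where it ends, and thus the tail
        of the last edge.\<close>
      have False if "p \<in> ?I" "q \<in> ?I" "p \<noteq> q" "V \<in> cont r (fst p)" "W \<in> cont r (fst q)"
        "V @ [snd p] = W @ [snd q]" for p q V W
      proof -
        have "P r V (fst p)" "P r V (fst q)" "snd p = snd q"
          using that(4-6) by (auto simp: cont_def)
        then show False
          using path_unique that(3) by (metis prod_eqI)
      qed
      then show "\<forall>p\<in>?I. \<forall>q\<in>?I. p \<noteq> q \<longrightarrow>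
        (\<lambda>W. W @ [snd p]) ` cont r (fst p) \<inter> (\<lambda>W. W @ [snd q]) ` cont r (fst q) = {}"
        by blast
    qed (use finite_cont in auto)
    moreover have "card ((\<lambda>W. W @ [snd p]) ` cont r (fst p)) = S (fst p)" if "p \<in> ?I" for p
      using that less.hyps[of "fst p"] by (subst card_image) (auto simp: inj_on_def)
    ultimately show ?thesis
      using counted[OF less.prems False] by (simp add: case_prod_beta)
  qed
qed

text \<open>The counterpart with the first edge removed; this is the form in which the backward
  recursion uses the counts.\<close>

lemma card_cont_step:
  assumes "D x \<noteq> 0"
  shows "card (cont x y) = of_bool (x = y) + (\<Sum>e | (x, e) \<in> tight. card (cont (snd e) y))"
proof -
  let ?O = "{e. (x, e) \<in> tight}"
  have finO: "finite ?O"
    by (rule finite_subset[OF _ finite_imageI[OF finite_tight, of snd]]) force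
  have "cont x y = (if x = y then {[]} else {}) \<union> (\<Union>e\<in>?O. Cons e ` cont (snd e) y)" (is "_ = ?A \<union> ?B")
  proof (intro set_eqI)
    fix W show "W \<in> cont x y \<longleftrightarrow> W \<in> ?A \<union> ?B"
      by (cases W) (auto simp: cont_Cons[OF assms], auto simp: cont_def)
  qed
  moreover have "card (?A \<union> ?B) = card ?A + card ?B"
    using finO finite_cont by (intro card_Un_disjoint) auto
  moreover have "card ?B = (\<Sum>e\<in>?O. card (Cons e ` cont (snd e) y))"
    using finO finite_cont by (intro card_UN_disjoint) auto
  moreover have "card (Cons e ` cont (snd e) y) = card (cont (snd e) y)" for e
    by (intro card_image) auto
  ultimately show ?thesis
    by auto
qed

lemma finite_reached: "finite {y. D y \<noteq> 0}"
proof (rule finite_subset)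
  show "{y. D y \<noteq> 0} \<subseteq> insert r (snd ` E)"
  proof
    fix y assume "y \<in> {y. D y \<noteq> 0}"
    then show "y \<in> insert r (snd ` E)"
      using parent[of y] by (cases "y = r") (auto simp: edge_def)
  qed
qed (use fin in auto)

section \<open>Shortest walks through a temporal node\<close>

definition passing :: "nat \<times> nat \<Rightarrow> nat \<times> nat \<Rightarrow> arc list set" where
  "passing x y = {W \<in> cont r y. \<exists>W1 W2. W = W1 @ W2 \<and> P r W1 x}"

text \<open>A prefix of a shortest path is shortest, so walks through \<open>x\<close> are free
  combinations of a shortest path to \<open>x\<close> and a continuation. Their numbers multiply, as
  in Brandes' formula.\<close>

lemma passing_eq: "passing x y = (\<lambda>(W1, W2). W1 @ W2) ` (cont r x \<times> cont x y)"
proof (intro set_eqI iffI)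
  fix W assume "W \<in> passing x y"
  then obtain W1 W2 where W: "W = W1 @ W2" "P r W1 x" "P r W y" "D y = Suc (length W)"
    using root by (auto simp: passing_def cont_def)
  then have "P x W2 y"
    using path_suffix by simp
  with W show "W \<in> (\<lambda>(W1, W2). W1 @ W2) ` (cont r x \<times> cont x y)"
    using cont_split[of r W1 x W2 y] root by auto
next
  fix W assume "W \<in> (\<lambda>(W1, W2). W1 @ W2) ` (cont r x \<times> cont x y)"
  then obtain W1 W2 where W: "W = W1 @ W2" "W1 \<in> cont r x" "W2 \<in> cont x y"
    by auto
  then have "W \<in> cont r y" "P r W1 x"
    using cont_append by (auto simp: cont_def)
  with W(1) show "W \<in> passing x y"
    unfolding passing_def by blast
qed

lemma card_passing: "card (passing x y) = card (cont r x) * card (cont x y)"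
  unfolding passing_eq card_image[OF inj_append_cont] by (rule card_cartesian_product)

lemma card_cont_root': "card (cont r x) = S x"
  using card_cont_root[of x] cont_unreached[of r x] root unreached by (cases "D x = 0") auto

text \<open>The recursion unrolls along tight edges, each of which raises \<open>D\<close> by one;
  hence the induction on the gap to the largest distance. With weights of targets as
  \<open>w\<close>, one value per node replaces a sum over all targets.\<close>

lemma backward_sum:
  fixes g w :: "nat \<times> nat \<Rightarrow> rat"
  assumes g: "\<And>x. D x \<noteq> 0 \<Longrightarrow> g x = w x + (\<Sum>e | (x, e) \<in> tight. g (snd e))" and "D x \<noteq> 0"
  shows "g x = (\<Sum>y | D y \<noteq> 0. w y * of_nat (card (cont x y)))"
  using assms(2)
proof (induction "Max (D ` {y. D y \<noteq> 0}) - D x" arbitrary: x rule: less_induct)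
  case less
  let ?R = "{y. D y \<noteq> 0}" and ?O = "{e. (x, e) \<in> tight}"
  have "g (snd e) = (\<Sum>y\<in>?R. w y * of_nat (card (cont (snd e) y)))" if "e \<in> ?O" for e
  proof (rule less.hyps)
    show "D (snd e) \<noteq> 0"
      using that by (simp add: tight_def)
    then have "D (snd e) \<le> Max (D ` ?R)"
      using finite_reached by (intro Max_ge) auto
    then show "Max (D ` ?R) - D (snd e) < Max (D ` ?R) - D x"
      using that by (auto simp: tight_def)
  qed
  then have "g x = w x + (\<Sum>e\<in>?O. \<Sum>y\<in>?R. w y * of_nat (card (cont (snd e) y)))"
    unfolding g[OF less.prems] by simp
  also have "\<dots> = w x + (\<Sum>y\<in>?R. w y * (\<Sum>e\<in>?O. of_nat (card (cont (snd e) y))))"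
    by (subst sum.swap) (simp add: sum_distrib_left)
  also have "w x = (\<Sum>y\<in>?R. w y * of_bool (x = y))"
    using less.prems finite_reached by (simp add: of_bool_def if_distrib[of "\<lambda>u. _ * u"] cong: if_cong)
  also have "\<dots> + (\<Sum>y\<in>?R. w y * (\<Sum>e\<in>?O. of_nat (card (cont (snd e) y)))) =
      (\<Sum>y\<in>?R. w y * of_nat (card (cont x y)))"
    unfolding card_cont_step[OF less.prems] by (simp add: sum.distrib algebra_simps)
  finally show ?case .
qed


section \<open>Optimal ends and their weights\<close>

text \<open>\<open>D\<close> exceeds the length by one everywhere, so \<open>key\<close> orders the
  ends as the cost of their best walks does.\<close>

definition key :: "nat \<Rightarrow> nat \<times> nat \<Rightarrow> nat" where
  "key a y = a * snd y + D y"

definition opt :: "nat \<Rightarrow> nat \<Rightarrow> nat set" where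
  "opt a z = {t. D (z, t) \<noteq> 0 \<and> (\<forall>t'. D (z, t') \<noteq> 0 \<longrightarrow> key a (z, t) \<le> key a (z, t'))}"

definition total :: "nat \<Rightarrow> nat \<Rightarrow> nat" where
  "total a z = (\<Sum>t\<in>opt a z. S (z, t))"

text \<open>Dividing by \<open>total\<close> already here allows the contributions of all targets to
  be added up in one recursion. Ends at \<open>s\<close> get weight 0 since source and target of a
  counted pair differ.\<close>

definition weight :: "nat \<Rightarrow> nat \<times> nat \<Rightarrow> rat" where
  "weight a y = (if fst y \<noteq> s \<and> snd y \<in> opt a (fst y) then 1 / of_nat (total a (fst y)) else 0)"

lemma finite_opt: "finite (opt a z)"
  by (rule finite_subset[OF _ finite_imageI[OF finite_reached, of snd]]) (force simp: opt_def)

text \<open>A walk ending in \<open>(z, t)\<close> costs at least \<open>key a (z, t) - 1\<close>,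
  with equality exactly for shortest paths. Minimising over walks thus means minimising
  \<open>key\<close> over arrival times. As \<open>z\<close> differs from \<open>s\<close>, these
  walks are non-empty and have an arrival time.\<close>

lemma argmin_walks:
  assumes "z \<noteq> s"
  shows "argmin_set {W. is_sz_walk strict E s z W \<and> restless (enat K) W} (\<lambda>W. a * arr W + length W) =
    (\<Union>t\<in>opt a z. cont r (z, t))"
proof -
  let ?A = "{W. is_sz_walk strict E s z W \<and> restless (enat K) W}" and ?f = "\<lambda>W. a * arr W + length W"
  have A: "W \<in> ?A \<longleftrightarrow> (\<exists>t. P r W (z, t))" for W
    using sz_walk_iff_path[where E = E, OF pos] assms by (cases "W = []") auto
  have arr: "arr W = t" if "P r W (z, t)" for W t
    using path_last[OF that] that assms by (cases "W = []") (auto simp: arr_def tm_def prod_eq_iff)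
  have ge: "key a (z, t) \<le> Suc (?f W)" if "P r W (z, t)" for W t
    using dist_le[OF that] arr[OF that] by (simp add: key_def)
  have short: "\<exists>W. P r W (z, t) \<and> Suc (?f W) = key a (z, t)" if "D (z, t) \<noteq> 0" for t
    using shortest_path[OF that] arr by (force simp: key_def)
  have cont: "W \<in> cont r (z, t) \<longleftrightarrow> Suc (?f W) = key a (z, t)" if "P r W (z, t)" for W t
    using that arr[OF that] root by (auto simp: cont_def key_def)
  show ?thesis
  proof (intro set_eqI iffI)
    fix W assume "W \<in> argmin_set ?A ?f"
    then obtain t where W: "P r W (z, t)" "\<And>V. V \<in> ?A \<Longrightarrow> ?f W \<le> ?f V"
      unfolding argmin_set_def using A by auto
    have le: "Suc (?f W) \<le> key a (z, t')" if "D (z, t') \<noteq> 0" for t'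
      using short[OF that] W(2) A by fastforce
    have "D (z, t) \<noteq> 0"
      using dist_le[OF W(1)] by blast
    moreover have "Suc (?f W) = key a (z, t)"
      using le[OF calculation] ge[OF W(1)] by linarith
    moreover have "t \<in> opt a z"
      using le ge[OF W(1)] calculation by (auto simp: opt_def)
    ultimately show "W \<in> (\<Union>t\<in>opt a z. cont r (z, t))"
      using cont[OF W(1)] by blast
  next
    fix W assume "W \<in> (\<Union>t\<in>opt a z. cont r (z, t))"
    then obtain t where t: "t \<in> opt a z" "P r W (z, t)" "W \<in> cont r (z, t)"
      by (auto simp: cont_def)
    have "?f W \<le> ?f V" if V: "V \<in> ?A" for V
    proof -
      obtain t' where V: "P r V (z, t')"
        using V A by auto
      then have "key a (z, t) \<le> key a (z, t')"
        using t(1) dist_le[OF V] by (auto simp: opt_def)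
      then show ?thesis
        using ge[OF V] cont[OF t(2)] t(3) by linarith
    qed
    moreover have "W \<in> ?A"
      using A t(2) by blast
    ultimately show "W \<in> argmin_set ?A ?f"
      unfolding argmin_set_def by blast
  qed
qed

lemma card_opt_walks:
  "card {W \<in> (\<Union>t\<in>opt a z. cont r (z, t)). Q W} = (\<Sum>t\<in>opt a z. card {W \<in> cont r (z, t). Q W})"
proof -
  have "{W \<in> (\<Union>t\<in>opt a z. cont r (z, t)). Q W} = (\<Union>t\<in>opt a z. {W \<in> cont r (z, t). Q W})"
    by blast
  moreover have "cont r (z, t) \<inter> cont r (z, t') = {}" if "t \<noteq> t'" for t t'
    using that path_unique by (fastforce simp: cont_def)
  ultimately show ?thesis
    using finite_opt finite_cont by (simp only:) (intro card_UN_disjoint, auto)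
qed

lemma of_rat_sum: "of_rat (\<Sum>x\<in>A. f x) = (\<Sum>x\<in>A. of_rat (f x) :: real)"
  by (induction A rule: infinite_finite_induct) (simp_all add: of_rat_add)

text \<open>Grouping optimal walks by the temporal node \<open>y\<close> in which they end turns the
  sum over targets into a single sum; the quotients of \<open>delta\<close> are absorbed by
  \<open>weight\<close>.\<close>

lemma sum_delta:
  assumes E: "\<And>e. e \<in> E \<Longrightarrow> dst e < n"
    and opt: "\<And>z. z \<noteq> s \<Longrightarrow> opt_walks strict c n E s z = (\<Union>t\<in>opt a z. cont r (z, t))"
  shows "(\<Sum>z | z < n \<and> z \<noteq> v \<and> z \<noteq> s. delta strict md c n T E s z v t) =
    of_rat (\<Sum>y | D y \<noteq> 0 \<and> fst y \<noteq> v. weight a y * of_nat (card {W \<in> cont r y. (v, t) \<in> Vis md T W}))"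
proof -
  let ?c = "\<lambda>y. card {W \<in> cont r y. (v, t) \<in> Vis md T W}"
  let ?Z = "{z. z < n \<and> z \<noteq> v \<and> z \<noteq> s}"
  have d: "delta strict md c n T E s z v t = of_rat (\<Sum>t'\<in>opt a z. weight a (z, t') * of_nat (?c (z, t')))"
    if "z \<noteq> s" for z
  proof -
    have "sigma strict c n E s z = total a z"
      using card_opt_walks[of z a "\<lambda>_. True"] unfolding sigma_def total_def opt[OF that]
        simp_thms Collect_mem_eq card_cont_root' .
    moreover have "sigma_at strict md c n T E s z v t = (\<Sum>t'\<in>opt a z. ?c (z, t'))"
      unfolding sigma_at_def opt[OF that] by (rule card_opt_walks)
    moreover have "(\<Sum>t'\<in>opt a z. weight a (z, t') * of_nat (?c (z, t'))) =
        of_nat (\<Sum>t'\<in>opt a z. ?c (z, t')) / of_nat (total a z)"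
      using that by (simp add: weight_def sum_divide_distrib)
    ultimately show ?thesis
      by (simp add: delta_def of_rat_divide of_rat_sum)
  qed
  \<comment> \<open>Reached nodes other than the root are heads of arcs and so lie below
    \<open>n\<close>; the root has weight 0.\<close>
  have reach: "{y. D y \<noteq> 0 \<and> fst y \<noteq> v \<and> weight a y \<noteq> 0} = {y. y \<in> Sigma ?Z (opt a) \<and> weight a y \<noteq> 0}"
  proof -
    have "fst y < n" if "D y \<noteq> 0" "y \<noteq> r" for y
    proof -
      have "\<exists>e. e \<in> E \<and> snd e = y"
        using parent[OF that] by (auto simp: edge_def)
      then obtain e where "e \<in> E" "snd e = y"
        by blast
      then show ?thesis
        using E[of e] by (auto simp: dst_def)
    qed
    then show ?thesis
      by (fastforce simp: weight_def opt_def split: if_splits)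
  qed
  have "(\<Sum>z\<in>?Z. delta strict md c n T E s z v t) =
      of_rat (\<Sum>z\<in>?Z. \<Sum>t'\<in>opt a z. weight a (z, t') * of_nat (?c (z, t')))"
    unfolding of_rat_sum using d by (simp add: of_rat_sum)
  also have "(\<Sum>z\<in>?Z. \<Sum>t'\<in>opt a z. weight a (z, t') * of_nat (?c (z, t'))) =
      (\<Sum>y\<in>Sigma ?Z (opt a). weight a y * of_nat (?c y))"
    using finite_opt by (subst sum.Sigma) auto
  also have "\<dots> = (\<Sum>y | y \<in> Sigma ?Z (opt a) \<and> weight a y \<noteq> 0. weight a y * of_nat (?c y))"
    using finite_opt by (intro sum.mono_neutral_right) auto
  also have "\<dots> = (\<Sum>y | D y \<noteq> 0 \<and> fst y \<noteq> v. weight a y * of_nat (?c y))"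
    unfolding reach[symmetric] using finite_reached by (intro sum.mono_neutral_left) auto
  finally show ?thesis .
qed

text \<open>An optimal walk to \<open>v\<close> has not been at \<open>v\<close> before: its prefix would be cheaper.\<close>

lemma cont_opt_self:
  assumes "D (v, t) \<noteq> 0" "t' \<in> opt a v" "cont (v, t) (v, t') \<noteq> {}"
  shows "t = t'"
proof -
  obtain W where W: "P (v, t) W (v, t')" "D (v, t') = D (v, t) + length W"
    using assms(3) by (auto simp: cont_def)
  have "a * t \<le> a * t'"
    using path_time[OF W(1)] by (simp del: mult_le_cancel1)
  moreover have "key a (v, t') \<le> key a (v, t)"
    using assms(1,2) by (auto simp: opt_def)
  ultimately have "length W = 0"
    using W(2) unfolding key_def snd_conv by linarith
  then show ?thesis
    using W(1) by simp
qed

section \<open>Visits by arrival and by waiting\<close>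

lemma passing_iff_nth:
  assumes "P r W y" "x \<noteq> r"
  shows "(\<exists>i < length W. snd (W ! i) = x) \<longleftrightarrow> (\<exists>W1 W2. W = W1 @ W2 \<and> P r W1 x)"
proof
  assume "\<exists>i < length W. snd (W ! i) = x"
  then obtain i where i: "i < length W" "snd (W ! i) = x"
    by blast
  obtain z where "P r (take (Suc i) W) z"
    using assms(1) append_take_drop_id[of "Suc i" W] by (metis path_append)
  moreover from path_last[OF this] have "z = x"
    using i by (simp add: take_Suc_conv_app_nth)
  ultimately show "\<exists>W1 W2. W = W1 @ W2 \<and> P r W1 x"
    by (metis append_take_drop_id)
next
  assume "\<exists>W1 W2. W = W1 @ W2 \<and> P r W1 x"
  then obtain W1 W2 where W: "W = W1 @ W2" "P r W1 x"
    by blast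
  then have "W1 \<noteq> []"
    using assms(2) by auto
  then show "\<exists>i < length W. snd (W ! i) = x"
    using path_last[OF W(2)] W(1)
    by (intro exI[of _ "length W1 - 1"]) (simp add: nth_append last_conv_nth trans_less_add1)
qed

text \<open>Here the walk has been at \<open>v\<close> since some time strictly before
  \<open>t\<close> and leaves at \<open>t\<close> or later. An arrival exactly at \<open>t\<close>
  belongs to \<open>passing\<close> instead.\<close>

definition crossing :: "nat \<Rightarrow> nat \<Rightarrow> nat \<times> nat \<Rightarrow> arc list set" where
  "crossing v t y = {W \<in> cont r y. \<exists>W1 e W2 u. W = W1 @ e # W2 \<and> P r W1 u \<and> fst u = v \<and> snd u < t \<and> t \<le> tm e}"

lemma crossing_iff_nth:
  assumes "P r W y" "v \<noteq> s"
  shows "(\<exists>i. Suc i < length W \<and> dst (W ! i) = v \<and> tm (W ! i) < t \<and> t \<le> tm (W ! Suc i)) \<longleftrightarrow>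
    (\<exists>W1 e W2 u. W = W1 @ e # W2 \<and> P r W1 u \<and> fst u = v \<and> snd u < t \<and> t \<le> tm e)"
proof
  assume "\<exists>i. Suc i < length W \<and> dst (W ! i) = v \<and> tm (W ! i) < t \<and> t \<le> tm (W ! Suc i)"
  then obtain i where i: "Suc i < length W" "dst (W ! i) = v" "tm (W ! i) < t" "t \<le> tm (W ! Suc i)"
    by blast
  obtain z where z: "P r (take (Suc i) W) z"
    using assms(1) append_take_drop_id[of "Suc i" W] by (metis path_append)
  have "z = snd (W ! i)"
    using path_last[OF z] i(1) by (simp add: take_Suc_conv_app_nth)
  then show "\<exists>W1 e W2 u. W = W1 @ e # W2 \<and> P r W1 u \<and> fst u = v \<and> snd u < t \<and> t \<le> tm e"
    using z i id_take_nth_drop[OF i(1)] unfolding dst_def tm_def by blast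
next
  assume "\<exists>W1 e W2 u. W = W1 @ e # W2 \<and> P r W1 u \<and> fst u = v \<and> snd u < t \<and> t \<le> tm e"
  then obtain W1 e W2 u where W: "W = W1 @ e # W2" "P r W1 u" "fst u = v" "snd u < t" "t \<le> tm e"
    by blast
  then have "W1 \<noteq> []"
    using assms(2) by auto
  moreover from this have "snd (W1 ! (length W1 - 1)) = u"
    using path_last[OF W(2)] by (simp add: last_conv_nth)
  ultimately show "\<exists>i. Suc i < length W \<and> dst (W ! i) = v \<and> tm (W ! i) < t \<and> t \<le> tm (W ! Suc i)"
    using W by (intro exI[of _ "length W1 - 1"]) (auto simp: nth_append dst_def tm_def)
qed

lemma passing_subset: "passing x y \<subseteq> cont r y" and crossing_subset: "crossing v t y \<subseteq> cont r y"
  unfolding passing_def crossing_def by simp_all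

lemma Vis_Passive:
  assumes "W \<in> cont r y" "v \<noteq> s" "fst y \<noteq> s"
  shows "(v, t) \<in> Vis Passive T W \<longleftrightarrow> W \<in> passing (v, t) y"
proof -
  have W: "P r W y" "W \<noteq> []"
    using assms by (auto simp: cont_def)
  then have "src (hd W) = s"
    by (cases W) (auto simp: edge_def)
  then have "(v, t) \<in> Vis Passive T W \<longleftrightarrow> (\<exists>i < length W. snd (W ! i) = (v, t))"
    using assms(2) by (auto simp: Vis_def dst_def tm_def prod_eq_iff)
  then show ?thesis
    using passing_iff_nth[OF W(1), of "(v, t)"] assms by (simp add: passing_def)
qed

text \<open>The final wait takes place at \<open>fst y\<close>, which is not \<open>v\<close>. Any
  other visit at time \<open>t\<close> either begins with an arrival at \<open>t\<close> or has
  begun earlier.\<close>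

lemma Vis_Active:
  assumes "W \<in> cont r y" "v \<noteq> s" "fst y \<noteq> s" "fst y \<noteq> v"
  shows "(v, t) \<in> Vis Active T W \<longleftrightarrow> W \<in> passing (v, t) y \<union> crossing v t y"
proof -
  have W: "P r W y" "W \<noteq> []"
    using assms by (auto simp: cont_def)
  have "src (hd W) = s"
    using W by (cases W) (auto simp: edge_def)
  moreover have last: "snd (last W) = y"
    using path_last[OF W] by simp
  then have "dst (last W) = fst y"
    by (simp add: dst_def)
  ultimately have "(v, t) \<in> Vis Active T W \<longleftrightarrow>
      (\<exists>i. Suc i < length W \<and> dst (W ! i) = v \<and> tm (W ! i) \<le> t \<and> t \<le> tm (W ! Suc i))"
    using assms by (auto simp: Vis_def)
  also have "\<dots> \<longleftrightarrow> (\<exists>i < length W. snd (W ! i) = (v, t)) \<or>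
      (\<exists>i. Suc i < length W \<and> dst (W ! i) = v \<and> tm (W ! i) < t \<and> t \<le> tm (W ! Suc i))" (is "?L \<longleftrightarrow> ?A \<or> ?B")
  proof
    assume ?L
    then obtain i where i: "Suc i < length W" "dst (W ! i) = v" "tm (W ! i) \<le> t" "t \<le> tm (W ! Suc i)"
      by blast
    show "?A \<or> ?B"
    proof (cases "tm (W ! i) = t")
      case True
      then have "snd (W ! i) = (v, t)"
        using i(2) by (simp add: dst_def tm_def prod_eq_iff)
      then show ?thesis
        using i(1) Suc_lessD by blast
    next
      case False
      then show ?thesis
        using i le_neq_implies_less by blast
    qed
  next
    assume "?A \<or> ?B"
    then show ?L
    proof
      assume ?A
      then obtain i where i: "i < length W" "snd (W ! i) = (v, t)"
        by blast
      \<comment> \<open>The walk does not end at \<open>v\<close>, so a next arc exists, and it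
        leaves no earlier than \<open>t\<close>. The arrival thus opens a waiting period, possibly
        of length 0.\<close>
      have "Suc i \<noteq> length W"
      proof
        assume "Suc i = length W"
        then have "i = length W - 1"
          by simp
        then show False
          using i(2) last W(2) assms(4) by (metis fst_conv last_conv_nth)
      qed
      then have Suc: "Suc i < length W"
        using i(1) by linarith
      have "W = take (Suc i) W @ W ! Suc i # drop (Suc (Suc i)) W"
        using id_take_nth_drop[OF Suc] .
      then obtain z where z: "P r (take (Suc i) W) z" "edge strict K E z (W ! Suc i)"
        using W(1) by (metis path_append path.simps(2))
      have "z = (v, t)"
        using path_last[OF z(1)] i by (simp add: take_Suc_conv_app_nth)
      then have "t \<le> tm (W ! Suc i)"
        using z(2) by (auto simp: edge_def ok_def split: if_splits)
      then show ?L
        using Suc i(2) by (intro exI[of _ i]) (auto simp: dst_def tm_def)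
    next
      assume ?B
      then show ?L
        using less_imp_le by blast
    qed
  qed
  also have "\<dots> \<longleftrightarrow> W \<in> passing (v, t) y \<union> crossing v t y"
    using passing_iff_nth[OF W(1), of "(v, t)"] crossing_iff_nth[OF W(1) assms(2), of t] assms
    by (simp add: passing_def crossing_def)
  finally show ?thesis .
qed

definition skipping :: "nat \<Rightarrow> nat \<Rightarrow> ((nat \<times> nat) \<times> arc) set" where
  "skipping v t = {(u, e) \<in> tight. fst u = v \<and> snd u < t \<and> t \<le> tm e}"

text \<open>Times along a path never decrease: after an arc taken at \<open>t\<close> or later no
  node has a time below \<open>t\<close>, so only one arc can span \<open>t\<close>.\<close>

lemma crossing_unique:
  assumes "W1 @ e # R = W1' @ e' # R'" "P r W1 u" "P r W1' u'"
    "snd u < t" "t \<le> tm e" "snd u' < t" "t \<le> tm e'"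
  shows "W1 = W1' \<and> u = u' \<and> e = e'"
proof -
  have False if "V = V' @ f # Z" "P r V w" "snd w < t" "t \<le> tm f" for V V' f Z w
    using that path_time[of strict K E "snd f" Z w] by (auto simp: path_append tm_def)
  note no = this
  obtain us where "W1 = W1' @ us \<and> us @ e # R = e' # R' \<or> W1 @ us = W1' \<and> e # R = us @ e' # R'"
    using assms(1) unfolding append_eq_append_conv2 by blast
  then have "W1 = W1'" "e = e'"
    using no[of W1 W1' e' _ u] no[of W1' W1 e _ u'] assms by (cases us; auto)+
  then show ?thesis
    using assms path_unique by auto
qed

text \<open>A crossing walk singles out its spanning edge by \<open>crossing_unique\<close>; the
  parts before and after it are independent.\<close>

lemma card_crossing:
  "card (crossing v t y) = (\<Sum>(u, e)\<in>skipping v t. S u * card (cont (snd e) y))"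
proof -
  let ?f = "\<lambda>p (W1, W2). W1 @ snd p # W2"
  let ?C = "\<lambda>p. ?f p ` (cont r (fst p) \<times> cont (snd (snd p)) y)"
  have fin: "finite (skipping v t)"
    by (rule finite_subset[OF _ finite_tight]) (auto simp: skipping_def)
  have eq: "crossing v t y = (\<Union>p\<in>skipping v t. ?C p)"
  proof (intro set_eqI iffI)
    fix W assume "W \<in> crossing v t y"
    then obtain W1 e W2 u where W: "W = W1 @ e # W2" "P r W1 u" "fst u = v" "snd u < t" "t \<le> tm e"
      "P r W y" "D y = Suc (length W)"
      using root by (auto simp: crossing_def cont_def)
    have "P u (e # W2) y"
      using path_suffix[OF W(6)[unfolded W(1)] W(2)] .
    then have "W1 \<in> cont r u" "e # W2 \<in> cont u y"
      using cont_split[of r W1 u "e # W2" y] root W by auto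
    moreover have "D u \<noteq> 0"
      using dist_le[OF W(2)] by blast
    ultimately have "(u, e) \<in> skipping v t" "(W1, W2) \<in> cont r u \<times> cont (snd e) y"
      using W by (auto simp: skipping_def cont_Cons)
    then show "W \<in> (\<Union>p\<in>skipping v t. ?C p)"
      unfolding W(1) by (intro UN_I[of "(u, e)"] image_eqI[of _ _ "(W1, W2)"]) simp_all
  next
    fix W assume "W \<in> (\<Union>p\<in>skipping v t. ?C p)"
    then obtain p where p: "p \<in> skipping v t" "W \<in> ?C p"
      by (rule UN_E)
    from p(2) obtain q where q: "q \<in> cont r (fst p) \<times> cont (snd (snd p)) y" "W = ?f p q"
      by (rule imageE) (rule that)
    obtain u e where "p = (u, e)"
      by (rule prod.exhaust)
    moreover obtain W1 W2 where "q = (W1, W2)"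
      by (rule prod.exhaust)
    ultimately have W: "(u, e) \<in> skipping v t" "W = W1 @ e # W2" "W1 \<in> cont r u" "W2 \<in> cont (snd e) y"
      using p(1) q by simp_all
    moreover from this have "e # W2 \<in> cont u y"
      using cont_Cons[of u e W2 y] by (auto simp: skipping_def tight_def)
    ultimately have "W \<in> cont r y" "P r W1 u" "fst u = v" "snd u < t" "t \<le> tm e"
      using cont_append by (auto simp: skipping_def cont_def)
    then show "W \<in> crossing v t y"
      using W(2) unfolding crossing_def by blast
  qed
  have "card (crossing v t y) = (\<Sum>p\<in>skipping v t. card (?C p))"
    unfolding eq
  proof (intro card_UN_disjoint ballI impI)
    fix p q assume pq: "p \<in> skipping v t" "q \<in> skipping v t" "p \<noteq> q"
    have False if W: "W1 @ snd p # W2 = V1 @ snd q # V2" "W1 \<in> cont r (fst p)" "V1 \<in> cont r (fst q)" for W1 W2 V1 V2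
    proof -
      have "P r W1 (fst p)" "P r V1 (fst q)" "snd (fst p) < t" "t \<le> tm (snd p)" "snd (fst q) < t" "t \<le> tm (snd q)"
        using pq W(2,3) by (auto simp: skipping_def cont_def)
      from crossing_unique[OF W(1) this] pq(3) show False
        by (simp add: prod_eq_iff)
    qed
    then show "?C p \<inter> ?C q = {}"
      by fast
  qed (use fin finite_cont in auto)
  also have "\<dots> = (\<Sum>p\<in>skipping v t. S (fst p) * card (cont (snd (snd p)) y))"
  proof (intro sum.cong refl)
    fix p
    have "inj_on (?f p) (cont r (fst p) \<times> cont (snd (snd p)) y)"
      by (auto simp: inj_on_def cont_def)
    then show "card (?C p) = S (fst p) * card (cont (snd (snd p)) y)"
      by (simp only: card_image card_cartesian_product card_cont_root')
  qed
  finally show ?thesis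
    by (simp add: case_prod_beta)
qed

text \<open>A walk can be at \<open>(v, t)\<close> twice in the active sense, when it waits at \<open>v\<close> until time \<open>t\<close>,
  leaves, and is back at \<open>v\<close> still at time \<open>t\<close>. Restlessness may force an optimal walk to do so.\<close>

definition snapshot_cycles :: "nat \<times> nat \<Rightarrow> nat \<times> nat \<Rightarrow> arc list set" where
  "snapshot_cycles u x = {C \<in> cont u x. \<forall>e\<in>set C. tm e = snd x}"

text \<open>The arc that ends the wait is taken at \<open>t\<close> or later and
  \<open>(v, t)\<close> is reached after it, so everything in between happens at time
  \<open>t\<close>, within one snapshot. This cycle cuts the walk into three independent
  parts.\<close>

lemma card_overlap:
  assumes "v \<noteq> s"
  shows "card (passing (v, t) y \<inter> crossing v t y) =
    (\<Sum>i | i < t \<and> D (v, i) \<noteq> 0. S (v, i) * card (snapshot_cycles (v, i) (v, t))) * card (cont (v, t) y)"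
proof -
  let ?I = "{i. i < t \<and> D (v, i) \<noteq> 0}"
  let ?f = "\<lambda>(W1, C, W2). W1 @ C @ W2 :: arc list"
  let ?A = "\<lambda>i. cont r (v, i) \<times> snapshot_cycles (v, i) (v, t) \<times> cont (v, t) y"
  have eq: "passing (v, t) y \<inter> crossing v t y = (\<Union>i\<in>?I. ?f ` ?A i)"
  proof (intro set_eqI iffI)
    fix W assume "W \<in> passing (v, t) y \<inter> crossing v t y"
    then have "W \<in> passing (v, t) y" "W \<in> crossing v t y"
      by simp_all
    moreover obtain V1 V2 where "W = V1 @ V2" "P r V1 (v, t)"
      using calculation(1) unfolding passing_def by blast
    moreover obtain W1 e W2 u where "W = W1 @ e # W2" "P r W1 u" "fst u = v" "snd u < t" "t \<le> tm e"
      using calculation(2) unfolding crossing_def by blast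
    moreover have "P r W y" "D y = Suc (length W)"
      using calculation(1) root by (simp_all add: passing_def cont_def)
    ultimately have W: "W = V1 @ V2" "P r V1 (v, t)"
      "W = W1 @ e # W2" "P r W1 u" "fst u = v" "snd u < t" "t \<le> tm e" "P r W y" "D y = Suc (length W)"
      by simp_all
    \<comment> \<open>The prefix that reaches \<open>(v, t)\<close> contains the spanning arc:
      otherwise \<open>W1\<close> would extend it and end no earlier than \<open>t\<close>.\<close>
    obtain Z where Z: "V1 = W1 @ e # Z"
    proof -
      obtain us where "V1 = W1 @ us \<and> us @ V2 = e # W2 \<or> V1 @ us = W1 \<and> V2 = us @ e # W2"
        using W(3)[unfolded W(1) append_eq_append_conv2] by blast
      moreover have False if "W1 = V1 @ us" for us
        using path_time[OF path_suffix[OF W(4)[unfolded that] W(2)]] W(6) by simp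
      ultimately show ?thesis
        using that by (cases us) (metis append_Nil2, auto)
    qed
    let ?C = "e # Z"
    have C: "P u ?C (v, t)"
      using path_suffix[OF W(2)[unfolded Z] W(4)] .
    have V2: "P (v, t) V2 y"
      using path_suffix[OF W(8)[unfolded W(1)] W(2)] .
    have len: "D y = D r + length W1 + length (?C @ V2)"
      using W(1,9) Z root by simp
    have u: "D u \<noteq> 0" "D r \<noteq> 0"
      using dist_le[OF W(4)] root by auto
    have CV: "P u (?C @ V2) y"
      using C V2 path_append by blast
    note 1 = cont_split[OF u(2) W(4) CV len]
    then have "D y = D u + length ?C + length V2"
      by (simp add: cont_def)
    note 2 = cont_split[OF u(1) C V2 this]
    have "\<forall>f\<in>set ?C. tm f = t"
      using path_time[OF C] W(7) path_time[of strict K E "snd e" Z "(v, t)"] C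
      by (fastforce simp: tm_def)
    then have "(W1, ?C, V2) \<in> ?A (snd u)"
      using 1 2 W(5) by (auto simp: snapshot_cycles_def prod_eq_iff)
    moreover have "W = ?f (W1, ?C, V2)"
      using W(1) Z by simp
    ultimately show "W \<in> (\<Union>i\<in>?I. ?f ` ?A i)"
      using u(1) W(5,6) by (intro UN_I[of "snd u"] image_eqI[of _ _ "(W1, ?C, V2)"]) auto
  next
    fix W assume "W \<in> (\<Union>i\<in>?I. ?f ` ?A i)"
    then obtain i W1 C W2 where W: "i < t" "D (v, i) \<noteq> 0" "W = W1 @ C @ W2" "W1 \<in> cont r (v, i)"
      "C \<in> cont (v, i) (v, t)" "\<forall>e\<in>set C. tm e = t" "W2 \<in> cont (v, t) y"
      by (auto simp: snapshot_cycles_def)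
    then obtain e Z where e: "C = e # Z" "tm e = t"
      by (cases C) (auto simp: cont_def)
    have "W1 @ C \<in> cont r (v, t)" "W \<in> cont r y"
      using W cont_append by blast+
    then have "W = (W1 @ C) @ W2" "P r (W1 @ C) (v, t)" "W \<in> cont r y"
      using W(3) by (simp_all add: cont_def)
    then have "W \<in> passing (v, t) y"
      unfolding passing_def by blast
    moreover have "W = W1 @ e # (Z @ W2)" "P r W1 (v, i)"
      using W e by (auto simp: cont_def)
    with W(1) e(2) \<open>W \<in> cont r y\<close> have "W \<in> crossing v t y"
      unfolding crossing_def by (intro CollectI conjI exI[of _ W1] exI[of _ e] exI[of _ "Z @ W2"] exI[of _ "(v, i)"]) simp_all
    ultimately show "W \<in> passing (v, t) y \<inter> crossing v t y"
      by blast
  qed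
  have "card (passing (v, t) y \<inter> crossing v t y) = (\<Sum>i\<in>?I. card (?f ` ?A i))"
    unfolding eq
  proof (intro card_UN_disjoint ballI impI)
    fix i j assume ij: "i \<in> ?I" "j \<in> ?I" "i \<noteq> j"
    have False if "W1 @ C @ W2 = V1 @ B @ V2" "(W1, C, W2) \<in> ?A i" "(V1, B, V2) \<in> ?A j" for W1 C W2 V1 B V2
    proof -
      have "C \<noteq> []" "B \<noteq> []"
        using that(2,3) ij by (auto simp: cont_def snapshot_cycles_def)
      then obtain e Z f Y where C: "C = e # Z" "B = f # Y"
        by (meson list.exhaust)
      have "P r W1 (v, i)" "P r V1 (v, j)" "tm e = t" "tm f = t" "snd (v, i) < t" "snd (v, j) < t"
        using that(2,3) ij C by (auto simp: cont_def snapshot_cycles_def)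
      moreover have "W1 @ e # Z @ W2 = V1 @ f # Y @ V2"
        using that(1) C by simp
      ultimately have "(v, i) = (v, j)"
        using crossing_unique by (metis order_refl)
      then show False
        using ij by simp
    qed
    then show "?f ` ?A i \<inter> ?f ` ?A j = {}"
      by fast
  qed (auto simp: snapshot_cycles_def finite_cont)
  also have "\<dots> = (\<Sum>i\<in>?I. S (v, i) * card (snapshot_cycles (v, i) (v, t)) * card (cont (v, t) y))"
  proof (intro sum.cong refl)
    fix i
    have "inj_on ?f (?A i)"
      by (auto simp: inj_on_def cont_def snapshot_cycles_def)
    then show "card (?f ` ?A i) = S (v, i) * card (snapshot_cycles (v, i) (v, t)) * card (cont (v, t) y)"
      by (simp only: card_image card_cartesian_product card_cont_root' mult.assoc)
  qed
  finally show ?thesis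
    by (simp add: sum_distrib_right)
qed

text \<open>\<open>D0\<close> and \<open>S0\<close> stem from the search with window 0 rooted at
  \<open>(fst x, 0)\<close>, so \<open>D0 x - 1\<close> is the length of a shortest snapshot cycle.
  The equation says that arriving at time \<open>i\<close> and then running through such a cycle is
  a shortest way to \<open>x\<close>; \<open>snd x \<le> i + K\<close> permits the wait.\<close>

definition overlap :: "(nat \<times> nat \<Rightarrow> nat) \<Rightarrow> (nat \<times> nat \<Rightarrow> nat) \<Rightarrow> nat \<times> nat \<Rightarrow> nat" where
  "overlap D0 S0 x = (\<Sum>i | i < snd x \<and> snd x \<le> i + K \<and> D (fst x, i) \<noteq> 0 \<and> D0 x \<noteq> 0 \<and>
     Suc (D x) = D (fst x, i) + D0 x. S (fst x, i) * S0 x)"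

section \<open>Weighted sums over all targets\<close>

context
  fixes g :: "nat \<times> nat \<Rightarrow> rat" and a :: nat
  assumes g: "D x \<noteq> 0 \<Longrightarrow> g x = weight a x + (\<Sum>e | (x, e) \<in> tight. g (snd e))"
begin

text \<open>Among the ends at the node of \<open>x\<close>, only \<open>x\<close> itself can be both
  optimal and the end of a continuation from \<open>x\<close>, by \<open>cont_opt_self\<close>.
  Excluding this node as a target therefore costs exactly \<open>weight a x\<close>.\<close>

lemma sum_weight_not_self:
  assumes "D x \<noteq> 0"
  shows "(\<Sum>y | D y \<noteq> 0 \<and> fst y \<noteq> fst x. weight a y * of_nat (card (cont x y))) = g x - weight a x"
proof -
  let ?f = "\<lambda>y. weight a y * of_nat (card (cont x y))"
  have 0: "?f y = 0" if "fst y = fst x" "y \<noteq> x" for y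
  proof -
    have "cont x y = {}" if "snd y \<in> opt a (fst y)"
      using cont_opt_self[of "fst x" "snd x" "snd y" a] assms that \<open>fst y = fst x\<close> \<open>y \<noteq> x\<close>
      by (metis prod.collapse)
    then show ?thesis
      by (auto simp: weight_def)
  qed
  then have "(\<Sum>y | D y \<noteq> 0 \<and> fst y = fst x. ?f y) = ?f x"
    using assms finite_reached sum.neutral[of "{y. D y \<noteq> 0 \<and> fst y = fst x} - {x}" ?f]
    by (subst sum.remove[of _ x]) (simp_all add: 0 del: mult_eq_0_iff)
  moreover have "(\<Sum>y | D y \<noteq> 0. ?f y) =
      (\<Sum>y | D y \<noteq> 0 \<and> fst y = fst x. ?f y) + (\<Sum>y | D y \<noteq> 0 \<and> fst y \<noteq> fst x. ?f y)"
    using finite_reached by (subst sum.union_disjoint[symmetric]) (auto intro: arg_cong2[where f = sum])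
  ultimately show ?thesis
    using backward_sum[of g "weight a", OF g assms] by (simp add: cont_self)
qed

text \<open>After an edge that leaves the node of \<open>x\<close> there is nothing to subtract: an
  optimal walk to this node would have ended before taking the edge.\<close>

lemma sum_weight_tight:
  assumes "(x, e) \<in> tight"
  shows "(\<Sum>y | D y \<noteq> 0 \<and> fst y \<noteq> fst x. weight a y * of_nat (card (cont (snd e) y))) = g (snd e)"
proof -
  let ?f = "\<lambda>y. weight a y * of_nat (card (cont (snd e) y))"
  have x: "D x \<noteq> 0" "D (snd e) \<noteq> 0"
    using assms by (auto simp: tight_def)
  have 0: "?f y = 0" if y: "fst y = fst x" for y
  proof (rule ccontr)
    assume "?f y \<noteq> 0"
    then obtain W where W: "W \<in> cont (snd e) y" and w: "weight a y \<noteq> 0"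
      using finite_cont[of "snd e" y] by (auto simp: card_eq_0_iff)
    have "e # W \<in> cont x y"
      using cont_Cons[OF x(1)] assms W by blast
    moreover from this have "x = y"
      using cont_opt_self[of "fst x" "snd x" "snd y" a] x y w
      by (cases x; cases y) (auto simp: weight_def split: if_splits)
    ultimately show False
      by (simp add: cont_self)
  qed
  then have "(\<Sum>y | D y \<noteq> 0 \<and> fst y \<noteq> fst x. ?f y) = (\<Sum>y | D y \<noteq> 0. ?f y)"
    using finite_reached 0 by (intro sum.mono_neutral_left ballI subsetI) (auto simp del: mult_eq_0_iff)
  then show ?thesis
    using backward_sum[of g "weight a", OF g x(2)] by simp
qed

lemma sum_passive:
  assumes "v \<noteq> s"
  shows "(\<Sum>y | D y \<noteq> 0 \<and> fst y \<noteq> v. weight a y * of_nat (card {W \<in> cont r y. (v, t) \<in> Vis Passive T W})) =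
    of_nat (S (v, t)) * (g (v, t) - weight a (v, t))"
proof (cases "D (v, t) = 0")
  case False
  have "weight a y * of_nat (card {W \<in> cont r y. (v, t) \<in> Vis Passive T W}) =
      of_nat (S (v, t)) * (weight a y * of_nat (card (cont (v, t) y)))" for y
  proof (cases "weight a y = 0")
    case False
    then have "fst y \<noteq> s"
      by (auto simp: weight_def)
    from Vis_Passive[OF _ assms this]
    have "{W \<in> cont r y. (v, t) \<in> Vis Passive T W} = passing (v, t) y"
      using passing_subset by blast
    then show ?thesis
      by (simp add: card_passing card_cont_root')
  qed simp
  then show ?thesis
    using sum_weight_not_self[OF False] unfolding fst_conv by (simp only: sum_distrib_left[symmetric])
next
  case True
  \<comment> \<open>At an unreached node \<open>g\<close> is arbitrary, but \<open>S\<close> is 0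
    and no shortest walk passes.\<close>
  have "{W \<in> cont r y. (v, t) \<in> Vis Passive T W} = {}" if "fst y \<noteq> s" for y
    using Vis_Passive[OF _ assms that] card_passing[of "(v, t)" y] True finite_cont[of r y]
    by (auto simp: card_cont_root' unreached passing_def card_eq_0_iff)
  from arg_cong[OF this, of _ card]
  have "card {W \<in> cont r y. (v, t) \<in> Vis Passive T W} = 0" if "fst y \<noteq> s" for y
    unfolding card.empty using that .
  then have "weight a y * of_nat (card {W \<in> cont r y. (v, t) \<in> Vis Passive T W}) = 0" for y
    by (cases "fst y = s") (simp add: weight_def, simp del: card_eq_0_iff)
  then show ?thesis
    using True by (simp only: unreached sum.neutral) simp
qed

end

end


section \<open>Shortest cycles within a snapshot\<close>

lemma path_snapshot:
  assumes "1 \<le> snd y"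
  shows "path strict 0 E y C x \<longleftrightarrow> path strict K E y C x \<and> (\<forall>e\<in>set C. tm e = snd y)"
  using assms
proof (induction C arbitrary: y)
  case (Cons e C)
  have "edge strict 0 E y e \<longleftrightarrow> edge strict K E y e \<and> tm e = snd y"
    using Cons.prems by (auto simp: edge_def ok_def)
  moreover have "snd (snd e) = tm e"
    by (simp add: tm_def)
  ultimately show ?case
    using Cons.IH[of "snd e"] Cons.prems by auto
qed simp

text \<open>Any first arc may be taken from \<open>(v, 0)\<close>, and window 0 freezes the time
  afterwards. So a single search from \<open>v\<close> covers the snapshots of all times at
  once.\<close>

locale bfs_trees = bfs_tree strict K E s D S + cyc: bfs_tree strict 0 E v D0 S0
  for strict K E s D S v D0 S0 +
  assumes v: "v \<noteq> s"
begin

lemma reached_time: "D (v, i) \<noteq> 0 \<Longrightarrow> 1 \<le> i"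
  using parent[of "(v, i)"] v pos by (fastforce simp: edge_def tm_def)

text \<open>The arrival time \<open>i\<close> only affects the first arc, through
  \<open>t \<le> i + K\<close>; the rest of the cycle is the same from \<open>(v, i)\<close> and
  from \<open>(v, 0)\<close>. This makes the cycle counts independent of the source.\<close>

lemma snapshot_path:
  assumes "1 \<le> i" "i < t"
  shows "P (v, i) C (v, t) \<and> (\<forall>e\<in>set C. tm e = t) \<longleftrightarrow> t \<le> i + K \<and> path strict 0 E (v, 0) C (v, t)"
proof (cases C)
  case (Cons e Z)
  have time: "snd (snd e) = tm e"
    by (simp add: tm_def)
  have "path strict 0 E (snd e) Z (v, t) \<longleftrightarrow> P (snd e) Z (v, t) \<and> (\<forall>f\<in>set Z. tm f = tm e)" if "e \<in> E"
    using path_snapshot[of "snd e" strict E Z "(v, t)" K] pos[OF that] unfolding time by blast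
  moreover have "tm e = t" if "P (snd e) Z (v, t)" "\<forall>f\<in>set Z. tm f = tm e"
  proof (cases "Z = []")
    case False
    then have "tm (last Z) = t"
      using path_last[OF that(1)] by (metis snd_conv tm_def)
    then show ?thesis
      using that(2) last_in_set[OF False] by simp
  qed (use that time in auto)
  ultimately show ?thesis
    using assms unfolding Cons by (auto simp: edge_def ok_def)
qed (use assms in auto)

text \<open>Members of \<open>cont\<close> have a prescribed length. It cannot exceed the length of
  a shortest cycle, which would otherwise improve \<open>D (v, t)\<close>. Hence either all shortest
  cycles qualify or no cycle does.\<close>

lemma card_snapshot_cycles:
  assumes "1 \<le> i" "i < t" "D (v, i) \<noteq> 0"
  shows "card (snapshot_cycles (v, i) (v, t)) =
    (if t \<le> i + K \<and> D0 (v, t) \<noteq> 0 \<and> Suc (D (v, t)) = D (v, i) + D0 (v, t) then S0 (v, t) else 0)"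
proof (cases "t \<le> i + K \<and> D0 (v, t) \<noteq> 0 \<and> Suc (D (v, t)) = D (v, i) + D0 (v, t)")
  case True
  have "snapshot_cycles (v, i) (v, t) = cyc.cont (v, 0) (v, t)"
    using snapshot_path[OF assms(1,2)] True cyc.root
    unfolding snapshot_cycles_def cyc.cont_def cont_def by auto
  then show ?thesis
    using True cyc.card_cont_root' by simp
next
  case False
  have "snapshot_cycles (v, i) (v, t) = {}"
  proof (rule ccontr)
    assume "snapshot_cycles (v, i) (v, t) \<noteq> {}"
    then obtain C where C: "t \<le> i + K" "path strict 0 E (v, 0) C (v, t)" "D (v, t) = D (v, i) + length C"
      using snapshot_path[OF assms(1,2)] unfolding snapshot_cycles_def cont_def by auto
    have C0: "D0 (v, t) \<noteq> 0" "D0 (v, t) \<le> Suc (length C)"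
      using cyc.dist_le[OF C(2)] by auto
    obtain B where B: "path strict 0 E (v, 0) B (v, t)" "D0 (v, t) = Suc (length B)"
      using cyc.shortest_path[OF C0(1)] by blast
    have "D (v, t) \<le> D (v, i) + length B"
      using path_dist[of "(v, i)" B "(v, t)"] snapshot_path[OF assms(1,2), of B] B(1) C(1) assms(3) by blast
    then show False
      using False C C0 B(2) by simp
  qed
  then show ?thesis
    using False by auto
qed

lemma sum_overlap:
  "(\<Sum>i | i < t \<and> D (v, i) \<noteq> 0. S (v, i) * card (snapshot_cycles (v, i) (v, t))) = overlap D0 S0 (v, t)"
proof -
  have "(\<Sum>i | i < t \<and> D (v, i) \<noteq> 0. S (v, i) * card (snapshot_cycles (v, i) (v, t))) =
    (\<Sum>i | i < t \<and> D (v, i) \<noteq> 0. if t \<le> i + K \<and> D0 (v, t) \<noteq> 0 \<and> Suc (D (v, t)) = D (v, i) + D0 (v, t)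
       then S (v, i) * S0 (v, t) else 0)"
    using card_snapshot_cycles reached_time by (intro sum.cong refl) simp
  also have "\<dots> = overlap D0 S0 (v, t)"
    unfolding overlap_def by (subst sum.inter_filter[symmetric]) (auto intro!: sum.cong)
  finally show ?thesis .
qed

text \<open>Since \<open>g\<close> is arbitrary at unreached nodes, the factor in front of it in
  \<open>sum_active\<close> has to vanish there.\<close>

lemma overlap_unreached:
  assumes "1 \<le> t" "D (v, t) = 0"
  shows "overlap D0 S0 (v, t) = 0"
proof -
  have "D0 (v, t) \<noteq> 1"
    using cyc.parent[of "(v, t)"] assms(1) by force
  then show ?thesis
    using assms(2) by (auto simp: overlap_def)
qed

text \<open>Inclusion and exclusion for \<open>passing\<close> and \<open>crossing\<close>. Walks in
  the overlap share the continuation from \<open>(v, t)\<close> with the passing ones, so the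
  correction merges with \<open>S\<close> into one factor; crossing walks contribute through their
  spanning edge.\<close>

lemma sum_active:
  fixes g :: "nat \<times> nat \<Rightarrow> rat"
  assumes g: "\<And>x. D x \<noteq> 0 \<Longrightarrow> g x = weight a x + (\<Sum>e | (x, e) \<in> tight. g (snd e))" and t: "1 \<le> t"
  shows "(\<Sum>y | D y \<noteq> 0 \<and> fst y \<noteq> v. weight a y * of_nat (card {W \<in> cont r y. (v, t) \<in> Vis Active T W})) =
    (of_nat (S (v, t)) - of_nat (overlap D0 S0 (v, t))) * (g (v, t) - weight a (v, t)) +
    (\<Sum>(u, e)\<in>skipping v t. of_nat (S u) * g (snd e))"
proof -
  let ?Y = "{y. D y \<noteq> 0 \<and> fst y \<noteq> v}"
  let ?q = "of_nat (S (v, t)) - of_nat (overlap D0 S0 (v, t)) :: rat"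
  have card: "weight a y * of_nat (card {W \<in> cont r y. (v, t) \<in> Vis Active T W}) =
      ?q * (weight a y * of_nat (card (cont (v, t) y))) +
      (\<Sum>(u, e)\<in>skipping v t. of_nat (S u) * (weight a y * of_nat (card (cont (snd e) y))))" (is "?l = ?r")
    if y: "y \<in> ?Y" for y
  proof (cases "weight a y = 0")
    case False
    then have "fst y \<noteq> s"
      by (auto simp: weight_def)
    from Vis_Active[OF _ v this] y
    have "{W \<in> cont r y. (v, t) \<in> Vis Active T W} = passing (v, t) y \<union> crossing v t y"
      using passing_subset crossing_subset by blast
    moreover have "card (passing (v, t) y) + card (crossing v t y) =
        card (passing (v, t) y \<union> crossing v t y) + card (passing (v, t) y \<inter> crossing v t y)"
      by (rule card_Un_Int) (auto simp: passing_def crossing_def finite_cont)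
    ultimately have "of_nat (card {W \<in> cont r y. (v, t) \<in> Vis Active T W}) + of_nat (overlap D0 S0 (v, t) * card (cont (v, t) y)) =
        (of_nat (S (v, t) * card (cont (v, t) y)) + of_nat (\<Sum>(u, e)\<in>skipping v t. S u * card (cont (snd e) y)) :: rat)"
      unfolding card_passing card_crossing card_overlap[OF v] sum_overlap card_cont_root' of_nat_add[symmetric] by simp
    then have "of_nat (card {W \<in> cont r y. (v, t) \<in> Vis Active T W}) =
        ?q * of_nat (card (cont (v, t) y)) + (\<Sum>(u, e)\<in>skipping v t. of_nat (S u) * of_nat (card (cont (snd e) y)))"
      by (simp add: algebra_simps case_prod_beta)
    then have "?l = weight a y * (?q * of_nat (card (cont (v, t) y)) +
        (\<Sum>(u, e)\<in>skipping v t. of_nat (S u) * of_nat (card (cont (snd e) y))))"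
      by simp
    also have "\<dots> = ?r"
      by (simp add: distrib_left sum_distrib_left case_prod_beta ac_simps)
    finally show ?thesis .
  qed (simp add: case_prod_beta)
  have pass: "?q * (\<Sum>y\<in>?Y. weight a y * of_nat (card (cont (v, t) y))) = ?q * (g (v, t) - weight a (v, t))"
  proof (cases "D (v, t) = 0")
    case True
    then show ?thesis
      using overlap_unreached[OF t] by (simp add: unreached)
  next
    case False
    then show ?thesis
      using sum_weight_not_self[of g a "(v, t)", OF g] by simp
  qed
  have cross: "(\<Sum>y\<in>?Y. weight a y * of_nat (card (cont (snd e) y))) = g (snd e)" if "(u, e) \<in> skipping v t" for u e
    using sum_weight_tight[of g a u e, OF g] that by (auto simp: skipping_def)
  have "(\<Sum>y\<in>?Y. weight a y * of_nat (card {W \<in> cont r y. (v, t) \<in> Vis Active T W})) =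
      (\<Sum>y\<in>?Y. ?q * (weight a y * of_nat (card (cont (v, t) y))) +
      (\<Sum>(u, e)\<in>skipping v t. of_nat (S u) * (weight a y * of_nat (card (cont (snd e) y)))))"
    by (rule sum.cong[OF refl card])
  also have "\<dots> = ?q * (\<Sum>y\<in>?Y. weight a y * of_nat (card (cont (v, t) y))) +
      (\<Sum>(u, e)\<in>skipping v t. of_nat (S u) * (\<Sum>y\<in>?Y. weight a y * of_nat (card (cont (snd e) y))))"
    unfolding sum.distrib sum_distrib_left case_prod_beta by (subst sum.swap) (rule refl)
  also have "\<dots> = ?q * (g (v, t) - weight a (v, t)) + (\<Sum>(u, e)\<in>skipping v t. of_nat (S u) * g (snd e))"
    unfolding pass using cross by (intro arg_cong2[where f = "(+)"] refl sum.cong) auto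
  finally show ?thesis .
qed

end

section \<open>Breadth-first search\<close>

text \<open>\<open>qs\<close> lists all discovered nodes, \<open>q\<close> is the position being
  processed and \<open>R\<close> the set of edges examined so far. Nothing is ever removed from the
  queue: its order by distance is what the backward pass follows in reverse.\<close>

definition bfs_inv :: "bool \<Rightarrow> nat \<Rightarrow> arc set \<Rightarrow> nat \<Rightarrow> ((nat \<times> nat) \<times> arc) set \<Rightarrow> nat \<Rightarrow>
    (nat \<times> nat \<Rightarrow> nat) \<Rightarrow> (nat \<times> nat \<Rightarrow> nat) \<Rightarrow> (nat \<times> nat) list \<Rightarrow> bool" where
  "bfs_inv strict K E r R q D S qs \<longleftrightarrow>
     finite R \<and> distinct qs \<and> set qs = {y. D y \<noteq> 0} \<and> D (r, 0) = 1 \<and> S (r, 0) = 1 \<and>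
     sorted (map D qs) \<and> (\<forall>y\<in>set qs. q < length qs \<longrightarrow> D y \<le> Suc (D (qs ! q))) \<and>
     (\<forall>(x, e)\<in>R. edge strict K E x e \<and> D x \<noteq> 0 \<and> D (snd e) \<noteq> 0 \<and> D (snd e) \<le> Suc (D x) \<and>
        (q < length qs \<longrightarrow> D x \<le> D (qs ! q))) \<and>
     (\<forall>y. D y \<noteq> 0 \<longrightarrow> y \<noteq> (r, 0) \<longrightarrow> (\<exists>x e. (x, e) \<in> R \<and> snd e = y \<and> D y = Suc (D x)) \<and>
        S y = (\<Sum>(x, e)\<in>{(x, e) \<in> R. snd e = y \<and> D y = Suc (D x)}. S x)) \<and>
     (\<forall>y. D y = 0 \<longrightarrow> S y = 0)"

lemma bfs_inv_init: "bfs_inv strict K E r {} 0 ((\<lambda>_. 0)((r, 0) := 1)) ((\<lambda>_. 0)((r, 0) := 1)) [(r, 0)]"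
  by (auto simp: bfs_inv_def)

lemma bfs_inv_next:
  assumes "bfs_inv strict K E r R q D S qs"
  shows "bfs_inv strict K E r R (Suc q) D S qs"
proof (cases "Suc q < length qs")
  case True
  then have "D (qs ! q) \<le> D (qs ! Suc q)"
    using assms by (auto simp: bfs_inv_def sorted_iff_nth_mono)
  then show ?thesis
    using assms True unfolding bfs_inv_def by (fastforce intro: order_trans)
qed (use assms in \<open>auto simp: bfs_inv_def\<close>)

lemma bfs_inv_bfs_tree:
  assumes inv: "bfs_inv strict K E r R q D S qs" and R: "R = {(x, e). edge strict K E x e \<and> x \<in> set qs}"
    and "finite E" "\<And>e. e \<in> E \<Longrightarrow> 1 \<le> tm e"
  shows "bfs_tree strict K E r D S"
proof
  have *: "(x, e) \<in> R \<longleftrightarrow> edge strict K E x e \<and> D x \<noteq> 0" for x e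
    using inv R by (auto simp: bfs_inv_def)
  have set: "{(x, e). D x \<noteq> 0 \<and> edge strict K E x e \<and> snd e = y \<and> D y = Suc (D x)} =
      {(x, e) \<in> R. snd e = y \<and> D y = Suc (D x)}" for y
    using * by auto
  fix x e y
  show "D x \<noteq> 0 \<Longrightarrow> edge strict K E x e \<Longrightarrow> D (snd e) \<noteq> 0 \<and> D (snd e) \<le> Suc (D x)"
    using inv *[of x e] by (auto simp: bfs_inv_def)
  show "\<exists>x e. D x \<noteq> 0 \<and> edge strict K E x e \<and> snd e = y \<and> D y = Suc (D x)"
    if "D y \<noteq> 0" "y \<noteq> (r, 0)"
  proof -
    have "\<exists>x e. (x, e) \<in> R \<and> snd e = y \<and> D y = Suc (D x)"
      using inv that by (simp add: bfs_inv_def)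
    then show ?thesis
      using * by blast
  qed
  show "D y \<noteq> 0 \<Longrightarrow> y \<noteq> (r, 0) \<Longrightarrow>
      S y = (\<Sum>(x, e) \<in> {(x, e). D x \<noteq> 0 \<and> edge strict K E x e \<and> snd e = y \<and> D y = Suc (D x)}. S x)"
    using inv unfolding set by (simp add: bfs_inv_def)
  show "D x = 0 \<Longrightarrow> S x = 0"
    using inv by (simp add: bfs_inv_def)
qed (use assms in \<open>auto simp: bfs_inv_def\<close>)

text \<open>The cases are a new node, a further tight edge, and an edge that is not tight. Changes
  at \<open>y\<close> leave the other sums over \<open>R\<close> valid because no edge out of
  \<open>y\<close> has been examined: examined tails have distance at most \<open>D x\<close>, and
  \<open>y\<close> is farther away or new.\<close>

lemma bfs_inv_relax:
  assumes inv: "bfs_inv strict K E r R q D S qs" and q: "q < length qs" "x = qs ! q"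
    and e: "edge strict K E x e" "(x, e) \<notin> R" "snd e = y" and r: "y \<noteq> (r, 0)"
  shows "D y = 0 \<Longrightarrow> bfs_inv strict K E r (insert (x, e) R) q (D(y := Suc (D x))) (S(y := S x)) (qs @ [y])"
    and "D y = Suc (D x) \<Longrightarrow> bfs_inv strict K E r (insert (x, e) R) q D (S(y := S y + S x)) qs"
    and "D y \<noteq> 0 \<Longrightarrow> D y \<noteq> Suc (D x) \<Longrightarrow> bfs_inv strict K E r (insert (x, e) R) q D S qs"
proof -
  have fin: "finite R" and dist: "distinct qs" and set: "set qs = {y. D y \<noteq> 0}" and root: "D (r, 0) = 1" "S (r, 0) = 1"
    and sorted: "sorted (map D qs)" and near: "\<And>y. D y \<noteq> 0 \<Longrightarrow> D y \<le> Suc (D x)"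
    and R: "\<And>u f. (u, f) \<in> R \<Longrightarrow> edge strict K E u f \<and> D u \<noteq> 0 \<and> D (snd f) \<noteq> 0 \<and> D (snd f) \<le> Suc (D u) \<and> D u \<le> D x"
    and parent: "\<And>y. D y \<noteq> 0 \<Longrightarrow> y \<noteq> (r, 0) \<Longrightarrow> \<exists>x e. (x, e) \<in> R \<and> snd e = y \<and> D y = Suc (D x)"
    and count: "\<And>y. D y \<noteq> 0 \<Longrightarrow> y \<noteq> (r, 0) \<Longrightarrow> S y = (\<Sum>(x, e)\<in>{(x, e) \<in> R. snd e = y \<and> D y = Suc (D x)}. S x)"
    and unr: "\<And>y. D y = 0 \<Longrightarrow> S y = 0"
    using inv q by (auto simp: bfs_inv_def)
  have x: "D x \<noteq> 0"
    using q set nth_mem by fastforce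
  let ?R = "insert (x, e) R"
  show "bfs_inv strict K E r ?R q (D(y := Suc (D x))) (S(y := S x)) (qs @ [y])" if y: "D y = 0"
  proof -
    let ?D = "D(y := Suc (D x))" and ?S = "S(y := S x)"
    have neq: "x \<noteq> y" "\<And>u f. (u, f) \<in> R \<Longrightarrow> u \<noteq> y \<and> snd f \<noteq> y"
      using x y R by (metis, metis)
    have notin: "y \<notin> set qs"
      using set y by simp
    have "map ?D qs = map D qs"
      using notin by (intro map_cong) auto
    then have sorted': "sorted (map ?D (qs @ [y]))"
      unfolding map_append sorted_append using sorted near set by (auto simp del: map_eq_conv)
    have old: "{(u, f) \<in> ?R. snd f = z \<and> ?D z = Suc (?D u)} = {(u, f) \<in> R. snd f = z \<and> D z = Suc (D u)}"
      if "z \<noteq> y" for z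
      using that neq e(3) by auto
    have new: "{(u, f) \<in> ?R. snd f = y \<and> ?D y = Suc (?D u)} = {(x, e)}"
      using neq e(3) by auto
    have cnt: "?S z = (\<Sum>(u, f)\<in>{(u, f) \<in> ?R. snd f = z \<and> ?D z = Suc (?D u)}. ?S u)" if "?D z \<noteq> 0" "z \<noteq> (r, 0)" for z
    proof (cases "z = y")
      case True
      then show ?thesis
        unfolding True new using neq by simp
    next
      case False
      have "(\<Sum>(u, f)\<in>{(u, f) \<in> R. snd f = z \<and> D z = Suc (D u)}. ?S u) =
          (\<Sum>(u, f)\<in>{(u, f) \<in> R. snd f = z \<and> D z = Suc (D u)}. S u)"
        using neq by (intro sum.cong) auto
      then show ?thesis
        using False count[of z] that unfolding old[OF False] by simp
    qed
    have par: "\<exists>u f. (u, f) \<in> ?R \<and> snd f = z \<and> ?D z = Suc (?D u)" if "?D z \<noteq> 0" "z \<noteq> (r, 0)" for z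
    proof (cases "z = y")
      case True
      then show ?thesis
        using neq e(3) by (intro exI[of _ x] exI[of _ e]) simp
    next
      case False
      then obtain u f where "(u, f) \<in> R" "snd f = z" "D z = Suc (D u)"
        using parent[of z] \<open>z \<noteq> (r, 0)\<close> \<open>?D z \<noteq> 0\<close> by auto
      then show ?thesis
        using neq(2) False by (intro exI[of _ u] exI[of _ f]) auto
    qed
    have Rin: "\<forall>(u, f)\<in>?R. edge strict K E u f \<and> ?D u \<noteq> 0 \<and> ?D (snd f) \<noteq> 0 \<and> ?D (snd f) \<le> Suc (?D u) \<and>
        (q < length (qs @ [y]) \<longrightarrow> ?D u \<le> ?D x)"
    proof
      fix p assume "p \<in> ?R"
      then consider "p = (x, e)" | u f where "p = (u, f)" "(u, f) \<in> R"
        by (cases p) auto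
      then show "case p of (u, f) \<Rightarrow> edge strict K E u f \<and> ?D u \<noteq> 0 \<and> ?D (snd f) \<noteq> 0 \<and>
          ?D (snd f) \<le> Suc (?D u) \<and> (q < length (qs @ [y]) \<longrightarrow> ?D u \<le> ?D x)"
      proof cases
        case 1
        then show ?thesis
          using neq e x by simp
      next
        case (2 u f)
        then show ?thesis
          using R[OF 2(2)] neq(1) neq(2)[OF 2(2)] by simp
      qed
    qed
    have at: "(qs @ [y]) ! q = x"
      using q by (simp add: nth_append)
    have set': "set (qs @ [y]) = {z. ?D z \<noteq> 0}"
      using set by auto
    have near': "\<forall>z\<in>set (qs @ [y]). q < length (qs @ [y]) \<longrightarrow> ?D z \<le> Suc (?D x)"
      using near neq(1) set by auto
    have unr': "?S z = 0" if "?D z = 0" for z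
      using that unr by (auto split: if_splits)
    show ?thesis
      unfolding bfs_inv_def at
    proof (intro conjI)
      show "?D (r, 0) = 1" "?S (r, 0) = 1" "finite ?R" "distinct (qs @ [y])"
        using root r fin dist notin by auto
      show "\<forall>z. ?D z \<noteq> 0 \<longrightarrow> z \<noteq> (r, 0) \<longrightarrow> (\<exists>u f. (u, f) \<in> ?R \<and> snd f = z \<and> ?D z = Suc (?D u)) \<and>
          ?S z = (\<Sum>(u, f)\<in>{(u, f) \<in> ?R. snd f = z \<and> ?D z = Suc (?D u)}. ?S u)"
        using cnt par by blast
      show "\<forall>z. ?D z = 0 \<longrightarrow> ?S z = 0"
        using unr' by blast
    qed (fact set' sorted' near' Rin)+
  qed
  show "bfs_inv strict K E r ?R q D (S(y := S y + S x)) qs" if y: "D y = Suc (D x)"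
  proof -
    let ?S = "S(y := S y + S x)"
    have neq: "x \<noteq> y" "\<And>u f. (u, f) \<in> R \<Longrightarrow> u \<noteq> y"
      using y R by (metis n_not_Suc_n, metis not_less_eq_eq order_refl)
    have cnt: "?S z = (\<Sum>(u, f)\<in>{(u, f) \<in> ?R. snd f = z \<and> D z = Suc (D u)}. ?S u)" if z: "D z \<noteq> 0" "z \<noteq> (r, 0)" for z
    proof -
      let ?Q = "{(u, f) \<in> R. snd f = z \<and> D z = Suc (D u)}"
      have eq: "(\<Sum>(u, f)\<in>?Q. ?S u) = S z"
        unfolding count[OF z] using neq by (intro sum.cong) auto
      have fQ: "finite ?Q"
        by (rule finite_subset[OF _ fin]) auto
      show ?thesis
      proof (cases "z = y")
        case True
        then have "{(u, f) \<in> ?R. snd f = z \<and> D z = Suc (D u)} = insert (x, e) ?Q"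
          using y e(3) by auto
        then show ?thesis
          using eq fQ e(2) neq(1) True by simp
      next
        case False
        then have "{(u, f) \<in> ?R. snd f = z \<and> D z = Suc (D u)} = ?Q"
          using e(3) by auto
        then show ?thesis
          using eq False by simp
      qed
    qed
    have par: "\<exists>u f. (u, f) \<in> ?R \<and> snd f = z \<and> D z = Suc (D u)" if "D z \<noteq> 0" "z \<noteq> (r, 0)" for z
      using parent[OF that] by blast
    have unr': "?S z = 0" if "D z = 0" for z
      using unr[OF that] y that by auto
    show ?thesis
      unfolding bfs_inv_def
      using sorted fin dist set root cnt par R near r y unr' q e x
      by (intro conjI allI impI) (auto simp del: fun_upd_apply simp: fun_upd_same fun_upd_other)
  qed
  show "bfs_inv strict K E r ?R q D S qs" if y: "D y \<noteq> 0" "D y \<noteq> Suc (D x)"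
  proof -
    have *: "{(u, f) \<in> ?R. snd f = z \<and> D z = Suc (D u)} = {(u, f) \<in> R. snd f = z \<and> D z = Suc (D u)}" for z
      using y e(3) by auto
    have par: "\<exists>u f. (u, f) \<in> ?R \<and> snd f = z \<and> D z = Suc (D u)" if "D z \<noteq> 0" "z \<noteq> (r, 0)" for z
      using parent[OF that] by blast
    show ?thesis
      unfolding bfs_inv_def *
      using sorted fin dist set root count par R near r y unr q e x
      by (intro conjI allI impI) auto
  qed
qed

section \<open>Breadth-first search as an array program\<close>

abbreviation V :: "nat \<Rightarrow> aexp" where "V x \<equiv> Rd x (Num 0) (Num 0) (Num 0)"
abbreviation Put :: "nat \<Rightarrow> aexp \<Rightarrow> acom" where "Put x e \<equiv> Wr x (Num 0) (Num 0) (Num 0) e"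

text \<open>The numbering lets each phase write one interval of arrays: 1 to 3 the graph, 4 to 8 the
  search, 9 and 10 the optimal ends, 11 to 13 the backward pass; 0 is the output. Frame conditions
  then reduce to comparing numbers.\<close>

abbreviation (input) "aDeg \<equiv> 1 :: nat"
abbreviation (input) "aHead \<equiv> 2 :: nat"
abbreviation (input) "aTime \<equiv> 3 :: nat"
abbreviation (input) "aDist \<equiv> 4 :: nat"
abbreviation (input) "aCount \<equiv> 5 :: nat"
abbreviation (input) "aQNode \<equiv> 6 :: nat"
abbreviation (input) "aQTime \<equiv> 7 :: nat"
abbreviation (input) "aQLen \<equiv> 8 :: nat"

abbreviation (input) "vWin \<equiv> 20 :: nat"
abbreviation (input) "vPass \<equiv> 21 :: nat"
abbreviation (input) "vRoot \<equiv> 22 :: nat"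
abbreviation (input) "vQ \<equiv> 23 :: nat"
abbreviation (input) "vU \<equiv> 24 :: nat"
abbreviation (input) "vT0 \<equiv> 25 :: nat"
abbreviation (input) "vJ \<equiv> 26 :: nat"
abbreviation (input) "vV \<equiv> 27 :: nat"
abbreviation (input) "vT \<equiv> 28 :: nat"

text \<open>Truth values are numbers: sums act as disjunctions, products as conjunctions, and
  subtraction from 1 as negation.\<close>

definition eok :: "bool \<Rightarrow> aexp" where
  "eok strict = Plus (Eq (V vT0) (Num 0))
     (Times (if strict then Lt (V vT0) (V vT) else Minus (Num 1) (Lt (V vT) (V vT0)))
        (Minus (Num 1) (Lt (Plus (V vT0) (V vWin)) (V vT))))"

lemma aval_eok:
  assumes "s (vT0, 0, 0, 0) = of_nat t0" "s (vT, 0, 0, 0) = of_nat t" "s (vWin, 0, 0, 0) = of_nat K"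
  shows "aval I (eok strict) s \<noteq> 0 \<longleftrightarrow> ok strict K t0 t"
  using assms by (auto simp: eok_def ok_def of_nat_add[symmetric] simp del: of_nat_add)

definition visit :: acom where
  "visit = Cond (Eq (Rd aDist (V vPass) (V vV) (V vT)) (Num 0))
     (Wr aDist (V vPass) (V vV) (V vT) (Plus (Rd aDist (V vPass) (V vU) (V vT0)) (Num 1));;
      Wr aCount (V vPass) (V vV) (V vT) (Rd aCount (V vPass) (V vU) (V vT0));;
      Wr aQNode (V vPass) (Rd aQLen (V vPass) (Num 0) (Num 0)) (Num 0) (V vV);;
      Wr aQTime (V vPass) (Rd aQLen (V vPass) (Num 0) (Num 0)) (Num 0) (V vT);;
      Wr aQLen (V vPass) (Num 0) (Num 0) (Plus (Rd aQLen (V vPass) (Num 0) (Num 0)) (Num 1)))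
     (Cond (Eq (Rd aDist (V vPass) (V vV) (V vT)) (Plus (Rd aDist (V vPass) (V vU) (V vT0)) (Num 1)))
        (Wr aCount (V vPass) (V vV) (V vT)
           (Plus (Rd aCount (V vPass) (V vV) (V vT)) (Rd aCount (V vPass) (V vU) (V vT0))))
        Nop)"

definition load_arc :: acom where
  "load_arc = (Put vV (Rd aHead (V vU) (V vJ) (Num 0));; Put vT (Rd aTime (V vU) (V vJ) (Num 0)))"

definition load_node :: "aexp \<Rightarrow> acom" where
  "load_node q = (Put vU (Rd aQNode (V vPass) q (Num 0));; Put vT0 (Rd aQTime (V vPass) q (Num 0)))"

abbreviation (input) for_arcs :: "bool \<Rightarrow> acom \<Rightarrow> acom" where
  "for_arcs strict c \<equiv> For vJ (Rd aDeg (V vU) (Num 0) (Num 0)) (load_arc;; Cond (eok strict) c Nop)"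

text \<open>The bound of a \<open>For\<close> is evaluated once, while the queue keeps growing. So
  the loop makes as many rounds as there can be reached temporal nodes, including the root, and
  idles behind the end of the queue.\<close>

definition bfs :: "bool \<Rightarrow> acom" where
  "bfs strict =
     (Wr aDist (V vPass) (V vRoot) (Num 0) (Num 1);;
      Wr aCount (V vPass) (V vRoot) (Num 0) (Num 1);;
      Wr aQNode (V vPass) (Num 0) (Num 0) (V vRoot);;
      Wr aQTime (V vPass) (Num 0) (Num 0) (Num 0);;
      Wr aQLen (V vPass) (Num 0) (Num 0) (Num 1);;
      For vQ (Plus (Times (In (Num 0)) (In (Num 1))) (Num 1))
        (Cond (Lt (V vQ) (Rd aQLen (V vPass) (Num 0) (Num 0)))
           (load_node (V vQ);; for_arcs strict visit)
           Nop))"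

definition adj :: "arc list \<Rightarrow> nat \<Rightarrow> arc list" where
  "adj es u = filter (\<lambda>e. src e = u) es"

definition adj_rep :: "arc list \<Rightarrow> store \<Rightarrow> bool" where
  "adj_rep es s \<longleftrightarrow> (\<forall>u. s (aDeg, u, 0, 0) = of_nat (length (adj es u)) \<and>
     (\<forall>j < length (adj es u). s (aHead, u, j, 0) = of_nat (dst (adj es u ! j)) \<and>
        s (aTime, u, j, 0) = of_nat (tm (adj es u ! j))))"

definition bfs_rep :: "nat \<Rightarrow> store \<Rightarrow> (nat \<times> nat \<Rightarrow> nat) \<Rightarrow> (nat \<times> nat \<Rightarrow> nat) \<Rightarrow> (nat \<times> nat) list \<Rightarrow> bool" where
  "bfs_rep p s D S qs \<longleftrightarrow> (\<forall>v t. s (aDist, p, v, t) = of_nat (D (v, t)) \<and> s (aCount, p, v, t) = of_nat (S (v, t))) \<and>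
     (\<forall>q < length qs. s (aQNode, p, q, 0) = of_nat (fst (qs ! q)) \<and> s (aQTime, p, q, 0) = of_nat (snd (qs ! q))) \<and>
     s (aQLen, p, 0, 0) = of_nat (length qs)"

text \<open>All arrays of pass \<open>p\<close> are indexed by \<open>p\<close>, so that no pass has to clear the arrays of another one.\<close>

definition bfs_frame :: "nat \<Rightarrow> store \<Rightarrow> store \<Rightarrow> bool" where
  "bfs_frame p s s' \<longleftrightarrow> (\<forall>c i j l. \<not> (aDist \<le> c \<and> c \<le> aQLen \<and> i = p) \<longrightarrow> \<not> (vQ \<le> c \<and> c \<le> vT) \<longrightarrow>
     s' (c, i, j, l) = s (c, i, j, l))"

lemma bfs_frame_refl: "bfs_frame p s s"
  by (simp add: bfs_frame_def)

lemma bfs_frame_trans: "bfs_frame p s s' \<Longrightarrow> bfs_frame p s' s'' \<Longrightarrow> bfs_frame p s s''"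
  by (simp add: bfs_frame_def)

lemma bfs_frame_adj: "bfs_frame p s s' \<Longrightarrow> adj_rep es s \<Longrightarrow> adj_rep es s'"
  by (simp add: bfs_frame_def adj_rep_def)

lemma wp_load_arc:
  assumes "adj_rep es s" "s (vU, 0, 0, 0) = of_nat u" "s (vJ, 0, 0, 0) = of_nat j" "j < length (adj es u)"
    and "Q (s((vV, 0, 0, 0) := of_nat (dst (adj es u ! j)), (vT, 0, 0, 0) := of_nat (tm (adj es u ! j)))) (\<tau> + 2)"
  shows "wp I load_arc Q s \<tau>"
  using assms by (simp add: load_arc_def adj_rep_def)

lemma wp_visit:
  assumes rep: "bfs_rep p s D S qs" and inv: "bfs_inv strict K E r R q D S qs" and q: "q < length qs" "x = qs ! q"
    and e: "edge strict K E x e" "(x, e) \<notin> R" "1 \<le> tm e"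
    and s: "s (vPass, 0, 0, 0) = of_nat p" "s (vU, 0, 0, 0) = of_nat (fst x)" "s (vT0, 0, 0, 0) = of_nat (snd x)"
      "s (vV, 0, 0, 0) = of_nat (dst e)" "s (vT, 0, 0, 0) = of_nat (tm e)"
    and Q: "\<And>s' \<tau>' D' S' qs'. \<lbrakk>bfs_rep p s' D' S' qs'; bfs_inv strict K E r (insert (x, e) R) q D' S' qs';
      qs' = qs \<or> (\<exists>y. qs' = qs @ [y]);
      \<And>c i j l. \<not> (aDist \<le> c \<and> c \<le> aQLen \<and> i = p) \<Longrightarrow> s' (c, i, j, l) = s (c, i, j, l); \<tau>' \<le> \<tau> + 6\<rbrakk> \<Longrightarrow> Q s' \<tau>'"
  shows "wp I visit Q s \<tau>"
proof -
  obtain u t0 v t where x: "x = (u, t0)" and y: "dst e = v" "tm e = t" and y': "snd e = (v, t)"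
    by (metis dst_def tm_def prod.collapse)
  have r: "(v, t) \<noteq> (r, 0)"
    using e(3) y by auto
  have D: "s (aDist, p, a, b) = of_nat (D (a, b))" "s (aCount, p, a, b) = of_nat (S (a, b))" for a b
    using rep by (simp_all add: bfs_rep_def)
  have L: "s (aQLen, p, 0, 0) = of_nat (length qs)"
    using rep by (simp add: bfs_rep_def)
  let ?y = "(v, t)"
  note inv' = bfs_inv_relax[OF inv q e(1,2) y' r]
  have eq: "rat_of_nat (D ?y) = rat_of_nat (D x) + 1 \<longleftrightarrow> D ?y = Suc (D x)"
    by (metis of_nat_Suc of_nat_eq_iff add.commute)
  consider "D ?y = 0" | "D ?y = Suc (D x)" | "D ?y \<noteq> 0" "D ?y \<noteq> Suc (D x)"
    by blast
  then show ?thesis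
  proof cases
    case 1
    show ?thesis
      unfolding visit_def
      apply (simp add: s D L y x 1)
      apply (rule Q[unfolded x, OF _ inv'(1)[unfolded x, OF 1[unfolded x]]])
      using rep by (auto simp: bfs_rep_def nth_append less_Suc_eq)
  next
    case 2
    show ?thesis
      unfolding visit_def
      apply (simp add: s D L y x eq[unfolded x] 2[unfolded x])
      apply (rule Q[unfolded x, OF _ inv'(2)[unfolded x, OF 2[unfolded x]]])
      using rep by (auto simp: bfs_rep_def)
  next
    case 3
    show ?thesis
      unfolding visit_def
      apply (simp add: s D L y x eq[unfolded x] 3[unfolded x])
      apply (rule Q[unfolded x, OF _ inv'(3)[unfolded x, OF 3[unfolded x]]])
      using rep by (auto simp: bfs_rep_def)
  qed
qed

definition done_edges :: "bool \<Rightarrow> nat \<Rightarrow> arc set \<Rightarrow> (nat \<times> nat) set \<Rightarrow> ((nat \<times> nat) \<times> arc) set" where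
  "done_edges strict K E X = {(x, e). edge strict K E x e \<and> x \<in> X}"

lemma edge_adj: "edge strict K (set es) x e \<longleftrightarrow> e \<in> set (adj es (fst x)) \<and> ok strict K (snd x) (tm e)"
  by (auto simp: edge_def adj_def)

lemma wp_bfs_inner:
  assumes rep: "bfs_rep p s D S qs" and inv: "bfs_inv strict K (set es) r (done_edges strict K (set es) (set (take q qs))) q D S qs"
    and q: "q < length qs" and adj: "adj_rep es s" and es: "distinct es" "\<forall>e\<in>set es. 1 \<le> tm e"
    and s: "s (vPass, 0, 0, 0) = of_nat p" "s (vWin, 0, 0, 0) = of_nat K"
      "s (vU, 0, 0, 0) = of_nat (fst (qs ! q))" "s (vT0, 0, 0, 0) = of_nat (snd (qs ! q))"
    and Q: "\<And>s' \<tau>' D' S' qs'. \<lbrakk>bfs_rep p s' D' S' qs';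
       bfs_inv strict K (set es) r (done_edges strict K (set es) (set (take (Suc q) qs'))) q D' S' qs';
       take (Suc q) qs' = take (Suc q) qs; bfs_frame p s s'; length qs \<le> length qs';
       \<tau>' \<le> \<tau> + 1 + 11 * length (adj es (fst (qs ! q)))\<rbrakk> \<Longrightarrow> Q s' \<tau>'"
  shows "wp I (for_arcs strict visit) Q s \<tau>"
proof -
  let ?x = "qs ! q"
  let ?as = "adj es (fst ?x)"
  let ?R = "\<lambda>j qs'. done_edges strict K (set es) (set (take q qs')) \<union> {(?x, e) | e. edge strict K (set es) ?x e \<and> e \<in> set (take j ?as)}"
  define J where "J = (\<lambda>j s' \<tau>'. \<exists>D S qs'. bfs_rep p s' D S qs' \<and> bfs_inv strict K (set es) r (?R j qs') q D S qs' \<and>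
      take (Suc q) qs' = take (Suc q) qs \<and> length qs \<le> length qs' \<and> bfs_frame p s s' \<and>
      s' (vU, 0, 0, 0) = of_nat (fst ?x) \<and> s' (vT0, 0, 0, 0) = of_nat (snd ?x) \<and> \<tau>' \<le> \<tau> + 1 + 11 * j)"
  show ?thesis
  proof (rule wp_For[where N = "length ?as" and J = J])
    show "idx (aval I (Rd aDeg (V vU) (Num 0) (Num 0)) s) = length ?as"
      using adj s by (simp add: adj_rep_def)
    show "J 0 s (Suc \<tau>)"
      unfolding J_def using rep inv s bfs_frame_refl by (intro exI[of _ D] exI[of _ S] exI[of _ qs]) simp
  next
    fix j s1 \<tau>1 assume j: "j < length ?as" and "J j s1 \<tau>1"
    then obtain D1 S1 qs1 where 1: "bfs_rep p s1 D1 S1 qs1" "bfs_inv strict K (set es) r (?R j qs1) q D1 S1 qs1"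
      "take (Suc q) qs1 = take (Suc q) qs" "length qs \<le> length qs1" "bfs_frame p s s1"
      "s1 (vU, 0, 0, 0) = of_nat (fst ?x)" "s1 (vT0, 0, 0, 0) = of_nat (snd ?x)" "\<tau>1 \<le> \<tau> + 1 + 11 * j"
      unfolding J_def by blast
    have q1: "q < length qs1" "qs1 ! q = ?x"
      using q 1(3,4) by (auto, metis lessI nth_take)
    let ?e = "?as ! j"
    let ?s = "s1((vJ, 0, 0, 0) := of_nat j, (vV, 0, 0, 0) := of_nat (dst ?e), (vT, 0, 0, 0) := of_nat (tm ?e))"
    have e: "?e \<in> set es" "1 \<le> tm ?e"
      using j es(2) nth_mem[OF j] by (auto simp: adj_def)
    have edge: "edge strict K (set es) ?x ?e \<longleftrightarrow> ok strict K (snd ?x) (tm ?e)"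
      using nth_mem[OF j] by (simp add: edge_adj)
    have dist: "distinct ?as"
      using es(1) by (simp add: adj_def)
    \<comment> \<open>An arc occurs once in its adjacency list and a node once in the queue, so no
      edge is counted twice.\<close>
    have new: "(?x, ?e) \<notin> ?R j qs1"
    proof -
      have "?e \<notin> set (take j ?as)"
        using dist j by (metis distinct_conv_nth in_set_conv_nth length_take less_irrefl min_less_iff_conj nth_take)
      moreover have "?x \<notin> set (take q qs1)"
      proof -
        have "distinct qs1"
          using 1(2) by (simp add: bfs_inv_def)
        then show ?thesis
          using q1 by (metis distinct_conv_nth in_set_conv_nth length_take less_irrefl min_less_iff_conj nth_take)
      qed
      ultimately show ?thesis
        by (auto simp: done_edges_def)
    qed
    have step: "?R (Suc j) qs' = (if edge strict K (set es) ?x ?e then insert (?x, ?e) (?R j qs') else ?R j qs')" for qs'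
      using j by (auto simp: take_Suc_conv_app_nth)
    have fr: "bfs_frame p s s2" if "\<And>c i j l. \<not> (aDist \<le> c \<and> c \<le> aQLen \<and> i = p) \<Longrightarrow> s2 (c, i, j, l) = ?s (c, i, j, l)" for s2
      using that 1(5) by (auto simp: bfs_frame_def)
    have rep2: "bfs_rep p ?s D1 S1 qs1"
      using 1(1) by (simp add: bfs_rep_def)
    have s2: "?s (vPass, 0, 0, 0) = of_nat p" "?s (vWin, 0, 0, 0) = of_nat K" "?s (vU, 0, 0, 0) = of_nat (fst ?x)"
      "?s (vT0, 0, 0, 0) = of_nat (snd ?x)" "?s (vV, 0, 0, 0) = of_nat (dst ?e)" "?s (vT, 0, 0, 0) = of_nat (tm ?e)"
      using 1(5,6,7) s by (simp_all add: bfs_frame_def)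
    have "wp I (Cond (eok strict) visit Nop) (J (Suc j)) ?s (Suc \<tau>1 + 2)"
    proof (cases "edge strict K (set es) ?x ?e")
      case True
      then have "aval I (eok strict) ?s \<noteq> 0"
        using aval_eok[OF s2(4,6,2)] edge by blast
      moreover have "wp I visit (J (Suc j)) ?s (Suc (Suc \<tau>1 + 2))"
      proof (rule wp_visit[OF rep2 1(2) q1(1) q1(2)[symmetric] True new e(2) s2(1,3-6)])
        fix s' \<tau>' D' S' qs'
        assume 2: "bfs_rep p s' D' S' qs'" "bfs_inv strict K (set es) r (insert (?x, ?e) (?R j qs1)) q D' S' qs'"
          "qs' = qs1 \<or> (\<exists>y. qs' = qs1 @ [y])"
          "\<And>c i j l. \<not> (aDist \<le> c \<and> c \<le> aQLen \<and> i = p) \<Longrightarrow> s' (c, i, j, l) = ?s (c, i, j, l)"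
          "\<tau>' \<le> Suc (Suc \<tau>1 + 2) + 6"
        have t: "take (Suc q) qs' = take (Suc q) qs1" "take q qs' = take q qs1" "length qs1 \<le> length qs'"
          using 2(3) q1(1) by auto
        show "J (Suc j) s' \<tau>'"
          unfolding J_def step
          using 2(1,2,5) t 1(3,4,8) True fr[OF 2(4)] 2(4) s2
          by (intro exI[of _ D'] exI[of _ S'] exI[of _ qs'] conjI) simp_all
      qed
      ultimately show ?thesis
        by simp
    next
      case False
      then have "aval I (eok strict) ?s = 0"
        using aval_eok[OF s2(4,6,2)] edge by blast
      moreover have "J (Suc j) ?s (Suc (Suc (Suc \<tau>1 + 2)))"
        unfolding J_def step using rep2 1 False fr[of ?s] s2
        by (intro exI[of _ D1] exI[of _ S1] exI[of _ qs1] conjI) simp_all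
      ultimately show ?thesis
        by simp
    qed
    moreover have "adj_rep es (s1((vJ, 0, 0, 0) := of_nat j))"
      using bfs_frame_adj[OF 1(5) adj] by (simp add: adj_rep_def)
    ultimately have "wp I load_arc (wp I (Cond (eok strict) visit Nop) (J (Suc j))) (s1((vJ, 0, 0, 0) := of_nat j)) (Suc \<tau>1)"
      using j 1(6) by (intro wp_load_arc) simp_all
    then show "wp I (load_arc;; Cond (eok strict) visit Nop) (J (Suc j)) (s1((vJ, 0, 0, 0) := of_nat j)) (Suc \<tau>1)"
      by simp
  next
    fix s1 \<tau>1 assume "J (length ?as) s1 \<tau>1"
    then obtain D1 S1 qs1 where 1: "bfs_rep p s1 D1 S1 qs1" "bfs_inv strict K (set es) r (?R (length ?as) qs1) q D1 S1 qs1"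
      "take (Suc q) qs1 = take (Suc q) qs" "length qs \<le> length qs1" "bfs_frame p s s1" "\<tau>1 \<le> \<tau> + 1 + 11 * length ?as"
      unfolding J_def by blast
    have q1: "q < length qs1" "qs1 ! q = ?x"
      using q 1(3,4) by (auto, metis lessI nth_take)
    have "?R (length ?as) qs1 = done_edges strict K (set es) (set (take (Suc q) qs1))"
      using q1 by (auto simp: done_edges_def take_Suc_conv_app_nth edge_adj)
    then show "Q s1 \<tau>1"
      using Q 1 by simp
  qed
qed

text \<open>Every arc is listed at one node \<open>u\<close> and can be tried from each of the
  \<open>T + 1\<close> times of \<open>u\<close>. This bounds the edges of the graph of temporal
  nodes.\<close>

lemma sum_adj:
  assumes "X \<subseteq> {..<n} \<times> {..T}"
  shows "(\<Sum>x\<in>X. length (adj es (fst x))) \<le> length es * Suc T"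
proof -
  have "(\<Sum>u<n. length (adj es u)) \<le> length es"
  proof (induction es)
    case (Cons e es)
    have "length (adj (e # es) u) = of_bool (u = src e) + length (adj es u)" for u
      by (auto simp: adj_def)
    then have "(\<Sum>u<n. length (adj (e # es) u)) = (\<Sum>u<n. of_bool (u = src e)) + (\<Sum>u<n. length (adj es u))"
      by (simp add: sum.distrib)
    moreover have "(\<Sum>u<n. of_bool (u = src e)) \<le> (1 :: nat)"
      by (simp add: of_bool_def sum.delta)
    ultimately show ?case
      using Cons by simp
  qed (simp add: adj_def)
  moreover have "(\<Sum>x\<in>X. length (adj es (fst x))) \<le> (\<Sum>x\<in>{..<n} \<times> {..T}. length (adj es (fst x)))"
    using assms by (intro sum_mono2) auto
  moreover have "(\<Sum>x\<in>{..<n} \<times> {..T}. length (adj es (fst x))) = (\<Sum>u<n. length (adj es u)) * Suc T"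
    by (simp add: sum.cartesian_product[symmetric, of "\<lambda>u _. length (adj es u)", unfolded case_prod_beta]
      sum.distrib sum_distrib_left sum_distrib_right mult.commute)
  ultimately show ?thesis
    by (metis (no_types, lifting) le_trans mult_le_mono1)
qed

lemma wp_bfs:
  assumes wf: "wf_tgraph n T es" "r < n" and I: "I 0 = of_nat n" "I 1 = of_nat T" and adj: "adj_rep es s"
    and s: "s (vPass, 0, 0, 0) = of_nat p" "s (vRoot, 0, 0, 0) = of_nat r" "s (vWin, 0, 0, 0) = of_nat K"
    and fresh: "\<And>v t. s (aDist, p, v, t) = 0" "\<And>v t. s (aCount, p, v, t) = 0"
    and Q: "\<And>s' \<tau>' D S qs. \<lbrakk>bfs_tree strict K (set es) r D S; bfs_rep p s' D S qs; distinct qs; set qs = {y. D y \<noteq> 0};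
      sorted (map D qs); length qs \<le> Suc (n * T); (\<Sum>x\<in>set qs. length (adj es (fst x))) \<le> length es * Suc T;
      bfs_frame p s s'; \<tau>' \<le> \<tau> + 20 + 20 * (n * T) + 11 * (length es * Suc T)\<rbrakk> \<Longrightarrow> Q s' \<tau>'"
  shows "wp I (bfs strict) Q s \<tau>"
proof -
  have es: "distinct es" "\<forall>e\<in>set es. 1 \<le> tm e"
    using wf by (auto simp: wf_tgraph_def)
  let ?E = "set es"
  let ?body = "Cond (Lt (V vQ) (Rd aQLen (V vPass) (Num 0) (Num 0)))
           (load_node (V vQ);; for_arcs strict visit)
           Nop"
  let ?work = "\<lambda>q qs. \<Sum>x\<in>set (take q qs). length (adj es (fst x))"
  \<comment> \<open>Time is charged to the degrees of the nodes processed so far, so that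
    \<open>sum_adj\<close> bounds the total; a maximal degree per round would be too coarse.\<close>
  define J where "J = (\<lambda>q s' \<tau>'. \<exists>D S qs. bfs_rep p s' D S qs \<and>
      bfs_inv strict K ?E r (done_edges strict K ?E (set (take q qs))) q D S qs \<and>
      bfs_frame p s s' \<and> \<tau>' \<le> \<tau> + 6 + 5 * q + 11 * ?work q qs)"
  have tree: "bfs_tree strict K ?E r D S"
    if "bfs_inv strict K ?E r (done_edges strict K ?E (set (take q qs))) q D S qs" "length qs \<le> q" for q D S qs
    using that(2) es(2) by (intro bfs_inv_bfs_tree[OF that(1)]) (auto simp: done_edges_def)
  have main: "wp I (For vQ (Plus (Times (In (Num 0)) (In (Num 1))) (Num 1)) ?body) Q s1 (\<tau> + 5)"
    if start: "J 0 s1 (\<tau> + 6)" for s1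
  proof (rule wp_For[where N = "Suc (n * T)" and J = J])
    have "aval I (Plus (Times (In (Num 0)) (In (Num 1))) (Num 1)) s1 = of_nat (Suc (n * T))"
      using I by simp
    then show "idx (aval I (Plus (Times (In (Num 0)) (In (Num 1))) (Num 1)) s1) = Suc (n * T)"
      by (simp only: idx_of_nat)
    show "J 0 s1 (Suc (\<tau> + 5))"
      using start by (simp add: add.commute)
  next
    fix q s1 \<tau>1 assume "J q s1 \<tau>1"
    then obtain D S qs where 1: "bfs_rep p s1 D S qs"
      "bfs_inv strict K ?E r (done_edges strict K ?E (set (take q qs))) q D S qs"
      "bfs_frame p s s1" "\<tau>1 \<le> \<tau> + 6 + 5 * q + 11 * ?work q qs"
      unfolding J_def by blast
    let ?s = "s1((vQ, 0, 0, 0) := of_nat q)"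
    have len: "?s (aQLen, p, 0, 0) = of_nat (length qs)" and p: "?s (vPass, 0, 0, 0) = of_nat p"
      using 1(1,3) s(1) by (simp_all add: bfs_rep_def bfs_frame_def)
    have frame: "bfs_frame p s ?s"
      using 1(3) by (simp add: bfs_frame_def)
    have rep: "bfs_rep p ?s D S qs"
      using 1(1) by (simp add: bfs_rep_def)
    show "wp I ?body (J (Suc q)) ?s (Suc \<tau>1)"
    proof (cases "q < length qs")
      case False
      have "J (Suc q) ?s (Suc (Suc (Suc \<tau>1)))"
        unfolding J_def using False bfs_inv_next[OF 1(2)] rep frame 1(4)
        by (intro exI[of _ D] exI[of _ S] exI[of _ qs] conjI) simp_all
      then show ?thesis
        using len p False by simp
    next
      case True
      let ?x = "qs ! q"
      let ?t = "?s((vU, 0, 0, 0) := of_nat (fst ?x), (vT0, 0, 0, 0) := of_nat (snd ?x))"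
      have Q: "?s (aQNode, p, q, 0) = of_nat (fst ?x)" "?s (aQTime, p, q, 0) = of_nat (snd ?x)"
        using 1(1) True by (simp_all add: bfs_rep_def)
      have "wp I (for_arcs strict visit) (J (Suc q)) ?t (Suc (Suc \<tau>1) + 2)"
      proof (rule wp_bfs_inner[where p = p and D = D and S = S and qs = qs and q = q and r = r and K = K and es = es])
        show "bfs_rep p ?t D S qs"
          using rep by (simp add: bfs_rep_def)
        show "adj_rep es ?t"
          using adj 1(3) by (simp add: adj_rep_def bfs_frame_def)
        show "?t (vPass, 0, 0, 0) = of_nat p" "?t (vWin, 0, 0, 0) = of_nat K"
          using s 1(3) by (simp_all add: bfs_frame_def)
      next
        fix s' \<tau>' D' S' qs'
        assume 2: "bfs_rep p s' D' S' qs'"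
          "bfs_inv strict K ?E r (done_edges strict K ?E (set (take (Suc q) qs'))) q D' S' qs'"
          "take (Suc q) qs' = take (Suc q) qs" "bfs_frame p ?t s'" "length qs \<le> length qs'"
          "\<tau>' \<le> Suc (Suc \<tau>1) + 2 + 1 + 11 * length (adj es (fst ?x))"
        have dist: "distinct qs"
          using 1(2) by (simp add: bfs_inv_def)
        have "?x \<notin> set (take q qs)"
          using dist True by (metis distinct_conv_nth in_set_conv_nth length_take less_irrefl min_less_iff_conj nth_take)
        then have "?work (Suc q) qs = ?work q qs + length (adj es (fst ?x))"
          using True by (simp add: take_Suc_conv_app_nth)
        then have "\<tau>' \<le> \<tau> + 6 + 5 * Suc q + 11 * ?work (Suc q) qs'"
          using 2(6) 1(4) unfolding 2(3) by simp
        moreover have "bfs_frame p ?s ?t"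
          by (auto simp: bfs_frame_def)
        ultimately show "J (Suc q) s' \<tau>'"
          unfolding J_def using 2(1) bfs_inv_next[OF 2(2)] bfs_frame_trans[OF frame bfs_frame_trans[OF _ 2(4)]]
          by blast
      qed (use 1 True es in \<open>simp_all\<close>)
      then show ?thesis
        using len p True Q by (simp add: load_node_def)
    qed
  next
    fix s1 \<tau>1 assume "J (Suc (n * T)) s1 \<tau>1"
    then obtain D S qs where 1: "bfs_rep p s1 D S qs"
      "bfs_inv strict K ?E r (done_edges strict K ?E (set (take (Suc (n * T)) qs))) (Suc (n * T)) D S qs"
      "bfs_frame p s s1" "\<tau>1 \<le> \<tau> + 6 + 5 * (Suc (n * T)) + 11 * ?work (Suc (n * T)) qs"
      unfolding J_def by blast
    have qs: "distinct qs" "set qs = {y. D y \<noteq> 0}" "sorted (map D qs)"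
      using 1(2) by (auto simp: bfs_inv_def)
    \<comment> \<open>Apart from the root only heads of arcs are discovered. The queue thus holds at
      most \<open>Suc (n * T)\<close> nodes, and the loop has processed them all.\<close>
    have sub: "set qs \<subseteq> insert (r, 0) ({..<n} \<times> {1..T})"
    proof
      fix y assume "y \<in> set qs"
      then have "y = (r, 0) \<or> (\<exists>x e. (x, e) \<in> done_edges strict K ?E (set (take (Suc (n * T)) qs)) \<and> snd e = y)"
      proof -
        let ?R = "done_edges strict K ?E (set (take (Suc (n * T)) qs))"
        have "\<forall>y. D y \<noteq> 0 \<longrightarrow> y \<noteq> (r, 0) \<longrightarrow> (\<exists>x e. (x, e) \<in> ?R \<and> snd e = y \<and> D y = Suc (D x))"
          using 1(2) unfolding bfs_inv_def by blast
        then show ?thesis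
          using \<open>y \<in> set qs\<close> qs(2) by blast
      qed
      then have "y = (r, 0) \<or> (\<exists>e \<in> set es. snd e = y)"
        by (auto simp: done_edges_def edge_def)
      then show "y \<in> insert (r, 0) ({..<n} \<times> {1..T})"
        using wf by (auto simp: wf_tgraph_def dst_def tm_def)
    qed
    have "length qs = card (set qs)"
      using qs(1) by (simp add: distinct_card)
    also have "\<dots> \<le> card (insert (r, 0::nat) ({..<n} \<times> {1..T}))"
      by (rule card_mono[OF _ sub]) simp
    also have "\<dots> \<le> Suc (n * T)"
      by (simp add: card_insert_if)
    finally have len: "length qs \<le> Suc (n * T)" .
    have "?work (Suc (n * T)) qs \<le> length es * Suc T"
      using sub wf(2) len by (intro sum_adj) auto
    then have "\<tau>1 \<le> \<tau> + 20 + 20 * (n * T) + 11 * (length es * Suc T)"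
    proof -
      have "b \<le> \<tau> + 20 + 20 * a + 11 * x" if "w \<le> x" "b \<le> \<tau> + 6 + 5 * Suc a + 11 * w" for w x a b :: nat
        using mult_le_mono2[OF that(1), of 11] that(2) by simp
      from this[OF \<open>?work (Suc (n * T)) qs \<le> length es * Suc T\<close> 1(4)] show ?thesis .
    qed
    moreover have "(\<Sum>x\<in>set qs. length (adj es (fst x))) \<le> length es * Suc T"
      using sub wf(2) by (intro sum_adj) auto
    ultimately show "Q s1 \<tau>1"
      using Q tree[OF 1(2) len] 1(1,3) qs len by blast
  qed
  let ?s1 = "s((aDist, p, r, 0) := 1, (aCount, p, r, 0) := 1, (aQNode, p, 0, 0) := of_nat r,
     (aQTime, p, 0, 0) := 0, (aQLen, p, 0, 0) := 1)"
  have "J 0 ?s1 (\<tau> + 6)"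
    unfolding J_def using bfs_inv_init[of strict K ?E r] fresh
    by (intro exI[of _ "(\<lambda>_. 0)((r, 0) := 1)"] exI[of _ "[(r, 0)]"])
      (auto simp: done_edges_def bfs_rep_def bfs_frame_def)
  from main[OF this] show ?thesis
    unfolding bfs_def using s by (simp add: eval_nat_numeral)
qed

section \<open>The program\<close>

abbreviation (input) "aMin \<equiv> 9 :: nat"
abbreviation (input) "aTotal \<equiv> 10 :: nat"
abbreviation (input) "aWeight \<equiv> 11 :: nat"
abbreviation (input) "aG \<equiv> 12 :: nat"
abbreviation (input) "aDiff \<equiv> 13 :: nat"
abbreviation (input) "vS \<equiv> 17 :: nat"
abbreviation (input) "vA \<equiv> 19 :: nat"
abbreviation (input) "vZ \<equiv> 29 :: nat"
abbreviation (input) "vI \<equiv> 30 :: nat"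
abbreviation (input) "vKey \<equiv> 31 :: nat"
abbreviation (input) "vAcc \<equiv> 32 :: nat"
abbreviation (input) "vN \<equiv> 33 :: nat"

text \<open>Variables from 23 on are scratch.\<close>

definition frame :: "nat \<Rightarrow> nat \<Rightarrow> nat \<Rightarrow> store \<Rightarrow> store \<Rightarrow> bool" where
  "frame lo hi p s s' \<longleftrightarrow> (\<forall>c i j l. c < 23 \<longrightarrow> \<not> (lo \<le> c \<and> c \<le> hi \<and> i = p) \<longrightarrow> s' (c, i, j, l) = s (c, i, j, l))"

lemma frame_refl: "frame lo hi p s s"
  by (simp add: frame_def)

lemma frame_trans: "frame lo hi p s s' \<Longrightarrow> frame lo hi p s' s'' \<Longrightarrow> frame lo hi p s s''"
  by (simp add: frame_def)

lemma frame_mono: "frame lo hi p s s' \<Longrightarrow> lo' \<le> lo \<Longrightarrow> hi \<le> hi' \<Longrightarrow> frame lo' hi' p s s'"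
  unfolding frame_def by (meson le_trans)

lemma frame_bfs: "bfs_frame p s s' \<Longrightarrow> frame 4 8 p s s'"
  by (simp add: frame_def bfs_frame_def)

lemma frame_adj: "frame lo hi p s s' \<Longrightarrow> 4 \<le> lo \<Longrightarrow> adj_rep es s \<Longrightarrow> adj_rep es s'"
  by (simp add: frame_def adj_rep_def)

lemma frame_bfs_rep: "frame lo hi p s s' \<Longrightarrow> 9 \<le> lo \<Longrightarrow> bfs_rep p s D S qs \<Longrightarrow> bfs_rep p s' D S qs"
  by (simp add: frame_def bfs_rep_def)

section \<open>Scanning for the optimal arrival times\<close>

text \<open>State of a scan over the times 1 to \<open>i\<close>: least key \<open>M\<close> and
  number \<open>N\<close> of shortest paths that attain it. Keys of reached nodes are positive, so
  \<open>M = 0\<close> can mean that none was met, which fits the zeroed memory.\<close>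

definition best :: "nat \<Rightarrow> (nat \<times> nat \<Rightarrow> nat) \<Rightarrow> (nat \<times> nat \<Rightarrow> nat) \<Rightarrow> nat \<Rightarrow> nat \<Rightarrow> nat \<Rightarrow> nat \<Rightarrow> bool" where
  "best a D S z i M N \<longleftrightarrow> (\<forall>t\<in>{1..i}. D (z, t) \<noteq> 0 \<longrightarrow> M \<le> a * t + D (z, t)) \<and>
     (if \<exists>t\<in>{1..i}. D (z, t) \<noteq> 0 then \<exists>t\<in>{1..i}. D (z, t) \<noteq> 0 \<and> M = a * t + D (z, t) else M = 0) \<and>
     N = (\<Sum>t | t \<in> {1..i} \<and> D (z, t) \<noteq> 0 \<and> a * t + D (z, t) = M. S (z, t))"

lemma best_0: "best a D S z 0 0 0"
  by (simp add: best_def)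

lemma best_zero: "best a D S z i M N \<Longrightarrow> M = 0 \<longleftrightarrow> (\<forall>t\<in>{1..i}. D (z, t) = 0)"
  by (auto simp: best_def split: if_splits)

lemma best_skip:
  assumes "best a D S z i M N" "D (z, Suc i) = 0"
  shows "best a D S z (Suc i) M N"
proof -
  have "t \<in> {1..Suc i} \<and> D (z, t) \<noteq> 0 \<longleftrightarrow> t \<in> {1..i} \<and> D (z, t) \<noteq> 0" for t
    using assms(2) by (auto simp: le_Suc_eq)
  then show ?thesis
    using assms(1) unfolding best_def Ball_def Bex_def imp_conjL[symmetric] conj_assoc[symmetric] by presburger
qed

lemma best_new:
  assumes "best a D S z i M N" "D (z, Suc i) \<noteq> 0" "M = 0 \<or> a * Suc i + D (z, Suc i) < M"
  shows "best a D S z (Suc i) (a * Suc i + D (z, Suc i)) (S (z, Suc i))"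
proof -
  let ?k = "a * Suc i + D (z, Suc i)"
  have less: "?k < a * t + D (z, t)" if "t \<in> {1..i}" "D (z, t) \<noteq> 0" for t
  proof -
    have "M \<le> a * t + D (z, t)" "M \<noteq> 0"
      using assms(1) that best_zero[OF assms(1)] by (auto simp: best_def)
    then show ?thesis
      using assms(3) by linarith
  qed
  then have "{t. t \<in> {1..Suc i} \<and> D (z, t) \<noteq> 0 \<and> a * t + D (z, t) = ?k} = {Suc i}"
    using assms(2) by (fastforce simp: le_Suc_eq)
  moreover have "\<forall>t\<in>{1..Suc i}. D (z, t) \<noteq> 0 \<longrightarrow> ?k \<le> a * t + D (z, t)"
    using less by (fastforce simp: le_Suc_eq)
  moreover have "\<exists>t\<in>{1..Suc i}. D (z, t) \<noteq> 0 \<and> ?k = a * t + D (z, t)"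
    using assms(2) by (intro bexI[of _ "Suc i"]) auto
  ultimately show ?thesis
    unfolding best_def by (auto simp del: mult_Suc_right)
qed

lemma best_old:
  assumes "best a D S z i M N" "D (z, Suc i) \<noteq> 0" "\<not> (M = 0 \<or> a * Suc i + D (z, Suc i) < M)"
  shows "best a D S z (Suc i) M (if a * Suc i + D (z, Suc i) = M then N + S (z, Suc i) else N)"
proof -
  let ?k = "a * Suc i + D (z, Suc i)"
  let ?X = "\<lambda>i. {t. t \<in> {1..i} \<and> D (z, t) \<noteq> 0 \<and> a * t + D (z, t) = M}"
  have "?X (Suc i) = (if ?k = M then insert (Suc i) (?X i) else ?X i)"
    using assms(2) by (auto simp: le_Suc_eq)
  then have "(\<Sum>t\<in>?X (Suc i). S (z, t)) = (if ?k = M then N + S (z, Suc i) else N)"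
    using assms(1) by (auto simp: best_def)
  moreover have "\<forall>t\<in>{1..Suc i}. D (z, t) \<noteq> 0 \<longrightarrow> M \<le> a * t + D (z, t)"
    using assms by (auto simp: le_Suc_eq best_def)
  moreover have "\<exists>t\<in>{1..i}. D (z, t) \<noteq> 0 \<and> M = a * t + D (z, t)"
    using assms(1,3) best_zero[OF assms(1)] unfolding best_def by (auto split: if_splits)
  then have "\<exists>t\<in>{1..Suc i}. D (z, t) \<noteq> 0 \<and> M = a * t + D (z, t)"
    by force
  ultimately show ?thesis
    unfolding best_def by auto
qed

definition update_best :: acom where
  "update_best =
     Cond (Eq (Rd aDist (V vPass) (V vZ) (V vT)) (Num 0)) Nop
       (Put vKey (Plus (Times (V vA) (V vT)) (Rd aDist (V vPass) (V vZ) (V vT)));;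
        Cond (Plus (Eq (Rd aMin (V vPass) (V vZ) (Num 0)) (Num 0)) (Lt (V vKey) (Rd aMin (V vPass) (V vZ) (Num 0))))
          (Wr aMin (V vPass) (V vZ) (Num 0) (V vKey);;
           Wr aTotal (V vPass) (V vZ) (Num 0) (Rd aCount (V vPass) (V vZ) (V vT)))
          (Cond (Eq (V vKey) (Rd aMin (V vPass) (V vZ) (Num 0)))
             (Wr aTotal (V vPass) (V vZ) (Num 0)
               (Plus (Rd aTotal (V vPass) (V vZ) (Num 0)) (Rd aCount (V vPass) (V vZ) (V vT))))
             Nop))"

definition select :: acom where
  "select = For vZ (In (Num 0)) (For vI (In (Num 1)) (Put vT (Plus (V vI) (Num 1));; update_best))"

definition best_rep :: "nat \<Rightarrow> nat \<Rightarrow> (nat \<times> nat \<Rightarrow> nat) \<Rightarrow> (nat \<times> nat \<Rightarrow> nat) \<Rightarrow> store \<Rightarrow> nat \<Rightarrow> nat \<Rightarrow> bool" where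
  "best_rep a p D S s i z \<longleftrightarrow> (\<exists>M N. best a D S z i M N \<and> s (aMin, p, z, 0) = of_nat M \<and> s (aTotal, p, z, 0) = of_nat N)"

lemma best_rep_cong:
  "best_rep a p D S s i z \<Longrightarrow> s' (aMin, p, z, 0) = s (aMin, p, z, 0) \<Longrightarrow> s' (aTotal, p, z, 0) = s (aTotal, p, z, 0) \<Longrightarrow>
     best_rep a p D S s' i z"
  by (simp add: best_rep_def)

lemma wp_select:
  assumes I: "I 0 = of_nat n" "I 1 = of_nat T" and s: "s (vPass, 0, 0, 0) = of_nat p" "s (vA, 0, 0, 0) = of_nat a"
    and rep: "bfs_rep p s D S qs"
    and fresh: "\<And>z. s (aMin, p, z, 0) = 0" "\<And>z. s (aTotal, p, z, 0) = 0"
    and Q: "\<And>s' \<tau>'. \<lbrakk>frame 9 10 p s s'; \<And>z. z < n \<Longrightarrow> best_rep a p D S s' T z; \<tau>' \<le> \<tau> + 1 + n * (2 + 8 * T)\<rbrakk> \<Longrightarrow> Q s' \<tau>'"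
  shows "wp I select Q s \<tau>"
proof -
  define J where "J = (\<lambda>z s' \<tau>'. frame 9 10 p s s' \<and> (\<forall>z'<n. best_rep a p D S s' (if z' < z then T else 0) z') \<and>
      \<tau>' \<le> \<tau> + 1 + z * (2 + 8 * T))"
  define H where "H = (\<lambda>z \<tau>0 i s' \<tau>'. frame 9 10 p s s' \<and>
      (\<forall>z'<n. best_rep a p D S s' (if z' < z then T else if z' = z then i else 0) z') \<and>
      s' (vZ, 0, 0, 0) = of_nat z \<and> \<tau>' \<le> \<tau>0 + 1 + 8 * i)"
  show ?thesis
    unfolding select_def
  proof (rule wp_For[where N = n and J = J])
    show "J 0 s (Suc \<tau>)"
      using fresh best_0 frame_refl by (auto simp: J_def best_rep_def)
  next
    fix z s1 \<tau>1 assume z: "z < n" and J: "J z s1 \<tau>1"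
    let ?s = "s1((vZ, 0, 0, 0) := of_nat z)"
    show "wp I (For vI (In (Num 1)) (Put vT (Plus (V vI) (Num 1));; update_best)) (J (Suc z)) ?s (Suc \<tau>1)" (is "wp I (For vI _ ?body) _ _ _")
    proof (rule wp_For[where N = T and J = "H z (Suc \<tau>1)"])
      have "best_rep a p D S ?s (if z' < z then T else if z' = z then 0 else 0) z'" if "z' < n" for z'
      proof (rule best_rep_cong[where s = s1])
        show "best_rep a p D S s1 (if z' < z then T else if z' = z then 0 else 0) z'"
          using J that by (cases "z' < z") (auto simp: J_def)
      qed simp_all
      then show "H z (Suc \<tau>1) 0 ?s (Suc (Suc \<tau>1))"
        using J by (simp add: H_def J_def frame_def)
    next
      fix i s2 \<tau>2 assume i: "i < T" and H: "H z (Suc \<tau>1) i s2 \<tau>2"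
      have fr: "frame 9 10 p s s2" and z2: "s2 (vZ, 0, 0, 0) = of_nat z"
        using H by (auto simp: H_def)
      have "best_rep a p D S s2 i z"
        using H z unfolding H_def by (metis less_irrefl)
      then obtain M N where MN: "best a D S z i M N" "s2 (aMin, p, z, 0) = of_nat M" "s2 (aTotal, p, z, 0) = of_nat N"
        unfolding best_rep_def by blast
      have p2: "s2 (vPass, 0, 0, 0) = of_nat p" "s2 (vA, 0, 0, 0) = of_nat a"
        using fr s by (simp_all add: frame_def)
      have D: "s2 (aDist, p, v, t) = of_nat (D (v, t))" "s2 (aCount, p, v, t) = of_nat (S (v, t))" for v t
        using frame_bfs_rep[OF fr _ rep] by (simp_all add: bfs_rep_def)
      have t: "rat_of_nat i + 1 = of_nat (Suc i)"
        by simp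
      have H': "H z (Suc \<tau>1) (Suc i) s3 \<tau>3"
        if "best a D S z (Suc i) M' N'" "s3 (aMin, p, z, 0) = of_nat M'" "s3 (aTotal, p, z, 0) = of_nat N'"
          "\<And>c i j l. c < 23 \<Longrightarrow> \<not> (9 \<le> c \<and> c \<le> 10 \<and> i = p \<and> j = z) \<Longrightarrow> s3 (c, i, j, l) = s2 (c, i, j, l)"
          "s3 (vZ, 0, 0, 0) = of_nat z" "\<tau>3 \<le> \<tau>2 + 8" for s3 \<tau>3 M' N'
      proof -
        note h = that
        have "best_rep a p D S s3 (if z' < z then T else if z' = z then Suc i else 0) z'" if z': "z' < n" for z'
        proof (cases "z' = z")
          case False
          then have "s3 (aMin, p, z', 0) = s2 (aMin, p, z', 0)" "s3 (aTotal, p, z', 0) = s2 (aTotal, p, z', 0)"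
            using h(4) by simp_all
          moreover have "best_rep a p D S s2 (if z' < z then T else if z' = z then Suc i else 0) z'"
            using H z' False by (cases "z' < z") (auto simp: H_def)
          ultimately show ?thesis
            using best_rep_cong by blast
        qed (use h in \<open>auto simp: best_rep_def\<close>)
        moreover have "frame 9 10 p s2 s3"
          using h(4) unfolding frame_def by blast
        ultimately show ?thesis
          using H h(5,6) frame_trans[OF fr] by (simp add: H_def)
      qed
      define k where "k = a * Suc i + D (z, Suc i)"
      have k: "rat_of_nat a * of_nat (Suc i) + rat_of_nat (D (z, Suc i)) = of_nat k"
        unfolding k_def of_nat_add of_nat_mult ..
      consider "D (z, Suc i) = 0" | "D (z, Suc i) \<noteq> 0" "M = 0 \<or> k < M" | "D (z, Suc i) \<noteq> 0" "\<not> (M = 0 \<or> k < M)"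
        by blast
      then show "wp I ?body (H z (Suc \<tau>1) (Suc i)) (s2((vI, 0, 0, 0) := of_nat i)) (Suc \<tau>2)"
      proof cases
        case 1
        show ?thesis
          using best_skip[OF MN(1) 1] by (simp add: update_best_def p2 z2 D t 1 del: of_nat_Suc) (rule H', auto simp: MN z2)
      next
        case 2
        show ?thesis
          using best_new[OF MN(1) 2(1) 2(2)[unfolded k_def], folded k_def] 2(2)
          by (auto simp: update_best_def p2 z2 D t k MN 2(1) simp del: of_nat_Suc intro!: H' split: if_splits)
      next
        case 3
        show ?thesis
          using best_old[OF MN(1) 3(1) 3(2)[unfolded k_def], folded k_def] 3(2)
          apply (simp add: update_best_def p2 z2 D t k MN 3(1) del: of_nat_Suc)
          apply (intro conjI impI; rule H')
          apply (auto simp: MN z2 split: if_splits)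
          done
      qed
    next
      fix s2 \<tau>2 assume "H z (Suc \<tau>1) T s2 \<tau>2"
      then show "J (Suc z) s2 \<tau>2"
        using J by (auto simp: H_def J_def less_Suc_eq)
    qed (simp add: I[simplified])
  next
    fix s' \<tau>' assume "J n s' \<tau>'"
    then show "Q s' \<tau>'"
      using Q by (simp add: J_def)
  qed (simp add: I)
qed

section \<open>The backward pass\<close>

lemma idx_Suc [simp]: "idx (rat_of_nat i + 1) = Suc i"
  by (metis add.commute idx_of_nat of_nat_Suc)

text \<open>The product of \<open>S\<close> at \<open>(u, t0)\<close> and \<open>g\<close> at the
  head counts for all times in \<open>{t0 + 1..t}\<close>; the difference array records it by an
  entry at \<open>t0 + 1\<close> and its negative at \<open>t + 1\<close>. For \<open>t = t0\<close>
  there is no wait, and the entries cancel.\<close>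

definition propagate :: acom where
  "propagate = Cond (Eq (Rd aDist (V vPass) (V vV) (V vT)) (Plus (Rd aDist (V vPass) (V vU) (V vT0)) (Num 1)))
     (Put vAcc (Plus (V vAcc) (Rd aG (V vPass) (V vV) (V vT)));;
      Wr aDiff (V vPass) (V vU) (Plus (V vT0) (Num 1)) (Plus (Rd aDiff (V vPass) (V vU) (Plus (V vT0) (Num 1)))
        (Times (Rd aCount (V vPass) (V vU) (V vT0)) (Rd aG (V vPass) (V vV) (V vT))));;
      Wr aDiff (V vPass) (V vU) (Plus (V vT) (Num 1)) (Minus (Rd aDiff (V vPass) (V vU) (Plus (V vT) (Num 1)))
        (Times (Rd aCount (V vPass) (V vU) (V vT0)) (Rd aG (V vPass) (V vV) (V vT)))))
     Nop"

definition set_weight :: acom where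
  "set_weight =
     (Put vAcc (Num 0);;
      Cond (Minus (Num 1) (Eq (V vU) (V vRoot)))
        (Cond (Eq (Plus (Times (V vA) (V vT0)) (Rd aDist (V vPass) (V vU) (V vT0))) (Rd aMin (V vPass) (V vU) (Num 0)))
           (Put vAcc (Divide (Num 1) (Rd aTotal (V vPass) (V vU) (Num 0)))) Nop) Nop;;
      Wr aWeight (V vPass) (V vU) (V vT0) (V vAcc))"

abbreviation (input) "last_node \<equiv> Minus (Minus (Rd aQLen (V vPass) (Num 0) (Num 0)) (Num 1)) (V vQ)"

text \<open>Tight edges raise the distance. In reverse queue order, \<open>g\<close> is therefore
  final at the heads of all tight edges when their tail is reached.\<close>

definition backward :: "bool \<Rightarrow> acom" where
  "backward strict = For vQ (Rd aQLen (V vPass) (Num 0) (Num 0))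
     (load_node last_node;;
      set_weight;;
      for_arcs strict propagate;;
      Wr aG (V vPass) (V vU) (V vT0) (V vAcc))"

context bfs_tree
begin

text \<open>What the difference array holds once the edges in \<open>X\<close> have been
  propagated.\<close>

definition dsum :: "(nat \<times> nat \<Rightarrow> rat) \<Rightarrow> ((nat \<times> nat) \<times> arc) set \<Rightarrow> nat \<Rightarrow> nat \<Rightarrow> rat" where
  "dsum g X v i = (\<Sum>(x, e)\<in>X. of_bool (fst x = v) * of_nat (S x) * g (snd e) *
     (of_bool (i = Suc (snd x)) - of_bool (i = Suc (tm e))))"

text \<open>A prefix sum turns the two entries of an edge into the indicator of
  \<open>snd x < t \<le> tm e\<close>, because edges never go back in time.\<close>

lemma sum_dsum: "(\<Sum>i\<in>{1..t}. dsum g tight v i) = (\<Sum>(x, e)\<in>skipping v t. of_nat (S x) * g (snd e))"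
proof -
  have "(\<Sum>i\<in>{1..t}. of_bool (i = Suc j) :: rat) = of_bool (j < t)" for j
    by (auto simp: of_bool_def sum.delta)
  moreover have "snd x \<le> tm e" if "(x, e) \<in> tight" for x e
    using that by (auto simp: tight_def edge_def ok_def split: if_splits)
  ultimately have *: "(\<Sum>i\<in>{1..t}. of_bool (i = Suc (snd x)) - of_bool (i = Suc (tm e)) :: rat) =
      of_bool (snd x < t \<and> t \<le> tm e)" if "(x, e) \<in> tight" for x e
    using that by (fastforce simp: sum_subtractf of_bool_def)
  have "(\<Sum>i\<in>{1..t}. dsum g tight v i) = (\<Sum>p\<in>tight. \<Sum>i\<in>{1..t}. of_bool (fst (fst p) = v) * of_nat (S (fst p)) * g (snd (snd p)) *
     (of_bool (i = Suc (snd (fst p))) - of_bool (i = Suc (tm (snd p)))))"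
    unfolding dsum_def case_prod_beta by (rule sum.swap)
  also have "\<dots> = (\<Sum>p\<in>tight. if fst (fst p) = v \<and> snd (fst p) < t \<and> t \<le> tm (snd p) then of_nat (S (fst p)) * g (snd (snd p)) else 0)"
    unfolding sum_distrib_left[symmetric] using * by (intro sum.cong refl) (auto simp: of_bool_def)
  also have "\<dots> = (\<Sum>p | p \<in> tight \<and> fst (fst p) = v \<and> snd (fst p) < t \<and> t \<le> tm (snd p). of_nat (S (fst p)) * g (snd (snd p)))"
    by (rule sum.inter_filter[symmetric, OF finite_tight])
  also have "{p. p \<in> tight \<and> fst (fst p) = v \<and> snd (fst p) < t \<and> t \<le> tm (snd p)} = skipping v t"
    by (auto simp: skipping_def)
  finally show ?thesis
    by (simp add: case_prod_beta)
qed

lemma dsum_cong: "(\<And>x e. (x, e) \<in> X \<Longrightarrow> g (snd e) = g' (snd e)) \<Longrightarrow> dsum g X v i = dsum g' X v i"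
  unfolding dsum_def by (intro sum.cong) auto

text \<open>The scan inspects the times 1 to \<open>T\<close> only. For a node other than
  \<open>s\<close> these include all reached times, as its reached temporal nodes are heads of
  arcs.\<close>

lemma best_opt:
  assumes b: "best a D S z T M N" and z: "z \<noteq> s" and T: "\<And>e. e \<in> E \<Longrightarrow> tm e \<le> T"
  shows "D (z, t) \<noteq> 0 \<Longrightarrow> t \<in> opt a z \<longleftrightarrow> a * t + D (z, t) = M" and "total a z = N"
proof -
  have range: "t \<in> {1..T}" if "D (z, t) \<noteq> 0" for t
  proof -
    have "\<exists>e. e \<in> E \<and> snd e = (z, t)"
      using parent[OF that] z by (auto simp: edge_def)
    then obtain e where "e \<in> E" "snd e = (z, t)"
      by blast
    then show ?thesis
      using pos[of e] T[of e] by (auto simp: tm_def)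
  qed
  have M: "M \<le> a * t + D (z, t)" if "D (z, t) \<noteq> 0" for t
    using b range[OF that] that by (auto simp: best_def)
  have ex: "\<exists>t. D (z, t) \<noteq> 0 \<and> M = a * t + D (z, t)" if "D (z, t) \<noteq> 0" for t
    using b range[OF that] that unfolding best_def by (metis (no_types, lifting))
  show *: "t \<in> opt a z \<longleftrightarrow> a * t + D (z, t) = M" if "D (z, t) \<noteq> 0" for t
  proof -
    from ex[OF that] obtain i where "D (z, i) \<noteq> 0" "M = a * i + D (z, i)"
      by blast
    then show ?thesis
      using M that M[OF that] unfolding opt_def key_def mem_Collect_eq snd_conv by (metis le_antisym)
  qed
  have "opt a z = {t. t \<in> {1..T} \<and> D (z, t) \<noteq> 0 \<and> a * t + D (z, t) = M}"
    using * range by (auto simp: opt_def)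
  then show "total a z = N"
    using b by (simp add: best_def total_def)
qed

lemma wp_set_weight:
  assumes "s0 (vPass, 0, 0, 0) = of_nat p" "s0 (vRoot, 0, 0, 0) = of_nat s" "s0 (vA, 0, 0, 0) = of_nat a"
    "s0 (vU, 0, 0, 0) = of_nat u" "s0 (vT0, 0, 0, 0) = of_nat t" "s0 (aDist, p, u, t) = of_nat (D (u, t))" "D (u, t) \<noteq> 0"
    and b: "best_rep a p D S s0 T u" and T: "\<And>e. e \<in> E \<Longrightarrow> tm e \<le> T"
    and Q: "\<And>\<tau>'. \<tau>' \<le> \<tau> + 5 \<Longrightarrow> Q (s0((vAcc, 0, 0, 0) := weight a (u, t), (aWeight, p, u, t) := weight a (u, t))) \<tau>'"
  shows "wp I set_weight Q s0 \<tau>"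
proof -
  obtain M N where MN: "best a D S u T M N" "s0 (aMin, p, u, 0) = of_nat M" "s0 (aTotal, p, u, 0) = of_nat N"
    using b by (auto simp: best_rep_def)
  have k: "rat_of_nat a * of_nat t + of_nat (D (u, t)) = of_nat M \<longleftrightarrow> a * t + D (u, t) = M"
    unfolding of_nat_mult[symmetric] of_nat_add[symmetric] of_nat_eq_iff ..
  have w: "weight a (u, t) = (if u \<noteq> s \<and> a * t + D (u, t) = M then 1 / of_nat N else 0)"
    using best_opt[OF MN(1) _ T] assms(7) by (auto simp: weight_def)
  show ?thesis
    unfolding set_weight_def using Q[unfolded w] assms(1-6) k MN
    by (cases "u = s"; cases "a * t + D (u, t) = M") simp_all
qed

lemma dsum_insert:
  assumes "finite X" "(x, e) \<notin> X"
  shows "dsum g (insert (x, e) X) v i = dsum g X v i + of_bool (fst x = v) * of_nat (S x) * g (snd e) *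
     (of_bool (i = Suc (snd x)) - of_bool (i = Suc (tm e)))"
  using assms by (simp add: dsum_def)

lemma wp_backward_inner:
  assumes E: "E = set es" and es: "distinct es" and adj: "adj_rep es s0"
    and s0: "s0 (vPass, 0, 0, 0) = of_nat p" "s0 (vWin, 0, 0, 0) = of_nat K"
      "s0 (vU, 0, 0, 0) = of_nat (fst x)" "s0 (vT0, 0, 0, 0) = of_nat (snd x)" "s0 (vAcc, 0, 0, 0) = w"
    and rep: "bfs_rep p s0 D S qs" and x: "D x \<noteq> 0"
    and X: "X \<subseteq> tight" "\<And>e. (x, e) \<notin> X"
    and diff: "\<And>v i. s0 (aDiff, p, v, i) = dsum g X v i" and g: "\<And>y. s0 (aG, p, y) = g y"
    and Q: "\<And>s' \<tau>'. \<lbrakk>frame 13 13 p s0 s';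
       s' (vAcc, 0, 0, 0) = w + (\<Sum>e | (x, e) \<in> tight. g (snd e));
       s' (vU, 0, 0, 0) = of_nat (fst x); s' (vT0, 0, 0, 0) = of_nat (snd x);
       \<And>v i. s' (aDiff, p, v, i) = dsum g (X \<union> {(x, e) | e. (x, e) \<in> tight}) v i;
       \<tau>' \<le> \<tau> + 1 + 8 * length (adj es (fst x))\<rbrakk> \<Longrightarrow> Q s' \<tau>'"
  shows "wp I (for_arcs strict propagate) Q s0 \<tau>"
proof -
  obtain u t0 where xu: "x = (u, t0)"
    by (rule prod.exhaust)
  let ?as = "adj es u"
  let ?T = "\<lambda>j. {e. (x, e) \<in> tight \<and> e \<in> set (take j ?as)}"
  define J where "J = (\<lambda>j s' \<tau>'. frame 13 13 p s0 s' \<and> s' (vAcc, 0, 0, 0) = w + (\<Sum>e\<in>?T j. g (snd e)) \<and>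
     s' (vU, 0, 0, 0) = of_nat u \<and> s' (vT0, 0, 0, 0) = of_nat t0 \<and>
     (\<forall>v i. s' (aDiff, p, v, i) = dsum g (X \<union> Pair x ` ?T j) v i) \<and> \<tau>' \<le> \<tau> + 1 + 8 * j)"
  have tight: "(x, e) \<in> tight \<longleftrightarrow> e \<in> set ?as \<and> ok strict K t0 (tm e) \<and> D (snd e) = Suc (D x)" for e
  proof -
    have "edge strict K E x e \<longleftrightarrow> e \<in> set ?as \<and> ok strict K t0 (tm e)"
      using edge_adj[of strict K es x e] E xu by simp
    then show ?thesis
      using x by (simp add: tight_def)
  qed
  show ?thesis
  proof (rule wp_For[where N = "length ?as" and J = J])
    show "idx (aval I (Rd aDeg (V vU) (Num 0) (Num 0)) s0) = length ?as"
      using adj s0(3) xu by (simp add: adj_rep_def)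
    show "J 0 s0 (Suc \<tau>)"
      using s0 diff frame_refl xu by (simp add: J_def)
  next
    fix j s1 \<tau>1 assume j: "j < length ?as" and "J j s1 \<tau>1"
    then have 1: "frame 13 13 p s0 s1" "s1 (vAcc, 0, 0, 0) = w + (\<Sum>e\<in>?T j. g (snd e))"
      "s1 (vU, 0, 0, 0) = of_nat u" "s1 (vT0, 0, 0, 0) = of_nat t0"
      "\<And>v i. s1 (aDiff, p, v, i) = dsum g (X \<union> Pair x ` ?T j) v i" "\<tau>1 \<le> \<tau> + 1 + 8 * j"
      by (simp_all add: J_def)
    define e where "e = ?as ! j"
    obtain v t where e: "dst e = v" "tm e = t" "snd e = (v, t)"
      by (metis dst_def tm_def prod.collapse)
    let ?s = "s1((vJ, 0, 0, 0) := of_nat j, (vV, 0, 0, 0) := of_nat v, (vT, 0, 0, 0) := of_nat t)"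
    have s2: "?s (vPass, 0, 0, 0) = of_nat p" "?s (vWin, 0, 0, 0) = of_nat K" "?s (vU, 0, 0, 0) = of_nat u"
      "?s (vT0, 0, 0, 0) = of_nat t0" "?s (vV, 0, 0, 0) = of_nat v" "?s (vT, 0, 0, 0) = of_nat t"
      using 1(1,3,4) s0(1,2) by (simp_all add: frame_def)
    have arr: "s1 (aDist, p, i, l) = of_nat (D (i, l))" "s1 (aCount, p, i, l) = of_nat (S (i, l))" for i l
      using 1(1) rep by (simp_all add: frame_def bfs_rep_def)
    have G: "s1 (aG, p, i, l) = g (i, l)" for i l
      using 1(1) g[of "(i, l)"] by (simp add: frame_def)
    have dist: "distinct ?as"
      using es by (simp add: adj_def)
    have new: "e \<notin> set (take j ?as)"
      using dist j unfolding e_def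
      by (metis distinct_conv_nth in_set_conv_nth length_take less_irrefl min_less_iff_conj nth_take)
    have e_in: "e \<in> set ?as"
      using j by (simp add: e_def)
    have T: "?T (Suc j) = (if (x, e) \<in> tight then insert e (?T j) else ?T j)"
      using j by (auto simp: take_Suc_conv_app_nth e_def)
    have finX: "finite (X \<union> Pair x ` ?T j)"
      using finite_subset[OF X(1) finite_tight] by simp
    have newX: "(x, e) \<notin> X \<union> Pair x ` ?T j"
      using X(2) new by auto
    have fr: "frame 13 13 p s0 s3"
      if "\<And>c i j l. c < 23 \<Longrightarrow> \<not> (c = 13 \<and> i = p) \<Longrightarrow> s3 (c, i, j, l) = s1 (c, i, j, l)" for s3
      using 1(1) that by (simp add: frame_def)
    have eqD: "rat_of_nat (D (v, t)) = rat_of_nat (D (u, t0)) + 1 \<longleftrightarrow> D (v, t) = Suc (D (u, t0))"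
      by (metis of_nat_Suc of_nat_eq_iff add.commute)
    have skip: "J (Suc j) ?s \<tau>'" if "(x, e) \<notin> tight" "\<tau>' \<le> Suc \<tau>1 + 7" for \<tau>'
      using 1 that fr[of ?s] unfolding J_def T by simp
    have "wp I (Cond (eok strict) propagate Nop) (J (Suc j)) ?s (Suc \<tau>1 + 2)"
    proof (cases "ok strict K t0 t")
      case False
      then have "aval I (eok strict) ?s = 0"
        using aval_eok[OF s2(4,6,2)] by blast
      moreover have "(x, e) \<notin> tight"
        using False e tight by simp
      ultimately show ?thesis
        using skip by simp
    next
      case True
      then have c: "aval I (eok strict) ?s \<noteq> 0"
        using aval_eok[OF s2(4,6,2)] by blast
      have "wp I propagate (J (Suc j)) ?s (Suc (Suc \<tau>1 + 2))"
      proof (cases "(x, e) \<in> tight")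
        case False
        then have "D (v, t) \<noteq> Suc (D (u, t0))"
          using True e e_in tight[of e] xu by simp
        then show ?thesis
          using skip[OF False] s2 arr eqD by (simp add: propagate_def)
      next
        case tight': True
        then have d: "D (v, t) = Suc (D (u, t0))"
          using e tight[of e] xu by simp
        have sum: "(\<Sum>e\<in>?T (Suc j). g (snd e)) = (\<Sum>e\<in>?T j. g (snd e)) + g (v, t)"
          unfolding T using tight' new e by simp
        have ds: "dsum g (X \<union> Pair x ` ?T (Suc j)) v' i = dsum g (X \<union> Pair x ` ?T j) v' i +
          of_bool (u = v') * of_nat (S (u, t0)) * g (v, t) * (of_bool (i = Suc t0) - of_bool (i = Suc t))" for v' i
          using dsum_insert[OF finX newX, of g v' i] tight' e xu unfolding T by simp
        have J1: "J (Suc j) s3 \<tau>3"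
          if "\<And>c i j l. c < 23 \<Longrightarrow> \<not> (c = 13 \<and> i = p) \<Longrightarrow> s3 (c, i, j, l) = s1 (c, i, j, l)"
            "s3 (vAcc, 0, 0, 0) = s1 (vAcc, 0, 0, 0) + g (v, t)"
            "s3 (vU, 0, 0, 0) = of_nat u" "s3 (vT0, 0, 0, 0) = of_nat t0"
            "\<And>v i. s3 (aDiff, p, v, i) = dsum g (X \<union> Pair x ` ?T (Suc j)) v i"
            "\<tau>3 \<le> \<tau>1 + 8" for s3 \<tau>3
          using that fr[of s3] 1(2,6) sum by (simp add: J_def)
        show ?thesis
          unfolding propagate_def
          using 1(6) 
          apply (simp add: s2[simplified] arr G eqD d)
          \<comment> \<open>The cells \<open>Suc t0\<close> and \<open>Suc t\<close> coincide if
            \<open>t = t0\<close>, hence two cases.\<close>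
          apply (intro conjI impI)
          subgoal by (rule J1) (simp_all add: ds 1(1-5) e)
          subgoal by (rule J1) (auto simp: ds 1(1-5) e)
          done
      qed
      then show ?thesis
        using c by simp
    qed
    moreover have "adj_rep es (s1((vJ, 0, 0, 0) := of_nat j))"
      using frame_adj[OF 1(1) _ adj] by (simp add: adj_rep_def)
    ultimately have "wp I load_arc (wp I (Cond (eok strict) propagate Nop) (J (Suc j))) (s1((vJ, 0, 0, 0) := of_nat j)) (Suc \<tau>1)"
      using j 1(3)
      by (intro wp_load_arc[where es = es and u = u and j = j]) (simp_all add: e_def[symmetric] e del: wp_simps(4))
    then show "wp I (load_arc;; Cond (eok strict) propagate Nop) (J (Suc j)) (s1((vJ, 0, 0, 0) := of_nat j)) (Suc \<tau>1)"
      by simp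
  next
    fix s' \<tau>' assume "J (length ?as) s' \<tau>'"
    moreover have "?T (length ?as) = {e. (x, e) \<in> tight}"
      using tight by auto
    moreover have "Pair x ` {e. (x, e) \<in> tight} = {(x, e) | e. (x, e) \<in> tight}"
      by auto
    ultimately show "Q s' \<tau>'"
      unfolding J_def using xu by (intro Q) simp_all
  qed
qed

lemma wp_backward:
  assumes E: "E = set es" and es: "distinct es" and T: "\<And>e. e \<in> E \<Longrightarrow> tm e \<le> T \<and> dst e < n" "s < n"
    and adj: "adj_rep es s0"
    and s0: "s0 (vPass, 0, 0, 0) = of_nat p" "s0 (vRoot, 0, 0, 0) = of_nat s" "s0 (vWin, 0, 0, 0) = of_nat K"
      "s0 (vA, 0, 0, 0) = of_nat a"
    and rep: "bfs_rep p s0 D S qs" and qs: "distinct qs" "set qs = {y. D y \<noteq> 0}" "sorted (map D qs)"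
    and best: "\<And>z. z < n \<Longrightarrow> best_rep a p D S s0 T z"
    and fresh: "\<And>v i. s0 (aDiff, p, v, i) = 0"
    and Q: "\<And>s' \<tau>' g. \<lbrakk>frame 11 13 p s0 s'; \<And>y. s' (aG, p, y) = g y;
       \<And>y. D y \<noteq> 0 \<Longrightarrow> s' (aWeight, p, y) = weight a y;
       \<And>y. D y \<noteq> 0 \<Longrightarrow> g y = weight a y + (\<Sum>e | (y, e) \<in> tight. g (snd e));
       \<And>v i. s' (aDiff, p, v, i) = dsum g tight v i;
       \<tau>' \<le> \<tau> + 1 + 10 * length qs + 8 * (\<Sum>x\<in>set qs. length (adj es (fst x)))\<rbrakk> \<Longrightarrow> Q s' \<tau>'"
  shows "wp I (backward strict) Q s0 \<tau>"
proof -
  let ?n = "length qs"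
  let ?done = "\<lambda>q. set (drop (?n - q) qs)"
  let ?X = "\<lambda>q. {(y, e) \<in> tight. y \<in> ?done q}"
  define J where "J = (\<lambda>q s' \<tau>'. frame 11 13 p s0 s' \<and> (\<exists>g. (\<forall>y. s' (aG, p, y) = g y) \<and>
     (\<forall>y\<in>?done q. s' (aWeight, p, y) = weight a y \<and> g y = weight a y + (\<Sum>e | (y, e) \<in> tight. g (snd e))) \<and>
     (\<forall>v i. s' (aDiff, p, v, i) = dsum g (?X q) v i)) \<and>
     \<tau>' \<le> \<tau> + 1 + 10 * q + 8 * (\<Sum>x\<in>?done q. length (adj es (fst x))))"
  let ?body = "load_node last_node;; set_weight;; for_arcs strict propagate;; Wr aG (V vPass) (V vU) (V vT0) (V vAcc)"
  show ?thesis
    unfolding backward_def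
  proof (rule wp_For[where N = ?n and J = J])
    show "idx (aval I (Rd aQLen (V vPass) (Num 0) (Num 0)) s0) = ?n"
      using rep s0 by (simp add: bfs_rep_def)
    show "J 0 s0 (Suc \<tau>)"
      using fresh frame_refl by (auto simp: J_def dsum_def)
  next
    fix q s1 \<tau>1 assume q: "q < ?n" and "J q s1 \<tau>1"
    then obtain g where 1: "frame 11 13 p s0 s1" "\<And>y. s1 (aG, p, y) = g y"
      "\<And>y. y \<in> ?done q \<Longrightarrow> s1 (aWeight, p, y) = weight a y"
      "\<And>y. y \<in> ?done q \<Longrightarrow> g y = weight a y + (\<Sum>e | (y, e) \<in> tight. g (snd e))"
      "\<And>v i. s1 (aDiff, p, v, i) = dsum g (?X q) v i"
      "\<tau>1 \<le> \<tau> + 1 + 10 * q + 8 * (\<Sum>x\<in>?done q. length (adj es (fst x)))"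
      unfolding J_def by blast
    define m where "m = ?n - 1 - q"
    have m: "m < ?n" "?n - q = Suc m" "?n - Suc q = m"
      using q by (auto simp: m_def)
    obtain u t0 where x: "qs ! m = (u, t0)"
      by (rule prod.exhaust)
    let ?x = "(u, t0)"
    have drop: "drop m qs = ?x # drop (Suc m) qs"
      using Cons_nth_drop_Suc[OF m(1)] x by simp
    have dn: "?done (Suc q) = insert ?x (?done q)" "?x \<notin> ?done q"
      using distinct_drop[OF qs(1), of m] drop unfolding m by simp_all
    have Dx: "D ?x \<noteq> 0" and u: "u < n"
    proof -
      have in_qs: "?x \<in> set qs"
        using m(1) x by (metis nth_mem)
      then show "D ?x \<noteq> 0"
        using qs(2) by simp
      then have "?x = r \<or> (\<exists>e\<in>E. snd e = ?x)"
        using parent[of ?x] unfolding edge_def by blast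
      then show "u < n"
        using T by (auto simp: dst_def)
    qed
    have le: "D ?x \<le> D y" if "y \<in> ?done q" for y
    proof -
      have "sorted (map D (drop m qs))"
        using qs(3) by (simp add: drop_map[symmetric] sorted_wrt_drop)
      then show ?thesis
        using that unfolding m drop by auto
    qed
    \<comment> \<open>The head of a tight edge out of a processed node is farther away than the
      current node. Setting \<open>g\<close> at the current node thus keeps all equations
      established before.\<close>
    have later: "snd e \<noteq> ?x" if "(y, e) \<in> tight" "y \<in> ?done (Suc q)" for y e
      using that le[of y] unfolding dn(1) by (auto simp: tight_def)
    have s1: "s1 (vPass, 0, 0, 0) = of_nat p" "s1 (vRoot, 0, 0, 0) = of_nat s" "s1 (vWin, 0, 0, 0) = of_nat K"
      "s1 (vA, 0, 0, 0) = of_nat a"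
      using 1(1) s0 by (simp_all add: frame_def)
    have rep1: "bfs_rep p s1 D S qs"
      using frame_bfs_rep[OF 1(1) _ rep] by simp
    have Q1: "s1 (aQLen, p, 0, 0) = of_nat ?n" "s1 (aQNode, p, m, 0) = of_nat u" "s1 (aQTime, p, m, 0) = of_nat t0"
      "s1 (aDist, p, u, t0) = of_nat (D ?x)"
      using rep1 m(1) x by (auto simp: bfs_rep_def)
    let ?s2 = "s1((vQ, 0, 0, 0) := of_nat q, (vU, 0, 0, 0) := of_nat u, (vT0, 0, 0, 0) := of_nat t0)"
    let ?s3 = "?s2((vAcc, 0, 0, 0) := weight a ?x, (aWeight, p, u, t0) := weight a ?x)"
    have b1: "best_rep a p D S ?s2 T u"
      using best[OF u] 1(1) by (auto simp: frame_def intro: best_rep_cong)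
    have f3: "frame 11 13 p s1 ?s3"
      by (auto simp: frame_def)
    have inner: "wp I (for_arcs strict propagate)
        (wp I (Wr aG (V vPass) (V vU) (V vT0) (V vAcc)) (J (Suc q))) ?s3 \<tau>3" if \<tau>3: "\<tau>3 \<le> \<tau>1 + 8" for \<tau>3
    proof (rule wp_backward_inner[where x = ?x and X = "?X q" and g = g and p = p and w = "weight a ?x", OF E es])
      show "adj_rep es ?s3"
        using frame_adj[OF f3 _ frame_adj[OF 1(1) _ adj]] by simp
      show "bfs_rep p ?s3 D S qs"
        using frame_bfs_rep[OF f3 _ rep1] by simp
      show "?X q \<subseteq> tight"
        by auto
      show "(?x, e) \<notin> ?X q" for e
        using dn(2) by simp
    next
      fix s' \<tau>'
      assume 2: "frame 13 13 p ?s3 s'" "s' (vAcc, 0, 0, 0) = weight a ?x + (\<Sum>e | (?x, e) \<in> tight. g (snd e))"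
       "s' (vU, 0, 0, 0) = of_nat (fst ?x)" "s' (vT0, 0, 0, 0) = of_nat (snd ?x)"
       "\<And>v i. s' (aDiff, p, v, i) = dsum g (?X q \<union> {(?x, e) | e. (?x, e) \<in> tight}) v i"
       "\<tau>' \<le> \<tau>3 + 1 + 8 * length (adj es (fst ?x))"
      define G where "G = weight a ?x + (\<Sum>e | (?x, e) \<in> tight. g (snd e))"
      let ?g = "g(?x := G)"
      let ?s4 = "s'((aG, p, u, t0) := G)"
      have X: "?X q \<union> {(?x, e) | e. (?x, e) \<in> tight} = ?X (Suc q)"
        unfolding dn(1) by auto
      have "frame 11 13 p s0 ?s4"
        using frame_trans[OF 1(1) frame_trans[OF f3 frame_mono[OF 2(1), of 11 13]]] by (simp add: frame_def)
      moreover have "?s4 (aG, p, y) = ?g y" for y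
        using 2(1) 1(2) by (cases y) (auto simp: frame_def)
      moreover have "?s4 (aWeight, p, y) = weight a y" if "y \<in> ?done (Suc q)" for y
        using that 2(1) 1(3) unfolding dn(1) by (cases y) (auto simp: frame_def)
      moreover have "?g y = weight a y + (\<Sum>e | (y, e) \<in> tight. ?g (snd e))" if y: "y \<in> ?done (Suc q)" for y
      proof -
        have "(\<Sum>e | (y, e) \<in> tight. ?g (snd e)) = (\<Sum>e | (y, e) \<in> tight. g (snd e))"
          using later y by (intro sum.cong) auto
        then show ?thesis
          using y 1(4)[of y] unfolding dn(1) by (cases "y = ?x") (simp_all add: G_def)
      qed
      moreover have "?s4 (aDiff, p, v, i) = dsum ?g (?X (Suc q)) v i" for v i
      proof -
        have "?g (snd e) = g (snd e)" if "(y, e) \<in> ?X (Suc q)" for y e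
          using later[of y e] that by simp
        then have "dsum ?g (?X (Suc q)) v i = dsum g (?X (Suc q)) v i"
          by (rule dsum_cong)
        then show ?thesis
          using 2(5)[of v i] unfolding X by simp
      qed
      moreover have "Suc \<tau>' \<le> \<tau> + 1 + 10 * Suc q + 8 * (\<Sum>x\<in>?done (Suc q). length (adj es (fst x)))"
        using 2(6) \<tau>3 1(6) dn(2) unfolding dn(1) by simp
      ultimately have "J (Suc q) ?s4 (Suc \<tau>')"
        unfolding J_def by blast
      moreover have "s' (vPass, 0, 0, 0) = of_nat p"
        using 2(1) s1(1) by (simp add: frame_def)
      ultimately show "wp I (Wr aG (V vPass) (V vU) (V vT0) (V vAcc)) (J (Suc q)) s' \<tau>'"
        using 2(2-4) by (simp add: G_def)
    qed (use s1 1 Dx in \<open>auto\<close>)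
    have weight: "wp I set_weight (wp I (for_arcs strict propagate)
        (wp I (Wr aG (V vPass) (V vU) (V vT0) (V vAcc)) (J (Suc q)))) ?s2 (\<tau>1 + 3)"
      using s1 Q1 Dx b1 T(1) by (intro wp_set_weight[where p = p and u = u and t = t0 and a = a and T = T] inner) auto
    have "rat_of_nat ?n - 1 - rat_of_nat q = of_nat m"
      using q by (simp add: m_def of_nat_diff)
    then have load: "wp I (load_node last_node) R
      (s1((vQ, 0, 0, 0) := of_nat q)) (Suc \<tau>1) = R ?s2 (\<tau>1 + 3)" for R
      using s1 Q1 by (simp add: load_node_def eval_nat_numeral)
    show "wp I ?body (J (Suc q)) (s1((vQ, 0, 0, 0) := of_nat q)) (Suc \<tau>1)"
      unfolding wp_simps(3) load by (rule weight)
  next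
    fix s' \<tau>' assume "J ?n s' \<tau>'"
    then obtain g where "frame 11 13 p s0 s'" "\<And>y. s' (aG, p, y) = g y"
      "\<And>y. y \<in> ?done ?n \<Longrightarrow> s' (aWeight, p, y) = weight a y"
      "\<And>y. y \<in> ?done ?n \<Longrightarrow> g y = weight a y + (\<Sum>e | (y, e) \<in> tight. g (snd e))"
      "\<And>v i. s' (aDiff, p, v, i) = dsum g (?X ?n) v i"
      "\<tau>' \<le> \<tau> + 1 + 10 * ?n + 8 * (\<Sum>x\<in>?done ?n. length (adj es (fst x)))"
      unfolding J_def by blast
    moreover have "?done ?n = {y. D y \<noteq> 0}" "?X ?n = tight"
      using qs(2) by (auto simp: tight_def)
    ultimately show "Q s' \<tau>'"
      using Q qs(2) by simp
  qed
qed

end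

section \<open>Adding the scores of one source to the output\<close>

abbreviation (input) "aOut \<equiv> 0 :: nat"

abbreviation (input) "out_idx \<equiv> Plus (Times (V vV) (In (Num 1))) (V vI)"
abbreviation (input) "at_node c \<equiv> Rd c (V vPass) (V vV) (V vT)"
abbreviation (input) "at_cycle c \<equiv> Rd c (V vV) (V vV) (V vT)"

text \<open>The cycle search from \<open>v\<close> runs as pass \<open>v\<close>, so
  \<open>at_cycle\<close> uses \<open>v\<close> both as pass and as node. The loop over all earlier
  times is the origin of \<open>T ^ 2\<close> in the active bound. Distances serve as truth values,
  0 meaning unreached.\<close>

definition count_overlap :: acom where
  "count_overlap =
     (Put vN (Num 0);;
      For vJ (V vT)
        (Cond (Times (Minus (Num 1) (Lt (Plus (V vJ) (V vWin)) (V vT)))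
            (Times (Rd aDist (V vPass) (V vV) (V vJ)) (Times (at_cycle aDist)
              (Eq (Plus (at_node aDist) (Num 1)) (Plus (Rd aDist (V vPass) (V vV) (V vJ)) (at_cycle aDist))))))
          (Put vN (Plus (V vN) (Times (Rd aCount (V vPass) (V vV) (V vJ)) (at_cycle aCount))))
          Nop))"

text \<open>In the active case \<open>vAcc\<close> carries the prefix sum of the difference array
  from one time to the next, so the waits cost one addition per temporal node.\<close>

primrec score :: "mode \<Rightarrow> acom" where
  "score Passive = Wr aOut out_idx (Num 0) (Num 0) (Plus (Rd aOut out_idx (Num 0) (Num 0))
     (Times (at_node aCount) (Minus (at_node aG) (at_node aWeight))))"
| "score Active =
     (Put vAcc (Plus (V vAcc) (at_node aDiff));;
      count_overlap;;
      Wr aOut out_idx (Num 0) (Num 0) (Plus (Rd aOut out_idx (Num 0) (Num 0))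
        (Plus (Times (Minus (at_node aCount) (V vN)) (Minus (at_node aG) (at_node aWeight))) (V vAcc))))"

definition accumulate :: "mode \<Rightarrow> acom" where
  "accumulate md = For vV (In (Num 0)) (Cond (Eq (V vV) (V vRoot)) Nop
     (Put vAcc (Num 0);; For vI (In (Num 1)) (Put vT (Plus (V vI) (Num 1));; score md)))"

definition out_frame :: "store \<Rightarrow> store \<Rightarrow> bool" where
  "out_frame s s' \<longleftrightarrow> (\<forall>c i j l. 0 < c \<longrightarrow> c < 23 \<longrightarrow> s' (c, i, j, l) = s (c, i, j, l))"

definition scored :: "store \<Rightarrow> nat \<Rightarrow> rat \<Rightarrow> store \<Rightarrow> bool" where
  "scored s a q s' \<longleftrightarrow> (\<forall>i. s' (aOut, i, 0, 0) = s (aOut, i, 0, 0) + (if i = a then q else 0))"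

lemma out_idx_eq:
  fixes i i' T :: nat
  assumes "i < T" "i' < T"
  shows "v * T + i = v' * T + i' \<longleftrightarrow> v = v' \<and> i = i'"
proof
  assume eq: "v * T + i = v' * T + i'"
  have "v = (v * T + i) div T" "v' = (v' * T + i') div T"
    using assms by simp_all
  then have "v = v'"
    using eq by simp
  then show "v = v' \<and> i = i'"
    using eq by simp
qed simp

text \<open>Shared by both modes: \<open>acc\<close> describes the running sum, \<open>c\<close> the
  score of a temporal node and \<open>k\<close> the cost of computing it.\<close>

lemma wp_accumulate:
  assumes I: "I 0 = of_nat n" "I 1 = of_nat T" and root: "s0 (vRoot, 0, 0, 0) = of_nat r"
    and acc: "\<And>v. acc v 0 = 0"
    and score: "\<And>v i s \<tau> Q. \<lbrakk>v < n; v \<noteq> r; i < T; out_frame s0 s; s (vV, 0, 0, 0) = of_nat v; s (vI, 0, 0, 0) = of_nat i;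
      s (vT, 0, 0, 0) = of_nat (Suc i); s (vAcc, 0, 0, 0) = acc v i;
      \<And>s' \<tau>'. \<lbrakk>out_frame s s'; s' (vV, 0, 0, 0) = of_nat v; s' (vAcc, 0, 0, 0) = acc v (Suc i);
        scored s (v * T + i) (c v (Suc i)) s'; \<tau>' \<le> \<tau> + k\<rbrakk> \<Longrightarrow> Q s' \<tau>'\<rbrakk> \<Longrightarrow> wp I (score md) Q s \<tau>"
    and Q: "\<And>s' \<tau>'. \<lbrakk>out_frame s0 s'; \<And>v i. v < n \<Longrightarrow> i < T \<Longrightarrow>
        s' (aOut, v * T + i, 0, 0) = s0 (aOut, v * T + i, 0, 0) + (if v = r then 0 else c v (Suc i));
      \<tau>' \<le> \<tau> + 1 + n * (4 + T * (2 + k))\<rbrakk> \<Longrightarrow> Q s' \<tau>'"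
  shows "wp I (accumulate md) Q s0 \<tau>"
proof -
  let ?out = "\<lambda>s' v i. \<forall>v'<n. \<forall>i'<T. s' (aOut, v' * T + i', 0, 0) = s0 (aOut, v' * T + i', 0, 0) +
     (if (v' < v \<or> v' = v \<and> i' < i) \<and> v' \<noteq> r then c v' (Suc i') else 0)"
  define J where "J = (\<lambda>v s' \<tau>'. out_frame s0 s' \<and> ?out s' v 0 \<and> \<tau>' \<le> \<tau> + 1 + v * (4 + T * (2 + k)))"
  define H where "H = (\<lambda>v \<tau>0 i s' \<tau>'. out_frame s0 s' \<and> ?out s' v i \<and> s' (vV, 0, 0, 0) = of_nat v \<and>
     s' (vAcc, 0, 0, 0) = acc v i \<and> \<tau>' \<le> \<tau>0 + 1 + i * (2 + k))"
  show ?thesis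
    unfolding accumulate_def
  proof (rule wp_For[where N = n and J = J])
    show "J 0 s0 (Suc \<tau>)"
      by (simp add: J_def out_frame_def)
  next
    fix v s1 \<tau>1 assume v: "v < n" and J: "J v s1 \<tau>1"
    let ?s = "s1((vV, 0, 0, 0) := of_nat v)"
    have root1: "s1 (vRoot, 0, 0, 0) = of_nat r"
      using J root by (simp add: J_def out_frame_def)
    show "wp I (Cond (Eq (V vV) (V vRoot)) Nop (Put vAcc (Num 0);; For vI (In (Num 1)) (Put vT (Plus (V vI) (Num 1));; score md)))
        (J (Suc v)) ?s (Suc \<tau>1)"
    proof (cases "v = r")
      case True
      have "J (Suc v) ?s (Suc (Suc (Suc \<tau>1)))"
        using J True by (auto simp: J_def out_frame_def less_Suc_eq)
      then show ?thesis
        using True root1 by simp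
    next
      case False
      let ?t = "?s((vAcc, 0, 0, 0) := 0)"
      have "wp I (For vI (In (Num 1)) (Put vT (Plus (V vI) (Num 1));; score md)) (J (Suc v)) ?t (\<tau>1 + 3)"
      proof (rule wp_For[where N = T and J = "H v (\<tau>1 + 3)"])
        show "H v (\<tau>1 + 3) 0 ?t (Suc (\<tau>1 + 3))"
          using J acc by (simp add: H_def J_def out_frame_def)
      next
        fix i s2 \<tau>2 assume i: "i < T" and H: "H v (\<tau>1 + 3) i s2 \<tau>2"
        let ?u = "s2((vI, 0, 0, 0) := of_nat i, (vT, 0, 0, 0) := of_nat (Suc i))"
        have "wp I (score md) (H v (\<tau>1 + 3) (Suc i)) ?u (Suc (Suc \<tau>2))"
        proof (rule score[OF v False i])
          show "out_frame s0 ?u" "?u (vV, 0, 0, 0) = of_nat v" "?u (vI, 0, 0, 0) = of_nat i"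
            "?u (vT, 0, 0, 0) = of_nat (Suc i)" "?u (vAcc, 0, 0, 0) = acc v i"
            using H by (simp_all add: H_def out_frame_def)
        next
          fix s' \<tau>' assume 1: "out_frame ?u s'" "s' (vV, 0, 0, 0) = of_nat v" "s' (vAcc, 0, 0, 0) = acc v (Suc i)"
            "scored ?u (v * T + i) (c v (Suc i)) s'" "\<tau>' \<le> Suc (Suc \<tau>2) + k"
          have "?out s' v (Suc i)"
          proof (intro allI impI)
            fix v' i' assume v': "v' < n" "i' < T"
            show "s' (aOut, v' * T + i', 0, 0) = s0 (aOut, v' * T + i', 0, 0) +
                (if (v' < v \<or> v' = v \<and> i' < Suc i) \<and> v' \<noteq> r then c v' (Suc i') else 0)"
              using 1(4) H v' False out_idx_eq[OF v'(2) i, of v' v] by (auto simp: scored_def H_def less_Suc_eq)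
          qed
          moreover have "out_frame s0 s'"
            using 1(1) H by (simp add: out_frame_def H_def)
          ultimately show "H v (\<tau>1 + 3) (Suc i) s' \<tau>'"
            using 1 H by (simp add: H_def)
        qed
        then show "wp I (Put vT (Plus (V vI) (Num 1));; score md) (H v (\<tau>1 + 3) (Suc i)) (s2((vI, 0, 0, 0) := of_nat i)) (Suc \<tau>2)"
          by (simp add: add.commute)
      next
        fix s' \<tau>' assume "H v (\<tau>1 + 3) T s' \<tau>'"
        then show "J (Suc v) s' \<tau>'"
          using J by (auto simp: H_def J_def less_Suc_eq)
      qed (simp add: I[simplified])
      then show ?thesis
        using False root1 by (simp add: eval_nat_numeral)
    qed
  next
    fix s' \<tau>' assume "J n s' \<tau>'"
    then show "Q s' \<tau>'"
      using Q by (simp add: J_def)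
  qed (simp add: I)
qed

lemma wp_score_Passive:
  assumes "I 1 = of_nat T" "s (vPass, 0, 0, 0) = of_nat p" "s (vV, 0, 0, 0) = of_nat v" "s (vI, 0, 0, 0) = of_nat i"
    "s (vT, 0, 0, 0) = of_nat (Suc i)"
    and Q: "\<And>s' \<tau>'. \<lbrakk>out_frame s s'; s' (vV, 0, 0, 0) = of_nat v; s' (vAcc, 0, 0, 0) = s (vAcc, 0, 0, 0);
      scored s (v * T + i) (s (aCount, p, v, Suc i) * (s (aG, p, v, Suc i) - s (aWeight, p, v, Suc i))) s';
      \<tau>' \<le> \<tau> + 1\<rbrakk> \<Longrightarrow> Q s' \<tau>'"
  shows "wp I (score Passive) Q s \<tau>"
proof -
  have "rat_of_nat v * of_nat T + of_nat i = of_nat (v * T + i)"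
    by simp
  then show ?thesis
    using assms(1-5) by (simp del: of_nat_add of_nat_mult of_nat_Suc) (rule Q, auto simp: out_frame_def scored_def)
qed

lemma wp_count_overlap:
  assumes "bfs_tree strict K E r D S" and t: "s (vPass, 0, 0, 0) = of_nat p" "s (vV, 0, 0, 0) = of_nat v"
    "s (vT, 0, 0, 0) = of_nat t" "s (vWin, 0, 0, 0) = of_nat K"
    and main: "\<And>i. s (aDist, p, v, i) = of_nat (D (v, i))" "\<And>i. s (aCount, p, v, i) = of_nat (S (v, i))"
    and cyc: "s (aDist, v, v, t) = of_nat (D0 (v, t))" "s (aCount, v, v, t) = of_nat (S0 (v, t))"
    and Q: "\<And>s' \<tau>'. \<lbrakk>\<And>c i j l. c \<noteq> vN \<Longrightarrow> c \<noteq> vJ \<Longrightarrow> s' (c, i, j, l) = s (c, i, j, l);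
      s' (vN, 0, 0, 0) = of_nat (bfs_tree.overlap K D S D0 S0 (v, t)); \<tau>' \<le> \<tau> + 2 + 3 * t\<rbrakk> \<Longrightarrow> Q s' \<tau>'"
  shows "wp I count_overlap Q s \<tau>"
proof -
  let ?c = "\<lambda>i. t \<le> i + K \<and> D (v, i) \<noteq> 0 \<and> D0 (v, t) \<noteq> 0 \<and> Suc (D (v, t)) = D (v, i) + D0 (v, t)"
  let ?N = "\<lambda>j. \<Sum>i | i < j \<and> ?c i. S (v, i) * S0 (v, t)"
  define J where "J = (\<lambda>j s' \<tau>'. (\<forall>c i j l. c \<noteq> vN \<longrightarrow> c \<noteq> vJ \<longrightarrow> s' (c, i, j, l) = s (c, i, j, l)) \<and>
     s' (vN, 0, 0, 0) = of_nat (?N j) \<and> \<tau>' \<le> \<tau> + 2 + 3 * j)"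
  have ov: "bfs_tree.overlap K D S D0 S0 (v, t) = ?N t"
    unfolding bfs_tree.overlap_def[OF assms(1)] by simp
  let ?cond = "Times (Minus (Num 1) (Lt (Plus (V vJ) (V vWin)) (V vT)))
            (Times (Rd aDist (V vPass) (V vV) (V vJ)) (Times (at_cycle aDist)
              (Eq (Plus (at_node aDist) (Num 1)) (Plus (Rd aDist (V vPass) (V vV) (V vJ)) (at_cycle aDist)))))"
  let ?body = "Cond ?cond (Put vN (Plus (V vN) (Times (Rd aCount (V vPass) (V vV) (V vJ)) (at_cycle aCount)))) Nop"
  have "wp I (For vJ (V vT) ?body) Q (s((vN, 0, 0, 0) := 0)) (Suc \<tau>)"
  proof (rule wp_For[where N = t and J = J])
    show "J 0 (s((vN, 0, 0, 0) := 0)) (Suc (Suc \<tau>))"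
      by (simp add: J_def)
  next
    fix j s1 \<tau>1 assume "j < t" and "J j s1 \<tau>1"
    then have 1: "\<And>c i j l. c \<noteq> vN \<Longrightarrow> c \<noteq> vJ \<Longrightarrow> s1 (c, i, j, l) = s (c, i, j, l)"
      "s1 (vN, 0, 0, 0) = of_nat (?N j)" "\<tau>1 \<le> \<tau> + 2 + 3 * j"
      by (auto simp: J_def)
    let ?s = "s1((vJ, 0, 0, 0) := of_nat j)"
    have step: "?N (Suc j) = (if ?c j then ?N j + S (v, j) * S0 (v, t) else ?N j)"
    proof -
      have "{i. i < Suc j \<and> ?c i} = (if ?c j then insert j {i. i < j \<and> ?c i} else {i. i < j \<and> ?c i})"
        by (auto simp: less_Suc_eq)
      then show ?thesis
        by simp
    qed
    have eqs: "rat_of_nat (D (v, t)) + 1 = of_nat (D (v, j)) + of_nat (D0 (v, t)) \<longleftrightarrow> Suc (D (v, t)) = D (v, j) + D0 (v, t)"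
      "rat_of_nat j + of_nat K < of_nat t \<longleftrightarrow> j + K < t"
      by (metis of_nat_Suc of_nat_eq_iff add.commute of_nat_add) (simp only: of_nat_add[symmetric] of_nat_less_iff)
    have "aval I ?cond ?s \<noteq> 0 \<longleftrightarrow> ?c j"
      using 1(1) t main cyc eqs by (auto simp: not_less)
    moreover have "aval I (Plus (V vN) (Times (Rd aCount (V vPass) (V vV) (V vJ)) (at_cycle aCount))) ?s =
        of_nat (?N j + S (v, j) * S0 (v, t))"
      using 1(1,2) t main cyc by simp
    ultimately show "wp I ?body (J (Suc j)) ?s (Suc \<tau>1)"
      using 1 unfolding J_def step wp_simps(1,2,4) by simp
  next
    fix s' \<tau>' assume "J t s' \<tau>'"
    then show "Q s' \<tau>'"
      unfolding J_def by (intro Q) (auto simp: ov)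
  qed (use t in simp)
  then show ?thesis
    unfolding count_overlap_def by simp
qed

lemma wp_score_Active:
  assumes "bfs_tree strict K E r D S" "I 1 = of_nat T" "s (vPass, 0, 0, 0) = of_nat p" "s (vV, 0, 0, 0) = of_nat v"
    "s (vI, 0, 0, 0) = of_nat i" "s (vT, 0, 0, 0) = of_nat (Suc i)" "s (vWin, 0, 0, 0) = of_nat K" "i < T"
    and main: "\<And>i. s (aDist, p, v, i) = of_nat (D (v, i))" "\<And>i. s (aCount, p, v, i) = of_nat (S (v, i))"
    and cyc: "s (aDist, v, v, Suc i) = of_nat (D0 (v, Suc i))" "s (aCount, v, v, Suc i) = of_nat (S0 (v, Suc i))"
    and Q: "\<And>s' \<tau>'. \<lbrakk>out_frame s s'; s' (vV, 0, 0, 0) = of_nat v;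
      s' (vAcc, 0, 0, 0) = s (vAcc, 0, 0, 0) + s (aDiff, p, v, Suc i);
      scored s (v * T + i) ((of_nat (S (v, Suc i)) - of_nat (bfs_tree.overlap K D S D0 S0 (v, Suc i))) *
        (s (aG, p, v, Suc i) - s (aWeight, p, v, Suc i)) + (s (vAcc, 0, 0, 0) + s (aDiff, p, v, Suc i))) s';
      \<tau>' \<le> \<tau> + (4 + 3 * T)\<rbrakk> \<Longrightarrow> Q s' \<tau>'"
  shows "wp I (score Active) Q s \<tau>"
proof -
  let ?s = "s((vAcc, 0, 0, 0) := s (vAcc, 0, 0, 0) + s (aDiff, p, v, Suc i))"
  let ?wr = "Wr aOut out_idx (Num 0) (Num 0) (Plus (Rd aOut out_idx (Num 0) (Num 0))
        (Plus (Times (Minus (at_node aCount) (V vN)) (Minus (at_node aG) (at_node aWeight))) (V vAcc)))"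
  have idx: "rat_of_nat v * of_nat T + of_nat i = of_nat (v * T + i)"
    by simp
  have "wp I count_overlap (wp I ?wr Q) ?s (Suc \<tau>)"
  proof (rule wp_count_overlap[OF assms(1), where p = p and v = v and t = "Suc i" and ?D0.0 = D0 and ?S0.0 = S0])
    fix s' \<tau>'
    assume 1: "\<And>c i j l. c \<noteq> vN \<Longrightarrow> c \<noteq> vJ \<Longrightarrow> s' (c, i, j, l) = ?s (c, i, j, l)"
      "s' (vN, 0, 0, 0) = of_nat (bfs_tree.overlap K D S D0 S0 (v, Suc i))" "\<tau>' \<le> Suc \<tau> + 2 + 3 * Suc i"
    show "wp I ?wr Q s' \<tau>'"
      using 1(1,2) assms(2-6) main idx
      by (simp del: of_nat_add of_nat_mult of_nat_Suc) (rule Q, use 1 assms(8) in \<open>auto simp: out_frame_def scored_def\<close>)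
  qed (use assms in simp_all)
  then show ?thesis
    using assms(3-6) by (simp del: of_nat_Suc)
qed

section \<open>Adjacency lists from the input\<close>

definition load_graph :: acom where
  "load_graph = For vI (In (Num 2))
     (Put vU (In (Plus (Num 4) (Times (Num 3) (V vI))));;
      Wr aHead (V vU) (Rd aDeg (V vU) (Num 0) (Num 0)) (Num 0) (In (Plus (Num 5) (Times (Num 3) (V vI))));;
      Wr aTime (V vU) (Rd aDeg (V vU) (Num 0) (Num 0)) (Num 0) (In (Plus (Num 6) (Times (Num 3) (V vI))));;
      Wr aDeg (V vU) (Num 0) (Num 0) (Plus (Rd aDeg (V vU) (Num 0) (Num 0)) (Num 1)))"

lemma input_arc:
  assumes "i < length es"
  shows "input n T es k (int (4 + 3 * i)) = of_nat (src (es ! i))"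
    "input n T es k (int (5 + 3 * i)) = of_nat (dst (es ! i))"
    "input n T es k (int (6 + 3 * i)) = of_nat (tm (es ! i))"
proof -
  have "nat (int (4 + 3 * i) - 4) = 3 * i" "nat (int (5 + 3 * i) - 4) = 1 + 3 * i" "nat (int (6 + 3 * i) - 4) = 2 + 3 * i"
    by simp_all
  moreover have "int (6 + 3 * i) < 4 + 3 * int (length es)"
    using assms by linarith
  moreover have "(1 + 3 * i) div 3 = i" "(2 + 3 * i) div 3 = i" "(1 + 3 * i) mod 3 = 1" "(2 + 3 * i) mod 3 = 2"
    by presburger+
  ultimately show "input n T es k (int (4 + 3 * i)) = of_nat (src (es ! i))"
    "input n T es k (int (5 + 3 * i)) = of_nat (dst (es ! i))"
    "input n T es k (int (6 + 3 * i)) = of_nat (tm (es ! i))"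
    unfolding input_def Let_def by simp_all
qed

lemma wp_load_graph:
  assumes I: "I 2 = of_nat (length es)"
    "\<And>i. i < length es \<Longrightarrow> I (4 + 3 * i) = of_nat (src (es ! i)) \<and> I (5 + 3 * i) = of_nat (dst (es ! i)) \<and>
       I (6 + 3 * i) = of_nat (tm (es ! i))"
    and fresh: "\<And>u. s (aDeg, u, 0, 0) = 0"
    and Q: "\<And>s' \<tau>'. \<lbrakk>adj_rep es s'; \<And>c i j l. c = 0 \<or> 3 < c \<Longrightarrow> c < 23 \<Longrightarrow> s' (c, i, j, l) = s (c, i, j, l);
       \<tau>' \<le> \<tau> + 1 + 5 * length es\<rbrakk> \<Longrightarrow> Q s' \<tau>'"
  shows "wp I load_graph Q s \<tau>"
proof -
  define J where "J = (\<lambda>i s' \<tau>'. adj_rep (take i es) s' \<and>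
     (\<forall>c i j l. c = 0 \<or> 3 < c \<longrightarrow> c < 23 \<longrightarrow> s' (c, i, j, l) = s (c, i, j, l)) \<and> \<tau>' \<le> \<tau> + 1 + 5 * i)"
  show ?thesis
    unfolding load_graph_def
  proof (rule wp_For[where N = "length es" and J = J])
    show "J 0 s (Suc \<tau>)"
      using fresh by (simp add: J_def adj_rep_def adj_def)
  next
    fix i s1 \<tau>1 assume i: "i < length es" and J: "J i s1 \<tau>1"
    define e where "e = es ! i"
    define u where "u = src e"
    let ?as = "adj (take i es)"
    have adj: "adj (take (Suc i) es) w = (if w = u then ?as w @ [e] else ?as w)" for w
      using i by (simp add: adj_def take_Suc_conv_app_nth e_def u_def)
    have rep: "s1 (aDeg, w, 0, 0) = of_nat (length (?as w))"
      "j < length (?as w) \<Longrightarrow> s1 (aHead, w, j, 0) = of_nat (dst (?as w ! j)) \<and> s1 (aTime, w, j, 0) = of_nat (tm (?as w ! j))" for w j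
      using J by (simp_all add: J_def adj_rep_def)
    have idx: "4 + 3 * rat_of_nat i = of_nat (4 + 3 * i)" "5 + 3 * rat_of_nat i = of_nat (5 + 3 * i)"
      "6 + 3 * rat_of_nat i = of_nat (6 + 3 * i)"
      by simp_all
    have arc: "I (4 + 3 * i) = of_nat u" "I (5 + 3 * i) = of_nat (dst e)" "I (6 + 3 * i) = of_nat (tm e)"
      using I(2)[OF i] by (simp_all add: e_def u_def)
    let ?d = "length (?as u)"
    let ?s = "s1((vI, 0, 0, 0) := of_nat i, (vU, 0, 0, 0) := of_nat u, (aHead, u, ?d, 0) := of_nat (dst e),
      (aTime, u, ?d, 0) := of_nat (tm e), (aDeg, u, 0, 0) := of_nat ?d + 1)"
    have "adj_rep (take (Suc i) es) ?s"
      unfolding adj_rep_def adj using rep by (auto simp: nth_append less_Suc_eq)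
    then have "J (Suc i) ?s (Suc (Suc (Suc (Suc (Suc \<tau>1)))))"
      using J by (auto simp: J_def)
    then show "wp I (Put vU (In (Plus (Num 4) (Times (Num 3) (V vI))));;
      Wr aHead (V vU) (Rd aDeg (V vU) (Num 0) (Num 0)) (Num 0) (In (Plus (Num 5) (Times (Num 3) (V vI))));;
      Wr aTime (V vU) (Rd aDeg (V vU) (Num 0) (Num 0)) (Num 0) (In (Plus (Num 6) (Times (Num 3) (V vI))));;
      Wr aDeg (V vU) (Num 0) (Num 0) (Plus (Rd aDeg (V vU) (Num 0) (Num 0)) (Num 1)))
      (J (Suc i)) (s1((vI, 0, 0, 0) := of_nat i)) (Suc \<tau>1)"
      by (simp add: idx arc rep(1)[unfolded One_nat_def] del: of_nat_add of_nat_mult)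
  next
    fix s' \<tau>' assume "J (length es) s' \<tau>'"
    then show "Q s' \<tau>'"
      using Q[of s' \<tau>'] unfolding J_def take_all[OF order_refl] by blast
  qed (simp add: I(1))
qed

section \<open>The costs as one optimisation problem\<close>

definition objective :: "bool \<Rightarrow> cost \<Rightarrow> nat \<Rightarrow> arc set \<Rightarrow> nat \<Rightarrow> nat \<Rightarrow> bool" where
  "objective strict c n E K a \<longleftrightarrow> (\<forall>s z. opt_walks strict c n E s z =
     argmin_set {W. is_sz_walk strict E s z W \<and> restless (enat K) W} (\<lambda>W. a * arr W + length W))"

lemma objective_restless: "objective strict (Restless (enat k)) n E k 0"
  by (simp add: objective_def opt_walks_def)

lemma all_restless:
  assumes "wf_tgraph n T es"
  shows "is_sz_walk strict (set es) s z W \<and> restless (enat T) W \<longleftrightarrow> is_sz_walk strict (set es) s z W"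
  using restless_bounded[of "set es" T strict W] assms by (auto simp: is_sz_walk_def wf_tgraph_def)

lemma objective_shortest:
  assumes "wf_tgraph n T es"
  shows "objective strict (Restless \<infinity>) n (set es) T 0"
  using all_restless[OF assms] by (simp add: objective_def opt_walks_def) (simp add: restless_def)

lemma objective_foremost:
  assumes "wf_tgraph n T es"
  shows "objective strict Foremost n (set es) T n"
  using all_restless[OF assms] by (simp add: objective_def opt_walks_def)

definition cycle_rep :: "bool \<Rightarrow> nat \<Rightarrow> arc set \<Rightarrow> store \<Rightarrow> bool" where
  "cycle_rep strict n E s \<longleftrightarrow> (\<forall>v<n. \<exists>D0 S0. bfs_tree strict 0 E v D0 S0 \<and>
     (\<forall>i j. s (aDist, v, i, j) = of_nat (D0 (i, j)) \<and> s (aCount, v, i, j) = of_nat (S0 (i, j))))"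

definition source_scores :: "bool \<Rightarrow> mode \<Rightarrow> cost \<Rightarrow> nat \<Rightarrow> nat \<Rightarrow> arc set \<Rightarrow> nat \<Rightarrow> nat \<Rightarrow> nat \<Rightarrow> real" where
  "source_scores strict md c n T E r v t = (if v = r then 0 else
     (\<Sum>z | z < n \<and> z \<noteq> v \<and> z \<noteq> r. delta strict md c n T E r z v t))"

lemma betweenness_source_scores:
  "v < n \<Longrightarrow> betweenness strict md c n T E v t = (\<Sum>r<n. source_scores strict md c n T E r v t)"
proof -
  assume "v < n"
  have "{(s, z). s < n \<and> z < n \<and> s \<noteq> v \<and> v \<noteq> z \<and> s \<noteq> z} = Sigma {s. s < n \<and> s \<noteq> v} (\<lambda>s. {z. z < n \<and> z \<noteq> v \<and> z \<noteq> s})"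
    by auto
  then have "betweenness strict md c n T E v t =
      (\<Sum>r | r < n \<and> r \<noteq> v. \<Sum>z | z < n \<and> z \<noteq> v \<and> z \<noteq> r. delta strict md c n T E r z v t)"
    unfolding betweenness_def by (simp add: sum.Sigma)
  also have "\<dots> = (\<Sum>r | r < n \<and> r \<noteq> v. source_scores strict md c n T E r v t)"
    by (intro sum.cong) (auto simp: source_scores_def)
  also have "\<dots> = (\<Sum>r<n. source_scores strict md c n T E r v t)"
    by (rule sum.mono_neutral_left) (auto simp: source_scores_def)
  finally show ?thesis .
qed

section \<open>Processing one source\<close>

definition process_source :: "bool \<Rightarrow> mode \<Rightarrow> acom" where
  "process_source strict md = (bfs strict;; select;; backward strict;; accumulate md)"

text \<open>Variables stand for the products here, so that the estimate is linear.\<close>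

lemma time_bound:
  fixes \<tau> \<tau>' n X Z m Y :: nat
  assumes "\<tau>' \<le> \<tau> + 33 + 6 * n + 40 * X + 7 * Z + 19 * m + 19 * Y" "1 \<le> X" "n \<le> X" "X \<le> Z" "m \<le> Y"
  shows "\<tau>' \<le> \<tau> + 100 * (Z + Y)"
  using assms by simp

text \<open>\<open>n \<le> p\<close> keeps the arrays of this pass apart from those of the cycle
  searches, which occupy the passes below \<open>n\<close> and are read by
  \<open>count_overlap\<close>.\<close>

lemma wp_process_source:
  assumes wf: "wf_tgraph n T es" "r < n" "1 \<le> T" and I: "I 0 = of_nat n" "I 1 = of_nat T"
    and obj: "objective strict c n (set es) K a"
    and adj: "adj_rep es s" and cyc: "cycle_rep strict n (set es) s"
    and s: "s (vPass, 0, 0, 0) = of_nat p" "s (vRoot, 0, 0, 0) = of_nat r" "s (vWin, 0, 0, 0) = of_nat K"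
      "s (vA, 0, 0, 0) = of_nat a"
    and p: "n \<le> p" and fresh: "\<And>c i j. 4 \<le> c \<Longrightarrow> c \<le> 13 \<Longrightarrow> s (c, p, i, j) = 0"
    and Q: "\<And>s' \<tau>'. \<lbrakk>\<And>c i j l. 0 < c \<Longrightarrow> c < 23 \<Longrightarrow> \<not> (4 \<le> c \<and> c \<le> 13 \<and> i = p) \<Longrightarrow> s' (c, i, j, l) = s (c, i, j, l);
       \<And>v i. v < n \<Longrightarrow> i < T \<Longrightarrow> real_of_rat (s' (aOut, v * T + i, 0, 0)) =
          real_of_rat (s (aOut, v * T + i, 0, 0)) + source_scores strict md c n T (set es) r v (Suc i);
       \<tau>' \<le> \<tau> + 100 * (n * T * (case md of Passive \<Rightarrow> 1 | Active \<Rightarrow> T) + length es * T)\<rbrakk> \<Longrightarrow> Q s' \<tau>'"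
  shows "wp I (process_source strict md) Q s \<tau>"
  unfolding process_source_def wp_simps(3)
proof (rule wp_bfs[where p = p and r = r and K = K, OF wf(1,2) I adj s(1-3)])
  fix s1 \<tau>1 D S qs
  assume tree: "bfs_tree strict K (set es) r D S" and rep: "bfs_rep p s1 D S qs" and qs: "distinct qs" "set qs = {y. D y \<noteq> 0}"
    "sorted (map D qs)" and len: "length qs \<le> Suc (n * T)" and work: "(\<Sum>x\<in>set qs. length (adj es (fst x))) \<le> length es * Suc T"
    and f1: "bfs_frame p s s1"
    and \<tau>1: "\<tau>1 \<le> \<tau> + 20 + 20 * (n * T) + 11 * (length es * Suc T)"
  interpret bfs_tree strict K "set es" r D S
    by (rule tree)
  let ?W = "\<Sum>x\<in>set qs. length (adj es (fst x))"
  have F1: "frame 4 8 p s s1"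
    using frame_bfs[OF f1] .
  have s1: "s1 (vPass, 0, 0, 0) = of_nat p" "s1 (vRoot, 0, 0, 0) = of_nat r" "s1 (vWin, 0, 0, 0) = of_nat K"
    "s1 (vA, 0, 0, 0) = of_nat a" "\<And>z. s1 (aMin, p, z, 0) = 0" "\<And>z. s1 (aTotal, p, z, 0) = 0"
    "\<And>v i. s1 (aDiff, p, v, i) = 0"
    using F1 s fresh by (simp_all add: frame_def)
  show "wp I select (wp I (backward strict) (wp I (accumulate md) Q)) s1 \<tau>1"
  proof (rule wp_select[where p = p and a = a, OF I s1(1,4) rep s1(5,6)])
    fix s2 \<tau>2 assume F2: "frame 9 10 p s1 s2" and best: "\<And>z. z < n \<Longrightarrow> best_rep a p D S s2 T z"
      and \<tau>2: "\<tau>2 \<le> \<tau>1 + 1 + n * (2 + 8 * T)"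
    have s2: "s2 (vPass, 0, 0, 0) = of_nat p" "s2 (vRoot, 0, 0, 0) = of_nat r" "s2 (vWin, 0, 0, 0) = of_nat K"
      "s2 (vA, 0, 0, 0) = of_nat a" "\<And>v i. s2 (aDiff, p, v, i) = 0"
      using F2 s1 by (simp_all add: frame_def)
    have rep2: "bfs_rep p s2 D S qs"
      using frame_bfs_rep[OF F2 _ rep] by simp
    have adj2: "adj_rep es s2"
      using frame_adj[OF F2 _ frame_adj[OF F1 _ adj]] by simp
    have es: "distinct es" "\<And>e. e \<in> set es \<Longrightarrow> tm e \<le> T \<and> dst e < n"
      using wf(1) by (auto simp: wf_tgraph_def)
    show "wp I (backward strict) (wp I (accumulate md) Q) s2 \<tau>2"
    proof (rule wp_backward[where p = p and a = a, OF refl es wf(2) adj2 s2(1-4) rep2 qs best s2(5)])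
      fix s3 \<tau>3 g
      assume F3: "frame 11 13 p s2 s3" and G: "\<And>y. s3 (aG, p, y) = g y"
        and W: "\<And>y. D y \<noteq> 0 \<Longrightarrow> s3 (aWeight, p, y) = weight a y"
        and g: "\<And>y. D y \<noteq> 0 \<Longrightarrow> g y = weight a y + (\<Sum>e | (y, e) \<in> tight. g (snd e))"
        and diff: "\<And>v i. s3 (aDiff, p, v, i) = dsum g tight v i"
        and \<tau>3: "\<tau>3 \<le> \<tau>2 + 1 + 10 * length qs + 8 * ?W"
      have F: "frame 4 13 p s s3"
        using frame_trans[OF frame_mono[OF F1] frame_trans[OF frame_mono[OF F2] frame_mono[OF F3]], of 4 13] by simp
      have s3: "s3 (vPass, 0, 0, 0) = of_nat p" "s3 (vRoot, 0, 0, 0) = of_nat r" "s3 (vWin, 0, 0, 0) = of_nat K"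
        using F s by (simp_all add: frame_def)
      have rep3: "s3 (aDist, p, v, i) = of_nat (D (v, i))" "s3 (aCount, p, v, i) = of_nat (S (v, i))" for v i
        using frame_bfs_rep[OF F3 _ rep2] by (simp_all add: bfs_rep_def)
      have opt: "opt_walks strict c n (set es) r z = (\<Union>t\<in>opt a z. cont (r, 0) (z, t))" if "z \<noteq> r" for z
        using obj argmin_walks[OF that, of a] by (simp add: objective_def)
      have scores: "source_scores strict md c n T (set es) r v t = real_of_rat
          (\<Sum>y | D y \<noteq> 0 \<and> fst y \<noteq> v. weight a y * of_nat (card {W \<in> cont (r, 0) y. (v, t) \<in> Vis md T W}))"
        if "v \<noteq> r" for v t
        using sum_delta[where n = n and c = c and a = a and v = v and md = md and T = T and t = t, OF _ opt] es(2) that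
        by (simp add: source_scores_def)
      \<comment> \<open>The conclusion is shared by both modes: \<open>sc\<close> is the score that
        was added, and \<open>k\<close> the cost per temporal node, constant or linear in
        \<open>T\<close>.\<close>
      have fin: "Q s' \<tau>'"
        if "out_frame s3 s'" "\<And>v i. v < n \<Longrightarrow> i < T \<Longrightarrow> s' (aOut, v * T + i, 0, 0) = s3 (aOut, v * T + i, 0, 0) + (if v = r then 0 else sc v (Suc i))"
          "\<And>v i. v < n \<Longrightarrow> i < T \<Longrightarrow> v \<noteq> r \<Longrightarrow> real_of_rat (sc v (Suc i)) = source_scores strict md c n T (set es) r v (Suc i)"
          "\<tau>' \<le> \<tau>3 + 1 + n * (4 + T * (2 + k))" "k \<le> 7 * (case md of Passive \<Rightarrow> 1 | Active \<Rightarrow> T)" for s' \<tau>' sc k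
      proof (rule Q)
        fix b i j l :: nat assume "0 < b" "b < 23" "\<not> (4 \<le> b \<and> b \<le> 13 \<and> i = p)"
        then show "s' (b, i, j, l) = s (b, i, j, l)"
          using that(1) F by (simp add: out_frame_def frame_def)
      next
        fix v i assume vi: "v < n" "i < T"
        have "s3 (aOut, v * T + i, 0, 0) = s (aOut, v * T + i, 0, 0)"
          using F by (simp add: frame_def)
        then show "real_of_rat (s' (aOut, v * T + i, 0, 0)) =
          real_of_rat (s (aOut, v * T + i, 0, 0)) + source_scores strict md c n T (set es) r v (Suc i)"
          using that(2,3)[OF vi] by (auto simp: of_rat_add source_scores_def)
      next
        let ?f = "case md of Passive \<Rightarrow> 1 | Active \<Rightarrow> T"
        have "1 \<le> n * T" "n \<le> n * T" "n * T \<le> n * T * ?f" "length es \<le> length es * T" "n * T * k \<le> 7 * (n * T * ?f)"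
          using wf(2,3) that(5) mult_le_mono2[OF that(5), of "n * T"] by (auto split: mode.splits)
        moreover have "\<tau>' \<le> \<tau>3 + 1 + 4 * n + 2 * (n * T) + n * T * k"
          using that(4) by (simp add: algebra_simps)
        moreover have "\<tau>3 \<le> \<tau> + 32 + 2 * n + 38 * (n * T) + 19 * length es + 19 * (length es * T)"
          using \<tau>1 \<tau>2 \<tau>3 len work by (simp add: algebra_simps)
        ultimately have "\<tau>' \<le> \<tau> + 33 + 6 * n + 40 * (n * T) + 7 * (n * T * ?f) + 19 * length es + 19 * (length es * T)"
          by linarith
        then show "\<tau>' \<le> \<tau> + 100 * (n * T * ?f + length es * T)"
          using \<open>1 \<le> n * T\<close> \<open>n \<le> n * T\<close> \<open>n * T \<le> n * T * ?f\<close> \<open>length es \<le> length es * T\<close> by (rule time_bound)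
      qed
      show "wp I (accumulate md) Q s3 \<tau>3"
      proof (cases md)
        case Passive
        \<comment> \<open>The score uses the stored \<open>aWeight\<close>, which is known at
          reached nodes only; elsewhere it is multiplied by \<open>S = 0\<close>.\<close>
        let ?sc = "\<lambda>v t. of_nat (S (v, t)) * (g (v, t) - s3 (aWeight, p, v, t))"
        have sc: "real_of_rat (?sc v t) = source_scores strict md c n T (set es) r v t" if "v \<noteq> r" for v t
        proof -
          have "source_scores strict md c n T (set es) r v t = real_of_rat (of_nat (S (v, t)) * (g (v, t) - weight a (v, t)))"
            unfolding scores[OF that] unfolding Passive
            by (rule arg_cong[where f = real_of_rat], rule sum_passive[OF _ that]) (rule g)
          then show ?thesis
            using W[of "(v, t)"] unreached[of "(v, t)"] Passive by (cases "D (v, t) = 0") simp_all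
        qed
        show ?thesis
          unfolding Passive
        proof (rule wp_accumulate[where acc = "\<lambda>_ _. 0" and c = ?sc and k = 1 and I = I and n = n and T = T and r = r and ?s0.0 = s3, OF I s3(2)])
          fix v i s4 \<tau>4 and R :: "store \<Rightarrow> nat \<Rightarrow> bool"
          assume 4: "out_frame s3 s4" "s4 (vV, 0, 0, 0) = of_nat v" "s4 (vI, 0, 0, 0) = of_nat i"
            "s4 (vT, 0, 0, 0) = of_nat (Suc i)" "s4 (vAcc, 0, 0, 0) = 0"
            and R: "\<And>s' \<tau>'. \<lbrakk>out_frame s4 s'; s' (vV, 0, 0, 0) = of_nat v; s' (vAcc, 0, 0, 0) = 0;
              scored s4 (v * T + i) (?sc v (Suc i)) s'; \<tau>' \<le> \<tau>4 + 1\<rbrakk> \<Longrightarrow> R s' \<tau>'"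
          have "s4 (vPass, 0, 0, 0) = of_nat p" "s4 (aCount, p, v, Suc i) = of_nat (S (v, Suc i))"
            "s4 (aG, p, v, Suc i) = g (v, Suc i)" "s4 (aWeight, p, v, Suc i) = s3 (aWeight, p, v, Suc i)"
            using 4(1) s3(1) rep3 G[of "(v, Suc i)"] by (simp_all add: out_frame_def)
          then show "wp I (score Passive) R s4 \<tau>4"
            using I(2) 4 R by (intro wp_score_Passive[where p = p and v = v and i = i and T = T]) simp_all
        next
          fix s' \<tau>'
          assume "out_frame s3 s'" "\<And>v i. v < n \<Longrightarrow> i < T \<Longrightarrow> s' (aOut, v * T + i, 0, 0) =
              s3 (aOut, v * T + i, 0, 0) + (if v = r then 0 else ?sc v (Suc i))"
            "\<tau>' \<le> \<tau>3 + 1 + n * (4 + T * (2 + 1))"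
          from fin[OF this(1,2) _ this(3)] show "Q s' \<tau>'"
            using sc Passive by simp
        qed simp
      next
        case Active
        obtain D0 S0 where cyc0: "\<And>v. v < n \<Longrightarrow> bfs_tree strict 0 (set es) v (D0 v) (S0 v)"
          "\<And>v i j. v < n \<Longrightarrow> s (aDist, v, i, j) = of_nat (D0 v (i, j))"
          "\<And>v i j. v < n \<Longrightarrow> s (aCount, v, i, j) = of_nat (S0 v (i, j))"
          using cyc unfolding cycle_rep_def by metis
        \<comment> \<open>By \<open>sum_dsum\<close> these prefix sums are the contribution of the
          waits that span the current time.\<close>
        define acc where "acc = (\<lambda>v i. \<Sum>j\<in>{1..i}. dsum g tight v j)"
        let ?sc = "\<lambda>v t. (of_nat (S (v, t)) - of_nat (overlap (D0 v) (S0 v) (v, t))) * (g (v, t) - s3 (aWeight, p, v, t)) + acc v t"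
        have sc: "real_of_rat (?sc v t) = source_scores strict md c n T (set es) r v t" if vt: "v \<noteq> r" "v < n" "1 \<le> t" for v t
        proof -
          interpret bfs_trees strict K "set es" r D S v "D0 v" "S0 v"
            using tree cyc0(1)[OF vt(2)] vt(1) by (intro bfs_trees.intro bfs_trees_axioms.intro)
          have "source_scores strict md c n T (set es) r v t = real_of_rat ((of_nat (S (v, t)) -
              of_nat (overlap (D0 v) (S0 v) (v, t))) * (g (v, t) - weight a (v, t)) + acc v t)"
            unfolding scores[OF vt(1)] unfolding Active acc_def sum_dsum
            by (rule arg_cong[where f = real_of_rat], rule sum_active[OF _ vt(3)]) (rule g)
          then show ?thesis
            using W[of "(v, t)"] unreached[of "(v, t)"] overlap_unreached[OF vt(3)] Active
            by (cases "D (v, t) = 0") simp_all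
        qed
        show ?thesis
          unfolding Active
        proof (rule wp_accumulate[where acc = acc and c = ?sc and k = "4 + 3 * T" and I = I and n = n and T = T and r = r and ?s0.0 = s3, OF I s3(2)])
          fix v i s4 \<tau>4 and R :: "store \<Rightarrow> nat \<Rightarrow> bool"
          assume v: "v < n" "v \<noteq> r" "i < T" and 4: "out_frame s3 s4" "s4 (vV, 0, 0, 0) = of_nat v" "s4 (vI, 0, 0, 0) = of_nat i"
            "s4 (vT, 0, 0, 0) = of_nat (Suc i)" "s4 (vAcc, 0, 0, 0) = acc v i"
            and R: "\<And>s' \<tau>'. \<lbrakk>out_frame s4 s'; s' (vV, 0, 0, 0) = of_nat v; s' (vAcc, 0, 0, 0) = acc v (Suc i);
              scored s4 (v * T + i) (?sc v (Suc i)) s'; \<tau>' \<le> \<tau>4 + (4 + 3 * T)\<rbrakk> \<Longrightarrow> R s' \<tau>'"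
          have s4: "s4 (vPass, 0, 0, 0) = of_nat p" "s4 (vWin, 0, 0, 0) = of_nat K"
            "s4 (aG, p, v, Suc i) = g (v, Suc i)" "s4 (aWeight, p, v, Suc i) = s3 (aWeight, p, v, Suc i)"
            "s4 (aDiff, p, v, Suc i) = dsum g tight v (Suc i)"
            "\<And>j. s4 (aDist, p, v, j) = of_nat (D (v, j))" "\<And>j. s4 (aCount, p, v, j) = of_nat (S (v, j))"
            using 4(1) s3 rep3 diff G[of "(v, Suc i)"] by (simp_all add: out_frame_def)
          have s4c: "s4 (aDist, v, v, Suc i) = of_nat (D0 v (v, Suc i))" "s4 (aCount, v, v, Suc i) = of_nat (S0 v (v, Suc i))"
            using 4(1) F cyc0(2,3)[OF v(1)] v(1) p by (simp_all add: out_frame_def frame_def)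
          have acc: "acc v (Suc i) = acc v i + dsum g tight v (Suc i)"
            by (simp add: acc_def)
          show "wp I (score Active) R s4 \<tau>4"
            using R
            by (intro wp_score_Active[where s = s4 and p = p and v = v and i = i and T = T and I = I and K = K and ?D0.0 = "D0 v" and ?S0.0 = "S0 v" and D = D and S = S, OF tree I(2) s4(1) 4(2-4) s4(2) v(3) s4(6,7) s4c]) (simp add: 4(5) s4 acc)
        next
          fix s' \<tau>'
          assume "out_frame s3 s'" "\<And>v i. v < n \<Longrightarrow> i < T \<Longrightarrow> s' (aOut, v * T + i, 0, 0) =
              s3 (aOut, v * T + i, 0, 0) + (if v = r then 0 else ?sc v (Suc i))"
            "\<tau>' \<le> \<tau>3 + 1 + n * (4 + T * (2 + (4 + 3 * T)))"
          from fin[OF this(1,2) _ this(3)] show "Q s' \<tau>'"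
            using sc Active wf(3) by simp
        qed (simp add: acc_def)
      qed
    qed
  qed
qed (use fresh in auto)

section \<open>The whole program\<close>

text \<open>For \<open>T = 0\<close> both bounds vanish and only constant time is allowed, so the
  loops over sources must make no round at all. The factor \<open>Lt (Num 0) (In (Num 1))\<close>
  sees to that.\<close>

abbreviation (input) "sources \<equiv> Times (In (Num 0)) (Lt (Num 0) (In (Num 1)))"

text \<open>The register \<open>vWin\<close> is initially 0, so the first searches only find walks inside a snapshot;
  the search from \<open>v\<close> counts the shortest cycles through \<open>v\<close> in every snapshot.\<close>

definition program :: "bool \<Rightarrow> mode \<Rightarrow> aexp \<Rightarrow> aexp \<Rightarrow> acom" where
  "program strict md window weight =
     (load_graph;;
      Put vA weight;;
      For vS sources (Put vPass (V vS);; Put vRoot (V vS);; bfs strict);;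
      Put vWin window;;
      For vS sources (Put vPass (Plus (In (Num 0)) (V vS));; Put vRoot (V vS);; process_source strict md))"

lemma cycle_rep_cong:
  "cycle_rep strict n E s \<Longrightarrow> (\<And>c i j l. i < n \<Longrightarrow> c \<in> {aDist, aCount} \<Longrightarrow> s' (c, i, j, l) = s (c, i, j, l)) \<Longrightarrow> cycle_rep strict n E s'"
  unfolding cycle_rep_def by (metis insertCI)

lemma idx_sources:
  assumes "I 0 = of_nat n" "I 1 = of_nat T"
  shows "idx (aval I sources s) = (if T = 0 then 0 else n)"
  using assms by simp

lemma wp_cycles:
  assumes wf: "wf_tgraph n T es" "1 \<le> T" and I: "I 0 = of_nat n" "I 1 = of_nat T" and adj: "adj_rep es s"
    and win: "s (vWin, 0, 0, 0) = 0"
    and fresh: "\<And>c i j l. 4 \<le> c \<Longrightarrow> c \<le> 13 \<Longrightarrow> s (c, i, j, l) = 0"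
    and Q: "\<And>s' \<tau>'. \<lbrakk>cycle_rep strict n (set es) s'; \<And>c i j l. c < 17 \<or> c = vA \<Longrightarrow>
        \<not> (4 \<le> c \<and> c \<le> 8 \<and> i < n) \<Longrightarrow> s' (c, i, j, l) = s (c, i, j, l); 
        \<tau>' \<le> \<tau> + 1 + n * (23 + 20 * (n * T) + 11 * (length es * Suc T))\<rbrakk> \<Longrightarrow> Q s' \<tau>'"
  shows "wp I (For vS sources (Put vPass (V vS);; Put vRoot (V vS);; bfs strict)) Q s \<tau>"
proof -
  let ?k = "23 + 20 * (n * T) + 11 * (length es * Suc T)"
  define J where "J = (\<lambda>v s' \<tau>'. cycle_rep strict v (set es) s' \<and> (\<forall>c i j l. c < 17 \<or> c = vA \<or> c = vWin \<longrightarrow>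
      \<not> (4 \<le> c \<and> c \<le> 8 \<and> i < v) \<longrightarrow> s' (c, i, j, l) = s (c, i, j, l)) \<and> \<tau>' \<le> \<tau> + 1 + v * ?k)"
  show ?thesis
  proof (rule wp_For[where N = n and J = J])
    show "idx (aval I sources s) = n"
      using idx_sources[OF I] wf(2) by simp
    show "J 0 s (Suc \<tau>)"
      by (simp add: J_def cycle_rep_def)
  next
    fix v s1 \<tau>1 assume v: "v < n" and J: "J v s1 \<tau>1"
    then have 1: "cycle_rep strict v (set es) s1" "\<And>c i j l. c < 17 \<or> c = vA \<or> c = vWin \<Longrightarrow>
      \<not> (4 \<le> c \<and> c \<le> 8 \<and> i < v) \<Longrightarrow> s1 (c, i, j, l) = s (c, i, j, l)" "\<tau>1 \<le> \<tau> + 1 + v * ?k"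
      unfolding J_def by blast+
    let ?s = "s1((vS, 0, 0, 0) := of_nat v, (vPass, 0, 0, 0) := of_nat v, (vRoot, 0, 0, 0) := of_nat v)"
    have "wp I (bfs strict) (J (Suc v)) ?s (Suc (Suc (Suc \<tau>1)))"
    proof (rule wp_bfs[where p = v and r = v and K = 0, OF wf(1) v I])
      show "adj_rep es ?s"
        using adj 1(2) by (simp add: adj_rep_def)
      show "?s (aDist, v, i, j) = 0" "?s (aCount, v, i, j) = 0" for i j
        using fresh 1(2) by simp_all
    next
      fix s' \<tau>' D S qs
      assume 2: "bfs_tree strict 0 (set es) v D S" "bfs_rep v s' D S qs" "bfs_frame v ?s s'"
        "\<tau>' \<le> Suc (Suc (Suc \<tau>1)) + 20 + 20 * (n * T) + 11 * (length es * Suc T)"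
      have "cycle_rep strict (Suc v) (set es) s'"
        unfolding cycle_rep_def
      proof (intro allI impI)
        fix u assume u: "u < Suc v"
        show "\<exists>D0 S0. bfs_tree strict 0 (set es) u D0 S0 \<and>
          (\<forall>i j. s' (aDist, u, i, j) = of_nat (D0 (i, j)) \<and> s' (aCount, u, i, j) = of_nat (S0 (i, j)))"
        proof (cases "u = v")
          case True
          then show ?thesis
            using 2(1,2) by (intro exI[of _ D] exI[of _ S]) (simp add: bfs_rep_def)
        next
          case False
          then have "s' (aDist, u, i, j) = s1 (aDist, u, i, j)" "s' (aCount, u, i, j) = s1 (aCount, u, i, j)" for i j
            using 2(3) by (simp_all add: bfs_frame_def)
          then show ?thesis
            using 1(1) u False by (simp add: cycle_rep_def)
        qed
      qed
      moreover have "s' (c, i, j, l) = s (c, i, j, l)" if "c < 17 \<or> c = vA \<or> c = vWin" "\<not> (4 \<le> c \<and> c \<le> 8 \<and> i < Suc v)" for c i j l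
      proof -
        have "s' (c, i, j, l) = ?s (c, i, j, l)"
          by (rule 2(3)[unfolded bfs_frame_def, rule_format]) (use that in auto)
        also have "\<dots> = s1 (c, i, j, l)"
          using that(1) by auto
        also have "\<dots> = s (c, i, j, l)"
          by (rule 1(2)) (use that in auto)
        finally show ?thesis .
      qed
      moreover have "\<tau>' \<le> \<tau> + 1 + Suc v * ?k"
        using 2(4) 1(3) by simp
      ultimately show "J (Suc v) s' \<tau>'"
        unfolding J_def by blast
    qed (use win 1(2) in simp_all)
    then show "wp I (Put vPass (V vS);; Put vRoot (V vS);; bfs strict) (J (Suc v)) (s1((vS, 0, 0, 0) := of_nat v)) (Suc \<tau>1)"
      by simp
  next
    fix s' \<tau>' assume "J n s' \<tau>'"
    then show "Q s' \<tau>'"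
      using Q[of s' \<tau>'] unfolding J_def by blast
  qed
qed

lemma wp_sources:
  assumes wf: "wf_tgraph n T es" "1 \<le> T" and I: "I 0 = of_nat n" "I 1 = of_nat T"
    and obj: "objective strict c n (set es) K a"
    and adj: "adj_rep es s" and cyc: "cycle_rep strict n (set es) s"
    and s: "s (vWin, 0, 0, 0) = of_nat K" "s (vA, 0, 0, 0) = of_nat a" "\<And>i. s (aOut, i, 0, 0) = 0"
    and fresh: "\<And>c p i j. 4 \<le> c \<Longrightarrow> c \<le> 13 \<Longrightarrow> n \<le> p \<Longrightarrow> s (c, p, i, j) = 0"
    and Q: "\<And>s' \<tau>'. \<lbrakk>\<And>v i. v < n \<Longrightarrow> i < T \<Longrightarrow>
        real_of_rat (s' (aOut, v * T + i, 0, 0)) = betweenness strict md c n T (set es) v (Suc i);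
       \<tau>' \<le> \<tau> + 1 + n * (3 + 100 * (n * T * (case md of Passive \<Rightarrow> 1 | Active \<Rightarrow> T) + length es * T))\<rbrakk> \<Longrightarrow> Q s' \<tau>'"
  shows "wp I (For vS sources (Put vPass (Plus (In (Num 0)) (V vS));; Put vRoot (V vS);; process_source strict md)) Q s \<tau>"
proof -
  let ?k = "3 + 100 * (n * T * (case md of Passive \<Rightarrow> 1 | Active \<Rightarrow> T) + length es * T)"
  let ?b = "\<lambda>r v t. source_scores strict md c n T (set es) r v t"
  define J where "J = (\<lambda>r s' \<tau>'. (\<forall>b i j l. 0 < b \<longrightarrow> b < 17 \<or> b = vA \<or> b = vWin \<longrightarrow> \<not> (4 \<le> b \<and> b \<le> 13 \<and> n \<le> i \<and> i < n + r) \<longrightarrow>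
      s' (b, i, j, l) = s (b, i, j, l)) \<and>
     (\<forall>v<n. \<forall>i<T. real_of_rat (s' (aOut, v * T + i, 0, 0)) = (\<Sum>q<r. ?b q v (Suc i))) \<and> \<tau>' \<le> \<tau> + 1 + r * ?k)"
  show ?thesis
  proof (rule wp_For[where N = n and J = J])
    show "idx (aval I sources s) = n"
      using idx_sources[OF I] wf(2) by simp
    show "J 0 s (Suc \<tau>)"
      using s by (simp add: J_def)
  next
    fix r s1 \<tau>1 assume r: "r < n" and "J r s1 \<tau>1"
    then have 1: "\<And>b i j l. 0 < b \<Longrightarrow> b < 17 \<or> b = vA \<or> b = vWin \<Longrightarrow> \<not> (4 \<le> b \<and> b \<le> 13 \<and> n \<le> i \<and> i < n + r) \<Longrightarrow>
      s1 (b, i, j, l) = s (b, i, j, l)"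
      "\<And>v i. v < n \<Longrightarrow> i < T \<Longrightarrow> real_of_rat (s1 (aOut, v * T + i, 0, 0)) = (\<Sum>q<r. ?b q v (Suc i))" "\<tau>1 \<le> \<tau> + 1 + r * ?k"
      unfolding J_def by blast+
    let ?s = "s1((vS, 0, 0, 0) := of_nat r, (vPass, 0, 0, 0) := of_nat (n + r), (vRoot, 0, 0, 0) := of_nat r)"
    have "wp I (process_source strict md) (J (Suc r)) ?s (Suc (Suc (Suc \<tau>1)))"
    proof (rule wp_process_source[where p = "n + r" and r = r and K = K and a = a, OF wf(1) r wf(2) I obj])
      show "adj_rep es ?s"
        using adj 1(1) by (simp add: adj_rep_def)
      show "cycle_rep strict n (set es) ?s"
        by (rule cycle_rep_cong[OF cyc]) (use 1(1) in auto)
      show "?s (b, n + r, i, j) = 0" if "4 \<le> b" "b \<le> 13" for b i j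
        using fresh 1(1) that by simp
    next
      fix s' \<tau>'
      assume 2: "\<And>b i j l. 0 < b \<Longrightarrow> b < 23 \<Longrightarrow> \<not> (4 \<le> b \<and> b \<le> 13 \<and> i = n + r) \<Longrightarrow> s' (b, i, j, l) = ?s (b, i, j, l)"
        "\<And>v i. v < n \<Longrightarrow> i < T \<Longrightarrow> real_of_rat (s' (aOut, v * T + i, 0, 0)) =
          real_of_rat (?s (aOut, v * T + i, 0, 0)) + ?b r v (Suc i)"
        "\<tau>' \<le> Suc (Suc (Suc \<tau>1)) + 100 * (n * T * (case md of Passive \<Rightarrow> 1 | Active \<Rightarrow> T) + length es * T)"
      have "s' (b, i, j, l) = s (b, i, j, l)"
        if "0 < b" "b < 17 \<or> b = vA \<or> b = vWin" "\<not> (4 \<le> b \<and> b \<le> 13 \<and> n \<le> i \<and> i < n + Suc r)" for b i j l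
      proof -
        have "s' (b, i, j, l) = ?s (b, i, j, l)"
          by (rule 2(1)) (use that in auto)
        also have "\<dots> = s1 (b, i, j, l)"
          using that(2) by auto
        also have "\<dots> = s (b, i, j, l)"
          by (rule 1(1)) (use that in auto)
        finally show ?thesis .
      qed
      moreover have "real_of_rat (s' (aOut, v * T + i, 0, 0)) = (\<Sum>q<Suc r. ?b q v (Suc i))" if "v < n" "i < T" for v i
        using 2(2)[OF that] 1(2)[OF that] by simp
      moreover have "\<tau>' \<le> \<tau> + 1 + Suc r * ?k"
        using 2(3) 1(3) by simp
      ultimately show "J (Suc r) s' \<tau>'"
        unfolding J_def by blast
    qed (use s 1(1) in simp_all)
    then show "wp I (Put vPass (Plus (In (Num 0)) (V vS));; Put vRoot (V vS);; process_source strict md) (J (Suc r))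
        (s1((vS, 0, 0, 0) := of_nat r)) (Suc \<tau>1)"
      using I by simp
  next
    fix s' \<tau>' assume "J n s' \<tau>'"
    then show "Q s' \<tau>'"
      using betweenness_source_scores unfolding J_def by (intro Q) auto
  qed
qed

lemma wp_For_0: "idx (aval I e s) = 0 \<Longrightarrow> Q s (Suc \<tau>) \<Longrightarrow> wp I (For x e c) Q s \<tau>"
  by (rule wp_For[where N = 0 and J = "\<lambda>_ s' \<tau>'. s' = s \<and> \<tau>' = Suc \<tau>"]) auto

text \<open>For positive \<open>T\<close> the lower terms are dominated: \<open>n\<close> by
  \<open>n * (n * T)\<close>, and \<open>m\<close> by \<open>n * (m * T)\<close> because arcs
  require a node.\<close>

lemma total_time_bound:
  fixes \<tau> n T m f :: nat
  assumes "\<tau> \<le> \<tau>2 + 1 + 1 + n * (3 + 100 * (n * T * f + m * T))"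
    "\<tau>2 \<le> \<tau>1 + 1 + 1 + n * (23 + 20 * (n * T) + 11 * (m * Suc T))" "\<tau>1 \<le> 1 + 5 * m"
    and "1 \<le> T" "1 \<le> f" "m = 0 \<or> 1 \<le> n"
  shows "\<tau> \<le> 200 * (n * (n * T * f + m * T) + 1)"
proof -
  let ?X = "n * (n * T * f)" and ?Y = "n * (m * T)"
  have "n * T \<le> n * T * f"
    using assms(5) by (cases f) simp_all
  then have X2: "n * (n * T) \<le> ?X"
    by (rule mult_le_mono2)
  have "n * 1 \<le> n * (n * T)" if "1 \<le> n"
    using assms(4) that by (intro mult_le_mono2) (metis mult_le_mono mult_1)
  then have X: "n \<le> ?X" "n * (n * T) \<le> ?X"
    using X2 by (cases "n = 0"; simp)+
  have "m \<le> m * T"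
    using assms(4) by (cases T) simp_all
  moreover from this have "n * m \<le> ?Y"
    by (rule mult_le_mono2)
  moreover have "m \<le> n * m"
    using assms(6) by (cases n) auto
  ultimately have Y: "m \<le> ?Y" "n * m \<le> ?Y"
    by simp_all
  have "\<tau> \<le> 6 + 26 * n + 20 * (n * (n * T)) + 100 * ?X + 111 * ?Y + 11 * (n * m) + 5 * m"
    using assms(1-3) by (simp add: distrib_left)
  \<comment> \<open>Products become variables again, which leaves a linear estimate.\<close>
  moreover have "\<tau> \<le> 200 * (x + y + 1)"
    if "\<tau> \<le> 6 + 26 * n + 20 * w + 100 * x + 111 * y + 11 * z + 5 * m" "n \<le> x" "w \<le> x" "m \<le> y" "z \<le> y" for w x y z
    using that by simp
  ultimately show ?thesis
    using X Y unfolding distrib_left[of n] by blast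
qed

lemma wp_program:
  assumes wf: "wf_tgraph n T es" and I: "I 0 = of_nat n" "I 1 = of_nat T" "I 2 = of_nat (length es)"
    and arcs: "\<And>i. i < length es \<Longrightarrow> I (4 + 3 * i) = of_nat (src (es ! i)) \<and> I (5 + 3 * i) = of_nat (dst (es ! i)) \<and>
       I (6 + 3 * i) = of_nat (tm (es ! i))"
    and obj: "objective strict c n (set es) K a" "\<And>s. aval I window s = of_nat K" "\<And>s. aval I weight s = of_nat a"
  shows "wp I (program strict md window weight) (\<lambda>s \<tau>. (\<forall>v<n. \<forall>i<T.
      real_of_rat (s (aOut, v * T + i, 0, 0)) = betweenness strict md c n T (set es) v (Suc i)) \<and>
      \<tau> \<le> 200 * (n * (n * T * (case md of Passive \<Rightarrow> 1 | Active \<Rightarrow> T) + length es * T) + 1)) (\<lambda>_. 0) 0"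
    (is "wp I _ ?Q _ _")
  unfolding program_def wp_simps(3)
proof (rule wp_load_graph[OF I(3) arcs])
  fix s1 \<tau>1
  assume 1: "adj_rep es s1" "\<And>c i j l. c = 0 \<or> 3 < c \<Longrightarrow> c < 23 \<Longrightarrow> s1 (c, i, j, l) = 0" "\<tau>1 \<le> 0 + 1 + 5 * length es"
  let ?s1 = "s1((vA, 0, 0, 0) := of_nat a)"
  let ?R = "wp I (Put vWin window) (wp I (For vS sources
    (Put vPass (Plus (In (Num 0)) (V vS));; Put vRoot (V vS);; process_source strict md)) ?Q)"
  have "wp I (For vS sources (Put vPass (V vS);; Put vRoot (V vS);; bfs strict)) ?R ?s1 (Suc \<tau>1)"
  proof (cases "T = 0")
    case True
    then have "es = []"
      using wf by (cases es) (auto simp: wf_tgraph_def)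
    then show ?thesis
      using True 1(3) idx_sources[OF I(1,2)] unfolding wp_simps(2) by (intro wp_For_0) simp_all
  next
    case False
    then have T: "1 \<le> T"
      by simp
    show ?thesis
    proof (rule wp_cycles[OF wf T I(1,2)])
      show "adj_rep es ?s1"
        using 1(1) by (simp add: adj_rep_def)
    next
      fix s2 \<tau>2
      assume 2: "cycle_rep strict n (set es) s2" "\<And>c i j l. c < 17 \<or> c = vA \<Longrightarrow>
        \<not> (4 \<le> c \<and> c \<le> 8 \<and> i < n) \<Longrightarrow> s2 (c, i, j, l) = ?s1 (c, i, j, l)"
        "\<tau>2 \<le> Suc \<tau>1 + 1 + n * (23 + 20 * (n * T) + 11 * (length es * Suc T))"
      let ?s2 = "s2((vWin, 0, 0, 0) := of_nat K)"
      have "wp I (For vS sources (Put vPass (Plus (In (Num 0)) (V vS));; Put vRoot (V vS);; process_source strict md)) ?Q ?s2 (Suc \<tau>2)"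
      proof (rule wp_sources[OF wf T I(1,2) obj(1)])
        show "adj_rep es ?s2"
          using 1(1) 2(2) by (simp add: adj_rep_def)
        show "cycle_rep strict n (set es) ?s2"
          by (rule cycle_rep_cong[OF 2(1)]) auto
        show "?s2 (aOut, i, 0, 0) = 0" for i
          using 1(2) 2(2) by simp
        show "?s2 (c, p, i, j) = 0" if "4 \<le> c" "c \<le> 13" "n \<le> p" for c p i j
          using 1(2) 2(2) that by simp
      next
        fix s' :: store and \<tau>'
        assume 3: "\<And>v i. v < n \<Longrightarrow> i < T \<Longrightarrow>
          real_of_rat (s' (aOut, v * T + i, 0, 0)) = betweenness strict md c n T (set es) v (Suc i)"
          "\<tau>' \<le> Suc \<tau>2 + 1 + n * (3 + 100 * (n * T * (case md of Passive \<Rightarrow> 1 | Active \<Rightarrow> T) + length es * T))"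
        have "length es = 0 \<or> 1 \<le> n"
          using wf by (cases es) (auto simp: wf_tgraph_def)
        then have "\<tau>' \<le> 200 * (n * (n * T * (case md of Passive \<Rightarrow> 1 | Active \<Rightarrow> T) + length es * T) + 1)"
          using 1(3) 2(3) 3(2) T by (intro total_time_bound[of \<tau>' \<tau>2 n T _ "length es" \<tau>1]) (auto split: mode.splits)
        then show "?Q s' \<tau>'"
          using 3(1) by blast
      qed (use 2(2) in simp_all)
      then show "?R s2 \<tau>2"
        using obj(2) by simp
    qed (use 1(2) in simp_all)
  qed
  then show "wp I (Put vA weight) (wp I (For vS sources (Put vPass (V vS);; Put vRoot (V vS);; bfs strict)) ?R) s1 \<tau>1"
    using obj(3) by simp
qed simp_all

section \<open>Uniform programs for each cost\<close>

text \<open>\<open>window\<close> and \<open>weight\<close> are expressions over the input rather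
  than numbers: one program has to serve all \<open>k\<close>, which it reads from cell 3.\<close>

definition realizes :: "bool \<Rightarrow> aexp \<Rightarrow> aexp \<Rightarrow> cost \<Rightarrow> nat \<Rightarrow> bool" where
  "realizes strict window weight c k \<longleftrightarrow> (\<forall>n T es. wf_tgraph n T es \<longrightarrow> (\<exists>K a. objective strict c n (set es) K a \<and>
     (\<forall>s. aval (\<lambda>i. input n T es k (int i)) window s = of_nat K) \<and>
     (\<forall>s. aval (\<lambda>i. input n T es k (int i)) weight s = of_nat a)))"

text \<open>\<open>C\<close> comes from the compilation of the program text and is chosen before
  \<open>c\<close> and \<open>k\<close>, so it is the same for all restless windows.\<close>

lemma program_computes:
  "\<exists>C. \<forall>c k. realizes strict window weight c k \<longrightarrow>
    computes_betweenness (comp 0 (program strict md window weight)) C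
      (case md of Passive \<Rightarrow> bound_passive | Active \<Rightarrow> bound_active) strict md c k"
proof -
  let ?P = "program strict md window weight"
  obtain C where C: "\<And>I N M Q. \<lbrakk>represents I N M (\<lambda>_. 0); wp I ?P Q (\<lambda>_. 0) 0\<rbrakk> \<Longrightarrow>
    \<exists>k M' s \<tau>. exec (comp 0 ?P) M k M' \<and> k \<le> C * \<tau> \<and> Q s \<tau> \<and> represents I N M' s"
    using exec_comp[of ?P] by metis
  let ?f = "case md of Passive \<Rightarrow> bound_passive | Active \<Rightarrow> bound_active"
  show ?thesis
  proof (rule exI[of _ "C * 200"], intro allI impI)
    fix c k
    assume obj: "realizes strict window weight c k"
    show "computes_betweenness (comp 0 ?P) (C * 200) ?f strict md c k"
      unfolding computes_betweenness_def
    proof (intro allI impI)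
      fix n T es assume wf: "wf_tgraph n T es"
      let ?M = "input n T es k"
      define I where "I = (\<lambda>i. ?M (int i))"
      obtain K a where obj: "objective strict c n (set es) K a" "\<And>s. aval I window s = of_nat K" "\<And>s. aval I weight s = of_nat a"
        using obj wf unfolding realizes_def I_def by blast
      have I: "I 0 = of_nat n" "I 1 = of_nat T" "I 2 = of_nat (length es)"
        by (simp_all add: I_def input_def)
      have arcs: "I (4 + 3 * i) = of_nat (src (es ! i)) \<and> I (5 + 3 * i) = of_nat (dst (es ! i)) \<and>
         I (6 + 3 * i) = of_nat (tm (es ! i))" if "i < length es" for i
        using input_arc[OF that] unfolding I_def by blast
      have neg: "?M x = 0" if "x < 0" for x
        using that by (simp add: input_def)
      \<comment> \<open>All negative cells are 0 initially, so every array starts cleared.\<close>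
      have "?M (addr (n * T) b i j l) = 0" for b i j l
        using addr_less[of "n * T" b i j l] by (intro neg) linarith
      then have "represents I (n * T) ?M (\<lambda>_. 0)"
        using I neg unfolding represents_def by (simp add: I_def)
      from C[OF this wp_program[OF wf I arcs obj]] obtain t M' s \<tau> where
        M': "exec (comp 0 ?P) ?M t M'" "t \<le> C * \<tau>" "represents I (n * T) M' s"
        "\<forall>v<n. \<forall>i<T. real_of_rat (s (aOut, v * T + i, 0, 0)) = betweenness strict md c n T (set es) v (Suc i)"
        "\<tau> \<le> 200 * (n * (n * T * (case md of Passive \<Rightarrow> 1 | Active \<Rightarrow> T) + length es * T) + 1)"
        by blast
      have "n * (n * T * (case md of Passive \<Rightarrow> 1 | Active \<Rightarrow> T) + length es * T) = ?f n T (length es)"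
        by (cases md) (simp_all add: bound_passive_def bound_active_def power2_eq_square algebra_simps)
      from mult_le_mono2[OF M'(5)[unfolded this], of C] have "C * \<tau> \<le> C * 200 * (?f n T (length es) + 1)"
        unfolding mult.assoc .
      moreover have "real_of_rat (M' (out_addr T v t)) = betweenness strict md c n T (set es) v t"
        if v: "v < n" and t: "t \<in> {1..T}" for v t
      proof -
        have lt: "v * T + (t - 1) < n * T"
        proof -
          have "t - 1 < T"
            using t by auto
          then have "v * T + (t - 1) < Suc v * T"
            by simp
          also have "\<dots> \<le> n * T"
            using v by (intro mult_le_mono1) simp
          finally show ?thesis .
        qed
        have "M' (- 1 - int (v * T + (t - 1))) = s (aOut, v * T + (t - 1), 0, 0)"
          using M'(3) lt unfolding represents_def by blast
        moreover have "t - 1 < T" "Suc (t - 1) = t"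
          using t by auto
        ultimately show ?thesis
          using M'(4) v unfolding out_addr_def by metis
      qed
      ultimately show "\<exists>steps s'. exec (comp 0 ?P) ?M steps s' \<and> steps \<le> C * 200 * (?f n T (length es) + 1) \<and>
          (\<forall>v<n. \<forall>t\<in>{1..T}. real_of_rat (s' (out_addr T v t)) = betweenness strict md c n T (set es) v t)"
        using M'(1,2) le_trans by blast
    qed
  qed
qed

theorem theorem1:
  shows "(\<forall>strict. \<exists>P C. computes_betweenness P C bound_passive strict Passive (Restless \<infinity>) 0)
   \<and> (\<forall>strict. \<exists>P C. \<forall>k::nat. computes_betweenness P C bound_passive strict Passive (Restless (enat k)) k)
   \<and> (\<forall>strict. \<exists>P C. computes_betweenness P C bound_passive strict Passive Foremost 0)
   \<and> (\<forall>strict. \<exists>P C. computes_betweenness P C bound_active strict Active (Restless \<infinity>) 0)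
   \<and> (\<forall>strict. \<exists>P C. \<forall>k::nat. computes_betweenness P C bound_active strict Active (Restless (enat k)) k)"
proof -
  have input: "input n T es k 0 = of_nat n" "input n T es k 1 = of_nat T" "input n T es k 3 = of_nat k" for n T es k
    by (simp_all add: input_def)
  have shortest: "realizes strict (In (Num 1)) (Num 0) (Restless \<infinity>) 0" for strict
    using objective_shortest input unfolding realizes_def
    by (intro allI impI) (metis aval.simps(1,2) idx_numeral(2) of_nat_0 of_nat_1)
  have restless: "realizes strict (In (Num 3)) (Num 0) (Restless (enat k)) k" for strict k
    using objective_restless input unfolding realizes_def
    by (intro allI impI exI[of _ k] exI[of _ 0]) simp
  have foremost: "realizes strict (In (Num 1)) (In (Num 0)) Foremost 0" for strict
    using objective_foremost input unfolding realizes_def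
    by (intro allI impI) (metis aval.simps(1,2) idx_numeral(1,2) of_nat_0 of_nat_1)
  show ?thesis
    using program_computes[where md = Passive, unfolded mode.case] program_computes[where md = Active, unfolded mode.case]
      shortest restless foremost by meson
qed

end
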